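(* Let $\boldsymbol{a}=(a_1,\ldots,a_n)\in\mathbb{Z}^n$ be the weight vector of an effective linear action of $\mathbb{C}^\times$ on $\mathbb{C}^n$, i.e. $\gcd(a_1,\ldots,a_n)=1$. Assume that there is an integer $k$ with $0<k<n$ such that $a_i<0$ for $i\leq k$ and $a_i>0$ for $i>k$. Then \begin{align*} \gamma_2(\boldsymbol{a})={}&\frac{5E_1(\boldsymbol{a})S_{n-3}(\boldsymbol{a})-\big(E_2(\boldsymbol{a})+E_1(\boldsymbol{a})^2\big)S_{n-4}(\boldsymbol{a})-4S_{n-2}(\boldsymbol{a})}{12\,D(\boldsymbol{a})}\\ &+\sum_{j=1}^n\frac{1-g_j^2}{12}\cdot\frac{S_{n-3}(\boldsymbol{a}_j)-a_jS_{n-4}(\boldsymbol{a}_j)}{D(\boldsymbol{a}_j)}\\ &+\sum_{j=1}^n\frac{g_j-1}{4}\cdot\frac{E_1(\boldsymbol{a}_j)S_{n-4}(\boldsymbol{a}_j)-S_{n-3}(\boldsymbol{a}_j)}{D(\boldsymbol{a}_j)}\\ &+\sum_{1\leq j<\ell\leq n}\frac{-S_{n-4}(\boldsymbol{a}_{j,\ell})}{D(\boldsymbol{a}_{j,\ell})}\sum_{\substack{\zeta^{g_{j,\ell}}=1\\ \zeta^{g_j}\neq1,\ \zeta^{g_\ell}\neq1}}\frac{1}{(1-\zeta^{a_j})(1-\zeta^{a_\ell})}. \end{align*} When moreover $a_i\neq a_j$ for all $i\neq j$ with $i,j\leq k$, this can be expressed as \begin{align*} \gamma_2(\boldsymbol{a})={}&\sum_{i=1}^k\frac{a_i^{n-4}}{12\prod\limits_{\substack{j=1\\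 j\neq i}}^n(a_i-a_j)}\Bigg(\sum_{\substack{j=1\\ j\neq i}}^n(2a_i-a_j)a_j-3\sum_{\substack{1\leq j<\ell\leq n\\ j,\ell\neq i}}a_ja_\ell\Bigg)\\ &+\sum_{i=1}^k\sum_{\substack{j=1\\ j\neq i}}^n\Bigg(\frac{(1-g_j^2)a_i^{n-4}(a_i-a_j)}{12\prod\limits_{\substack{\ell=1\\ \ell\neq i,j}}^n(a_i-a_\ell)}+\frac{g_j-1}{2}\sum_{\substack{\ell=1\\ \ell\neq i,j}}^n\frac{a_i^{n-4}a_\ell}{2\prod\limits_{\substack{p=1\\ p\neq i,j}}^n(a_i-a_p)}\Bigg)\\ &+\sum_{i=1}^k\sum_{\substack{1\leq j<\ell\leq n\\ j,\ell\neq i}}\frac{-a_i^{n-4}}{\prod\limits_{\substack{p=1\\ p\neq i,j,\ell}}^n(a_i-a_p)}\sum_{\substack{\zeta^{g_{j,\ell}}=1\\ \zeta^{g_j}\neq1,\ \zeta^{g_\ell}\neq1}}\frac{1}{(1-\zeta^{a_j})(1-\zeta^{a_\ell})}. \end{align*}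
   Context: The action with weight vector $\boldsymbol{a}$ is $w\cdot(z_1,\ldots,z_n)=(w^{a_1}z_1,\ldots,w^{a_n}z_n)$. $R=\mathbb{C}[\mathbb{C}^n]^{\mathbb{C}^\times_{\boldsymbol{a}}}$ is the algebra of invariant polynomials graded by polynomial degree, of Krull dimension $\dim R=n-1$; $\operatorname{Hilb}_{\boldsymbol{a}}(t)=\sum_{d\geq0}\dim_{\mathbb{C}}(R_d)t^d$ is its Hilbert series (a rational function), and $\gamma_m(\boldsymbol{a})$ are the coefficients of its Laurent expansion at $t=1$: $\operatorname{Hilb}_{\boldsymbol{a}}(t)=\sum_{m\geq 0}\gamma_m(\boldsymbol{a})(1-t)^{m-\dim R}$. $\boldsymbol{a}_j$ (resp. $\boldsymbol{a}_{j,\ell}$) is $\boldsymbol{a}$ with the $j$-th entry (resp. $j$-th and $\ell$-th entries) removed; $g_j=\gcd\{a_i:i\neq j\}$ and $g_{j,\ell}=\gcd\{a_i:i\neq j,\ell\}$ (positive). $E_1,E_2$ are the elementary symmetric polynomials of degree $1,2$ in the entries of the vector. For a vector $\boldsymbol{b}$ of nonzero integers, $D(\boldsymbol{b})=\prod_{b_p<0,\ b_q>0}(b_p-b_q)$, the product over all pairs of a negative entry and a positive entry of $\boldsymbol{b}$ (empty product $=1$). Sums over $\zeta$ run over complex numbers satisfying the stated conditions. For integers $k,m\geq0$ with $N=k+m\geq1$, variables $\boldsymbol{x}=(x_1,\ldots,x_k)$, $\boldsymbol{y}=(y_1,\ldots,y_m)$ and an integer $u\leq N-2$, $S_u(\boldsymbol{x},\boldsymbol{y})=\det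 M/(\operatorname{V}(\boldsymbol{x})\operatorname{V}(\boldsymbol{y}))$, where $\operatorname{V}(x_1,\ldots,x_k)=\prod_{1\leq i<j\leq k}(x_i-x_j)$ and $M$ is the $N\times N$ matrix with first row $(x_1^u,\ldots,x_k^u,0,\ldots,0)$ and $r$-th row $(x_1^{N-r},\ldots,x_k^{N-r},y_1^{N-r},\ldots,y_m^{N-r})$ for $r=2,\ldots,N$. This is a polynomial in $\boldsymbol{y}$ and the $x_i^{\pm1}$, so it may be evaluated also when some variables coincide. $S_u(\boldsymbol{b})$ means $S_u$ evaluated with $\boldsymbol{x}=$ the negative entries and $\boldsymbol{y}=$ the positive entries of $\boldsymbol{b}$; $S_u(\boldsymbol{b})=0$ if $\boldsymbol{b}$ has no negative entries, and any summand involving such a vector (in particular the empty vector) is $0$. *)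

theory Defs
  imports
    Complex_Main
    "HOL-Library.Poly_Mapping"
    "HOL-Computational_Algebra.Formal_Laurent_Series"
    "HOL-Computational_Algebra.Polynomial_FPS"
    "Jordan_Normal_Form.Determinant"
begin

text \<open>
  A polynomial in the variables \<open>z\<^sub>0, z\<^sub>1, \<dots>\<close> is a finitely supported map from monomials
  (finitely supported exponent vectors) to coefficients; its multiplication is the convolution
  product. Points of \<open>\<complex>\<^sup>n\<close> are functions of which only the first \<open>n\<close> values matter, and a weight
  vector of length \<open>n\<close> is an integer list, indexed from \<open>0\<close> to \<open>n - 1\<close>.
\<close>

type_synonym cpoly = "(nat \<Rightarrow>\<^sub>0 nat) \<Rightarrow>\<^sub>0 complex"

definition cpoly_eval :: "cpoly \<Rightarrow> (nat \<Rightarrow> complex) \<Rightarrow> complex" where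
  "cpoly_eval p z =
     (\<Sum>m\<in>Poly_Mapping.keys p. Poly_Mapping.lookup p m *
        (\<Prod>i\<in>Poly_Mapping.keys m. z i ^ Poly_Mapping.lookup m i))"

definition cpoly_scale :: "complex \<Rightarrow> cpoly \<Rightarrow> cpoly" where
  "cpoly_scale c p = Poly_Mapping.single 0 c * p"

lemma vector_space_cpoly_scale: "vector_space cpoly_scale"
  by unfold_locales
    (simp_all add: cpoly_scale_def algebra_simps single_add mult_single flip: mult.assoc)

definition torus_act :: "int list \<Rightarrow> complex \<Rightarrow> (nat \<Rightarrow> complex) \<Rightarrow> (nat \<Rightarrow> complex)" where
  "torus_act a w z = (\<lambda>i. if i < length a then w powi (a ! i) * z i else z i)"

definition invariant_polys :: "int list \<Rightarrow> cpoly set" where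
  "invariant_polys a =
     {p. (\<forall>m\<in>Poly_Mapping.keys p. Poly_Mapping.keys m \<subseteq> {..<length a}) \<and>
         (\<forall>w z. w \<noteq> 0 \<longrightarrow> cpoly_eval p (torus_act a w z) = cpoly_eval p z)}"

definition invariant_polys_deg :: "int list \<Rightarrow> nat \<Rightarrow> cpoly set" where
  "invariant_polys_deg a d =
     {p \<in> invariant_polys a.
        \<forall>m\<in>Poly_Mapping.keys p. (\<Sum>i\<in>Poly_Mapping.keys m. Poly_Mapping.lookup m i) = d}"

definition Hilb :: "int list \<Rightarrow> complex fps" where
  "Hilb a = Abs_fps (\<lambda>d. of_nat (vector_space.dim cpoly_scale (invariant_polys_deg a d)))"

text \<open>
  The Laurent expansion at \<open>t = 1\<close> of a power series \<open>H\<close> in \<open>t\<close> that is a rational function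
  \<open>p / q\<close>: substitute \<open>t = 1 - s\<close> in \<open>p\<close> and \<open>q\<close> and divide as formal Laurent series in
  \<open>s = 1 - t\<close>. The result does not depend on the choice of \<open>p\<close> and \<open>q\<close>.
\<close>

definition laurent_at_1 :: "complex fps \<Rightarrow> complex fls" where
  "laurent_at_1 H =
     (THE L. \<exists>p q :: complex poly. q \<noteq> 0 \<and> H * fps_of_poly q = fps_of_poly p \<and>
        L = fps_to_fls (fps_of_poly (pcompose p [:1, -1:])) /
            fps_to_fls (fps_of_poly (pcompose q [:1, -1:])))"

lemma laurent_at_1_eqI:
  fixes p q :: "complex poly"
  assumes "q \<noteq> 0" "H * fps_of_poly q = fps_of_poly p"
  shows "laurent_at_1 H = fps_to_fls (fps_of_poly (pcompose p [:1, -1:])) /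
            fps_to_fls (fps_of_poly (pcompose q [:1, -1:]))"
proof -
  have nz: "r \<noteq> 0 \<Longrightarrow> fps_to_fls (fps_of_poly (pcompose r [:1, -1:])) \<noteq> 0" for r :: "complex poly"
    by (simp add: pcompose_eq_0_iff fps_to_fls_eq_0_iff)
  { fix p' q' :: "complex poly" assume 2: "q' \<noteq> 0" "H * fps_of_poly q' = fps_of_poly p'"
    have "fps_of_poly (p' * q) = fps_of_poly (p * q')"
      using assms 2 by (simp add: fps_of_poly_mult flip: assms(2) 2(2)) 
    hence e: "p' * q = p * q'" by simp
    have "pcompose p' [:1,-1:] * pcompose q [:1,-1:] = pcompose p [:1,-1:] * pcompose q' [:1,-1:]"
      using e by (metis pcompose_mult)
    hence "fps_to_fls (fps_of_poly (pcompose p' [:1, -1:])) /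
            fps_to_fls (fps_of_poly (pcompose q' [:1, -1:])) = fps_to_fls (fps_of_poly (pcompose p [:1, -1:])) /
            fps_to_fls (fps_of_poly (pcompose q [:1, -1:]))"
      using nz assms 2 by (simp add: frac_eq_eq flip: fls_times_fps_to_fls fps_of_poly_mult)
  } 
  thus ?thesis unfolding laurent_at_1_def using assms by (intro the_equality) blast+
qed

text \<open>The invariant algebra has Krull dimension \<open>n - 1\<close>, whence the shift of the index.\<close>

definition gamma_coeff :: "nat \<Rightarrow> int list \<Rightarrow> complex" where
  "gamma_coeff m a = fls_nth (laurent_at_1 (Hilb a)) (int m - (int (length a) - 1))"

definition elem_sym :: "nat \<Rightarrow> int list \<Rightarrow> int" where
  "elem_sym r b = (\<Sum>I | I \<subseteq> {..<length b} \<and> card I = r. \<Prod>i\<in>I. b ! i)"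

definition del1 :: "int list \<Rightarrow> nat \<Rightarrow> int list" where
  "del1 a j = nths a (- {j})"

definition del2 :: "int list \<Rightarrow> nat \<Rightarrow> nat \<Rightarrow> int list" where
  "del2 a j l = nths a (- {j, l})"

definition g1 :: "int list \<Rightarrow> nat \<Rightarrow> int" where
  "g1 a j = Gcd {a ! i | i. i < length a \<and> i \<noteq> j}"

definition g2 :: "int list \<Rightarrow> nat \<Rightarrow> nat \<Rightarrow> int" where
  "g2 a j l = Gcd {a ! i | i. i < length a \<and> i \<noteq> j \<and> i \<noteq> l}"

definition D_prod :: "int list \<Rightarrow> int" where
  "D_prod b = (\<Prod>(p, q) | p < length b \<and> q < length b \<and> b ! p < 0 \<and> b ! q > 0. b ! p - b ! q)"

text \<open>
  For \<open>length a = 2\<close> the index set of this sum is infinite (\<open>g2 a j l = 0\<close>); the sum is then only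
  used with the factor \<open>0\<close>, coming from the empty vector \<open>del2 a j l\<close>.
\<close>

definition zeta_sum :: "int list \<Rightarrow> nat \<Rightarrow> nat \<Rightarrow> complex" where
  "zeta_sum a j l =
     (\<Sum>\<zeta> | \<zeta> powi g2 a j l = 1 \<and> \<zeta> powi g1 a j \<noteq> 1 \<and> \<zeta> powi g1 a l \<noteq> 1.
        1 / ((1 - \<zeta> powi (a ! j)) * (1 - \<zeta> powi (a ! l))))"

text \<open>
  Laurent polynomials are finitely supported maps on integer exponent vectors; they form an
  integral domain. The variables \<open>0, \<dots>, k - 1\<close> play the role of \<open>x\<^sub>1, \<dots>, x\<^sub>k\<close>, and
  \<open>k, \<dots>, k + m - 1\<close> that of \<open>y\<^sub>1, \<dots>, y\<^sub>m\<close>.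
\<close>

type_synonym laurent_poly = "(nat \<Rightarrow>\<^sub>0 int) \<Rightarrow>\<^sub>0 complex"

definition var_pow :: "nat \<Rightarrow> int \<Rightarrow> laurent_poly" where
  "var_pow i e = Poly_Mapping.single (Poly_Mapping.single i e) 1"

definition laurent_eval :: "laurent_poly \<Rightarrow> (nat \<Rightarrow> complex) \<Rightarrow> complex" where
  "laurent_eval P z =
     (\<Sum>m\<in>Poly_Mapping.keys P. Poly_Mapping.lookup P m *
        (\<Prod>i\<in>Poly_Mapping.keys m. z i powi Poly_Mapping.lookup m i))"

definition vandermonde :: "nat \<Rightarrow> nat \<Rightarrow> laurent_poly" where
  "vandermonde lo hi =
     (\<Prod>(i, j) | lo \<le> i \<and> i < j \<and> j < hi. var_pow i 1 - var_pow j 1)"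

text \<open>Rows are counted from \<open>0\<close>, so the exponent \<open>N - r\<close> becomes \<open>N - 1 - r\<close>.\<close>

definition S_matrix :: "nat \<Rightarrow> nat \<Rightarrow> int \<Rightarrow> laurent_poly mat" where
  "S_matrix k m u = (let N = k + m in
     mat N N (\<lambda>(r, c). if r = 0 then (if c < k then var_pow c u else 0)
                       else var_pow c (int N - 1 - int r)))"

text \<open>
  The quotient of \<open>det M\<close> by the two Vandermonde products is taken in the ring of Laurent
  polynomials, and only then evaluated, so that coinciding values cause no division by zero.
  It is a Laurent polynomial when \<open>u \<le> N - 2\<close> (in fact for all \<open>u\<close>).
\<close>

definition S_poly :: "nat \<Rightarrow> nat \<Rightarrow> int \<Rightarrow> laurent_poly" where
  "S_poly k m u =
     (THE P. P * (vandermonde 0 k * vandermonde k (k + m)) = det (S_matrix k m u))"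

lemma var_pow_inject: "i \<noteq> j \<Longrightarrow> var_pow i 1 \<noteq> var_pow j 1"
proof
  assume "i \<noteq> j" "var_pow i 1 = var_pow j 1"
  hence "Poly_Mapping.keys (var_pow i 1) = Poly_Mapping.keys (var_pow j 1)" by simp
  hence "Poly_Mapping.single i (1::int) = Poly_Mapping.single j 1" by (simp add: var_pow_def)
  hence "Poly_Mapping.keys (Poly_Mapping.single i (1::int)) = Poly_Mapping.keys (Poly_Mapping.single j (1::int))" by simp
  thus False using \<open>i \<noteq> j\<close> by simp
qed
lemma vandermonde_nonzero: "vandermonde lo hi \<noteq> 0"
proof -
  have "finite {(i,j). lo \<le> i \<and> i < j \<and> j < hi}"
    by (rule finite_subset[of _ "{..<hi} \<times> {..<hi}"]) auto
  thus ?thesis unfolding vandermonde_def by (auto simp: var_pow_inject)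
qed
lemma S_poly_eqI:
  assumes "P * (vandermonde 0 k * vandermonde k (k + m)) = det (S_matrix k m u)"
  shows "S_poly k m u = P"
  unfolding S_poly_def
proof (rule the_equality)
  fix Q assume "Q * (vandermonde 0 k * vandermonde k (k + m)) = det (S_matrix k m u)"
  with assms have "Q * (vandermonde 0 k * vandermonde k (k + m)) =
      P * (vandermonde 0 k * vandermonde k (k + m))" by simp
  thus "Q = P" by (simp add: vandermonde_nonzero)
qed (fact assms)

definition S_fun :: "int \<Rightarrow> int list \<Rightarrow> complex" where
  "S_fun u b =
     (let xs = filter (\<lambda>c. c < 0) b; ys = filter (\<lambda>c. c > 0) b in
      if xs = [] then 0
      else laurent_eval (S_poly (length xs) (length ys) u) (\<lambda>i. of_int ((xs @ ys) ! i)))"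

end

theory Submission
  imports Defs
begin

text \<open>
  The invariants of degree \<open>d\<close> are counted by the monomials of weight zero, and the generating
  function of these monomials, refined to one variable \<open>t\<^sub>j\<close> for every coordinate, is obtained by
  eliminating \<open>z\<close> from \<open>\<Prod> 1 / (1 - t\<^sub>j z^a\<^sub>j)\<close>: only the poles belonging to the
  negative weights contribute, and partial fractions over the roots \<open>z = \<zeta> t\<^sub>i^(1 / \<bar>a\<^sub>i\<bar>)\<close>
  write the series as a sum over \<open>i\<close> and over roots of unity \<open>\<zeta>\<close>.  To make the roots distinct and
  available as power series in \<open>s = 1 - t\<close>, one takes \<open>t\<^sub>j = (1 - s)^c\<^sub>j\<close> for
  generic exponents \<open>c\<^sub>j\<close> near \<open>1\<close>.  A factor \<open>1 - \<zeta>^a\<^sub>j t^\<alpha>\<close> of a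
  denominator vanishes at \<open>s = 0\<close> only if \<open>\<zeta>^a\<^sub>j = 1\<close>, so that only those \<open>\<zeta>\<close> matter for
  \<open>\<gamma>\<^sub>2\<close> for which at most two weights violate this; they give the three kinds of terms.

  As \<open>c\<close> tends to \<open>1\<close> the individual terms blow up if negative weights coincide, but each sum
  over \<open>i\<close> is, by Laplace expansion of the determinant along its first row, a quotient
  \<open>S\<^sub>u / D\<close> evaluated at the perturbed weights \<open>a\<^sub>j / c\<^sub>j\<close>, and this is continuous because \<open>S\<^sub>u\<close> is a
  Laurent polynomial.
\<close>

section \<open>Elimination of a variable\<close>

text \<open>The generating function contains powers of \<open>z\<close> of both signs, and only its
  constant term in \<open>z\<close> is wanted. It is never formed as one object: a series in
  \<open>z\<close> is replaced by a linear functional on polynomials, \<open>seqfun \<phi>\<close>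
  sending \<open>z^e\<close> to \<open>\<phi> e\<close>, and multiplying the argument by
  \<open>1 - T z^w\<close> amounts to cancelling a factor of the series.

  The second obstacle is that the perturbed summands have no limit one by one. What does converge is
  a numerator and a denominator that are universal polynomials in the \<open>T j\<close>. This is
  why the elimination is carried out over an arbitrary commutative ring: the same
  \<open>elim_numer\<close> is specialised to \<open>T j = t\<close> for the Hilbert series, to
  \<open>T j = 1 - s\<close> for its expansion, and to \<open>T j = t^(c j)\<close> for the generic
  case. The roots are used in the generic case only, and the result is carried back to
  \<open>c = 1\<close> by continuity of the coefficients. The perturbation changes exponents of
  \<open>t\<close> alone; roots of unity and gcds always refer to the integer weights.\<close>

definition seqfun :: "(nat \<Rightarrow> 'a) \<Rightarrow> 'a :: comm_ring_1 poly \<Rightarrow> 'a" where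
  "seqfun \<phi> p = (\<Sum>e\<le>degree p. coeff p e * \<phi> e)"

lemma seqfun_bound: "degree p \<le> N \<Longrightarrow> seqfun \<phi> p = (\<Sum>e\<le>N. coeff p e * \<phi> e)"
  unfolding seqfun_def by (rule sum.mono_neutral_left) (auto simp: coeff_eq_0)

lemma seqfun_0 [simp]: "seqfun \<phi> 0 = 0"
  by (simp add: seqfun_def)

lemma seqfun_add: "seqfun \<phi> (p + q) = seqfun \<phi> p + seqfun \<phi> q"
proof -
  let ?N = "max (degree p) (degree q)"
  have "degree (p + q) \<le> ?N" by (rule degree_add_le_max)
  then show ?thesis
    by (simp add: seqfun_bound[of _ ?N] algebra_simps sum.distrib)
qed

lemma seqfun_smult: "seqfun \<phi> (Polynomial.smult c p) = c * seqfun \<phi> p"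
  using degree_smult_le[of c p]
  by (simp add: seqfun_bound[of _ "degree p"] sum_distrib_left mult.assoc)

lemma seqfun_uminus: "seqfun \<phi> (- p) = - seqfun \<phi> p"
  using seqfun_smult[of \<phi> "-1" p] by simp

lemma seqfun_diff: "seqfun \<phi> (p - q) = seqfun \<phi> p - seqfun \<phi> q"
  using seqfun_add[of \<phi> p "-q"] by (simp add: seqfun_uminus)

lemma seqfun_monom [simp]: "seqfun \<phi> (monom c e) = c * \<phi> e"
proof -
  have "seqfun \<phi> (monom c e) = (\<Sum>i\<le>e. coeff (monom c e) i * \<phi> i)"
    by (rule seqfun_bound) (rule degree_monom_le)
  also have "\<dots> = (\<Sum>i\<in>{e}. coeff (monom c e) i * \<phi> i)"
    by (rule sum.mono_neutral_right) (auto simp: coeff_monom)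
  finally show ?thesis by simp
qed

lemma seqfun_sum: "seqfun \<phi> (\<Sum>x\<in>A. f x) = (\<Sum>x\<in>A. seqfun \<phi> (f x))"
  by (induction A rule: infinite_finite_induct) (auto simp: seqfun_add)

text \<open>Both sides are linear in \<open>p\<close>, so an identity between two functionals need
  only be tested on monomials, where it is a recurrence between the two sequences.\<close>

lemma seqfun_mult_eqI:
  assumes "\<And>e. seqfun \<phi> (monom 1 e * q) = seqfun \<psi> (monom 1 e * r)"
  shows "seqfun \<phi> (p * q) = seqfun \<psi> (p * r)"
proof -
  have s: "seqfun \<chi> (p * s) = (\<Sum>e\<le>degree p. coeff p e * seqfun \<chi> (monom 1 e * s))" for \<chi> s
  proof -
    have "p * s = (\<Sum>e\<le>degree p. monom (coeff p e) e) * s"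
      by (simp add: poly_as_sum_of_monoms)
    also have "\<dots> = (\<Sum>e\<le>degree p. Polynomial.smult (coeff p e) (monom 1 e * s))"
      by (simp add: sum_distrib_right smult_monom flip: mult_smult_left)
    finally show ?thesis by (simp add: seqfun_sum seqfun_smult)
  qed
  show ?thesis by (simp add: s assms)
qed

text \<open>The coefficients of \<open>\<Prod>\<^bsub>i<k\<^esub> 1 / (1 - T\<^sub>i z^w\<^sub>i)\<close> as a power series in \<open>z\<close>.\<close>

function chs :: "(nat \<Rightarrow> nat) \<Rightarrow> (nat \<Rightarrow> 'a :: comm_ring_1) \<Rightarrow> nat \<Rightarrow> nat \<Rightarrow> 'a" where
  "chs w T 0 e = (if e = 0 then 1 else 0)"
| "chs w T (Suc k) e =
     chs w T k e + (if 0 < w k \<and> w k \<le> e then T k * chs w T (Suc k) (e - w k) else 0)"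
  by pat_completeness auto
termination
  by (relation "measures [\<lambda>(w, T, k, e). k, \<lambda>(w, T, k, e). e]") auto

declare chs.simps(2) [simp del]

text \<open>Multiplication by \<open>z^(w k) - T k\<close> undoes the last factor of the generating
  function, because the recurrence says \<open>chs w T (Suc k) (e + w k) - T k * chs w T (Suc k) e =
  chs w T k (e + w k)\<close>. Each factor lowers \<open>k\<close> by one and leaves a shift by
  \<open>w k\<close> behind.\<close>

lemma chs_kills:
  assumes "\<And>i. i < k \<Longrightarrow> 0 < w i"
  shows "seqfun (chs w T k) (p * (\<Prod>i<k. monom 1 (w i) - [:T i:])) =
    seqfun (chs w T 0) (p * monom 1 (\<Sum>i<k. w i))"
  using assms
proof (induction k arbitrary: p)
  case (Suc k)
  let ?P = "\<Prod>i<k. monom 1 (w i) - [:T i:]"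
  have "seqfun (chs w T (Suc k)) ((p * ?P) * (monom 1 (w k) - [:T k:]))
      = seqfun (chs w T k) ((p * ?P) * monom 1 (w k))"
  proof (rule seqfun_mult_eqI)
    fix e
    have "monom 1 e * [:T k:] = monom (T k) e"
      by (metis monom_0 mult_monom mult_1 add.right_neutral)
    then show "seqfun (chs w T (Suc k)) (monom 1 e * (monom 1 (w k) - [:T k:])) =
        seqfun (chs w T k) (monom 1 e * monom 1 (w k))"
      using Suc.prems[of k]
      by (simp add: right_diff_distrib seqfun_diff mult_monom chs.simps(2)[of w T k "e + w k"])
  qed
  also have "(p * ?P) * monom 1 (w k) = (p * monom 1 (w k)) * ?P" by (simp add: mult_ac)
  also have "seqfun (chs w T k) \<dots> = seqfun (chs w T 0) (p * monom 1 (w k) * monom 1 (\<Sum>i<k. w i))"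
    by (rule Suc.IH) (use Suc.prems in auto)
  also have "p * monom 1 (w k) * monom 1 (\<Sum>i<k. w i) = p * monom 1 (\<Sum>i<Suc k. w i)"
    by (simp add: mult.assoc mult_monom add.commute)
  finally show ?case by (simp add: mult_ac)
qed simp

text \<open>Once all factors are used up, the sequence 1, 0, 0, ... remains, and it is read only at
  exponents that are at least \<open>\<Sum>i<k. w i\<close>, hence positive. The functional
  therefore vanishes on an ideal, which permits computing modulo the product.\<close>

lemma chs_kills_0:
  assumes "\<And>i. i < k \<Longrightarrow> 0 < w i" and "0 < k"
  shows "seqfun (chs w T k) (p * (\<Prod>i<k. monom 1 (w i) - [:T i:])) = 0"
proof -
  have pos: "0 < (\<Sum>i<k. w i)" using assms by (intro sum_pos) auto
  have "seqfun (chs w T 0) (p * monom 1 (\<Sum>i<k. w i)) = seqfun (\<lambda>_. 0) (p * 0)"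
  proof (rule seqfun_mult_eqI)
    fix e
    have "e + (\<Sum>i<k. w i) \<noteq> 0" using pos by linarith
    then show "seqfun (chs w T 0) (monom 1 e * monom 1 (\<Sum>i<k. w i)) =
        seqfun (\<lambda>_. 0) (monom 1 e * 0)"
      by (simp add: mult_monom del: add_eq_0_iff_both_eq_0 add_is_0)
  qed
  then show ?thesis by (simp add: chs_kills assms)
qed

section \<open>Eliminating one positive weight at a time\<close>

definition elim_idx :: "(nat \<Rightarrow> nat) \<Rightarrow> nat \<Rightarrow> (nat set \<times> nat) set" where
  "elim_idx w k = (SIGMA I:Pow {..<k}. {..<\<Sum>i\<in>I. w i})"

definition elim_coeff ::
    "(nat \<Rightarrow> nat) \<Rightarrow> (nat \<Rightarrow> 'a :: comm_ring_1) \<Rightarrow> nat \<Rightarrow> nat \<Rightarrow> nat set \<times> nat \<Rightarrow> 'a" where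
  "elim_coeff w T k j q = T j ^ snd q * (\<Prod>i\<in>{..<k} - fst q. - (T j ^ w i * T i ^ w j))"

text \<open>A cofactor for \<open>1 - x\<close>, where \<open>x = T j * z^(w j)\<close>. Modulo
  \<open>z^(w i) - T i\<close> the power \<open>x^(w i)\<close> is the constant
  \<open>c i = T j ^ w i * T i ^ w j\<close>. The difference of \<open>\<Prod>i<k. 1 - c i\<close>
  and \<open>\<Prod>i<k. x^(w i) - c i\<close> vanishes at \<open>x = 1\<close>. Expanding both
  products over the set \<open>I\<close> of factors that do not contribute \<open>- c i\<close>
  leaves \<open>1 - x^s\<close> with \<open>s = \<Sum>i\<in>I. w i\<close>; dividing by
  \<open>1 - x\<close> gives geometric sums, whence the index pairs of \<open>I\<close> and
  \<open>l < s\<close>.\<close>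

definition elim_poly :: "(nat \<Rightarrow> nat) \<Rightarrow> (nat \<Rightarrow> 'a :: comm_ring_1) \<Rightarrow> nat \<Rightarrow> nat \<Rightarrow> 'a poly" where
  "elim_poly w T k j = (\<Sum>q\<in>elim_idx w k. monom (elim_coeff w T k j q) (w j * snd q))"

definition elim_den :: "(nat \<Rightarrow> nat) \<Rightarrow> (nat \<Rightarrow> 'a :: comm_ring_1) \<Rightarrow> nat \<Rightarrow> nat \<Rightarrow> 'a" where
  "elim_den w T k j = (\<Prod>i<k. 1 - T j ^ w i * T i ^ w j)"

lemma const_poly_prod: "(\<Prod>i\<in>A. [:f i:]) = [:\<Prod>i\<in>A. f i:]"
  for f :: "_ \<Rightarrow> 'a :: comm_ring_1"
  by (induction A rule: infinite_finite_induct) (simp_all add: one_pCons)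

lemma elim_poly_eq:
  fixes T :: "nat \<Rightarrow> 'a :: comm_ring_1"
  shows "(1 - monom (T j) (w j)) * elim_poly w T k j =
    [:elim_den w T k j:] - (\<Prod>i<k. monom (T j) (w j) ^ w i - [:T j ^ w i * T i ^ w j:])"
proof -
  define x where "x = monom (T j) (w j)"
  define m where "m I = (\<Prod>i\<in>{..<k} - I. - (T j ^ w i * T i ^ w j))" for I
  have xp: "x ^ l = monom (T j ^ l) (w j * l)" for l by (simp add: x_def monom_power)
  have c: "(\<Prod>i\<in>{..<k} - I. [:- (T j ^ w i * T i ^ w j):]) = [:m I:]" for I
    unfolding m_def by (rule const_poly_prod)
  have geo: "(1 - x) * (\<Sum>l<s. x ^ l) = 1 - x ^ s" for s by (rule one_diff_power_eq[symmetric])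
  have "elim_poly w T k j = (\<Sum>I\<in>Pow {..<k}. [:m I:] * (\<Sum>l<(\<Sum>i\<in>I. w i). x ^ l))"
  proof -
    have "elim_poly w T k j = (\<Sum>(I, l)\<in>(SIGMA I:Pow {..<k}. {..<\<Sum>i\<in>I. w i}).
        monom (elim_coeff w T k j (I, l)) (w j * l))"
      unfolding elim_poly_def elim_idx_def by (simp add: split_def)
    also have "\<dots> = (\<Sum>I\<in>Pow {..<k}. \<Sum>l<(\<Sum>i\<in>I. w i). monom (elim_coeff w T k j (I, l)) (w j * l))"
      by (rule sum.Sigma[symmetric]) auto
    also have "\<dots> = (\<Sum>I\<in>Pow {..<k}. [:m I:] * (\<Sum>l<(\<Sum>i\<in>I. w i). x ^ l))"
      unfolding sum_distrib_left
      by (intro sum.cong refl) (simp add: elim_coeff_def xp smult_monom m_def mult.commute)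
    finally show ?thesis .
  qed
  then have "(1 - x) * elim_poly w T k j =
      (\<Sum>I\<in>Pow {..<k}. [:m I:] * ((1 - x) * (\<Sum>l<(\<Sum>i\<in>I. w i). x ^ l)))"
    by (simp add: sum_distrib_left mult_ac del: mult_pCons_left mult_pCons_right)
  also have "\<dots> = (\<Sum>I\<in>Pow {..<k}. [:m I:]) - (\<Sum>I\<in>Pow {..<k}. x ^ (\<Sum>i\<in>I. w i) * [:m I:])"
    unfolding geo by (simp add: algebra_simps sum_subtractf)
  also have "(\<Sum>I\<in>Pow {..<k}. x ^ (\<Sum>i\<in>I. w i) * [:m I:]) =
      (\<Prod>i<k. x ^ w i + [:- (T j ^ w i * T i ^ w j):])"
    unfolding prod_add[OF finite_lessThan] c[symmetric] power_sum ..
  also have "(\<Sum>I\<in>Pow {..<k}. [:m I:]) = (\<Sum>I\<in>Pow {..<k}. (\<Prod>i\<in>I. 1) * (\<Prod>i\<in>{..<k} - I. [:- (T j ^ w i * T i ^ w j):]))"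
    by (simp add: c)
  also have "\<dots> = (\<Prod>i<k. 1 + [:- (T j ^ w i * T i ^ w j):])"
    by (rule prod_add[OF finite_lessThan, symmetric])
  also have "\<dots> = [:elim_den w T k j:]"
    unfolding elim_den_def const_poly_prod[symmetric]
    by (simp add: one_pCons)
  finally show ?thesis unfolding x_def by (simp add: diff_conv_add_uminus del: add_uminus_conv_diff)
qed

text \<open>Up to \<open>T j ^ w i\<close>, each factor on the right is the difference of the
  \<open>w j\<close>-th powers of \<open>z^(w i)\<close> and \<open>T i\<close>.\<close>

lemma elim_rest_dvd:
  fixes T :: "nat \<Rightarrow> 'a :: comm_ring_1"
  shows "(\<Prod>i<k. monom 1 (w i) - [:T i:]) dvd
    (\<Prod>i<k. monom (T j) (w j) ^ w i - [:T j ^ w i * T i ^ w j:])"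
proof (rule prod_dvd_prod)
  fix i
  have "monom (T j) (w j) ^ w i - [:T j ^ w i * T i ^ w j:] =
      Polynomial.smult (T j ^ w i) (monom 1 (w i) ^ w j - [:T i:] ^ w j)"
    by (simp add: monom_power smult_diff_right smult_monom poly_const_pow mult.commute)
  moreover have "monom 1 (w i) - [:T i:] dvd monom 1 (w i) ^ w j - [:T i:] ^ w j"
    by (metis dvd_triv_left power_diff_sumr2)
  ultimately show "monom 1 (w i) - [:T i:] dvd
      monom (T j) (w j) ^ w i - [:T j ^ w i * T i ^ w j:]"
    by (simp only: dvd_smult)
qed

text \<open>\<open>L r\<close> stands for the constant term against the first \<open>r\<close>
  factors. Only linearity, the cancelling step and the vanishing on an ideal are assumed, since the
  lemma is applied twice: to counting monomials and to summing over roots. The positive factors go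
  from the last one down: \<open>elim_den * p\<close> and \<open>p * elim_poly * (1 - x)\<close>
  differ by a multiple of the product that \<open>L\<close> kills.\<close>

lemma elimination:
  fixes L :: "nat \<Rightarrow> 'a :: comm_ring_1 poly \<Rightarrow> 'a"
  assumes "k \<le> n"
    and diff: "\<And>r p q. L r (p - q) = L r p - L r q"
    and smult: "\<And>r c p. L r (Polynomial.smult c p) = c * L r p"
    and step: "\<And>r p. k \<le> r \<Longrightarrow> r < n \<Longrightarrow> L (Suc r) (p * (1 - monom (T r) (w r))) = L r p"
    and kills: "\<And>r p. k \<le> r \<Longrightarrow> r \<le> n \<Longrightarrow> L r (p * (\<Prod>i<k. monom 1 (w i) - [:T i:])) = 0"
  shows "(\<Prod>j\<in>{k..<n}. elim_den w T k j) * L n p = L k (p * (\<Prod>j\<in>{k..<n}. elim_poly w T k j))"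
proof -
  have "m \<le> n \<longrightarrow> (\<forall>p. (\<Prod>j\<in>{k..<m}. elim_den w T k j) * L m p =
      L k (p * (\<Prod>j\<in>{k..<m}. elim_poly w T k j)))" if "k \<le> m" for m
    using that
  proof (induction m rule: dec_induct)
    case base
    show ?case by simp
  next
    case (step m)
    show ?case
    proof (intro allI impI)
    fix p assume "Suc m \<le> n"
    let ?V = "elim_poly w T k m"
    obtain W where W: "(\<Prod>i<k. monom (T m) (w m) ^ w i - [:T m ^ w i * T i ^ w m:]) =
        (\<Prod>i<k. monom 1 (w i) - [:T i:]) * W"
      using elim_rest_dvd[where T = T and w = w and k = k and j = m] by (elim dvdE)
    have e: "p * ?V * (1 - monom (T m) (w m)) =
        Polynomial.smult (elim_den w T k m) p - (p * W) * (\<Prod>i<k. monom 1 (w i) - [:T i:])"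
    proof -
      have "p * ?V * (1 - monom (T m) (w m)) = p * ((1 - monom (T m) (w m)) * ?V)"
        by (simp only: mult_ac)
      also have "\<dots> = p * [:elim_den w T k m:] - p * ((\<Prod>i<k. monom 1 (w i) - [:T i:]) * W)"
        unfolding elim_poly_eq W right_diff_distrib ..
      finally show ?thesis by (simp add: mult_ac)
    qed
    have "elim_den w T k m * L (Suc m) p = L (Suc m) (p * ?V * (1 - monom (T m) (w m)))"
      unfolding e diff smult using kills[of "Suc m"] step.hyps \<open>Suc m \<le> n\<close> by simp
    also have "\<dots> = L m (p * ?V)" using assms(4)[of m] step.hyps \<open>Suc m \<le> n\<close> by simp
    finally have "elim_den w T k m * L (Suc m) p = L m (p * ?V)" .
    then have "(\<Prod>j\<in>{k..<Suc m}. elim_den w T k j) * L (Suc m) p =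
        (\<Prod>j\<in>{k..<m}. elim_den w T k j) * L m (p * ?V)"
      using step.hyps by (simp add: mult.assoc)
    also have "\<dots> = L k (p * ?V * (\<Prod>j\<in>{k..<m}. elim_poly w T k j))"
      using step.IH \<open>Suc m \<le> n\<close> by simp
    also have "\<dots> = L k (p * (\<Prod>j\<in>{k..<Suc m}. elim_poly w T k j))"
      using step.hyps by (simp add: mult_ac)
    finally show "(\<Prod>j\<in>{k..<Suc m}. elim_den w T k j) * L (Suc m) p =
        L k (p * (\<Prod>j\<in>{k..<Suc m}. elim_poly w T k j))" .
    qed
  qed
  with assms(1) show ?thesis by blast
qed

text \<open>What is left after all positive weights have been eliminated, as an explicit finite sum
  of products in the \<open>T i\<close>. In this form ring homomorphisms and coefficientwise limits
  pass through it.\<close>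

definition elim_numer :: "(nat \<Rightarrow> nat) \<Rightarrow> (nat \<Rightarrow> 'a :: comm_ring_1) \<Rightarrow> nat \<Rightarrow> nat \<Rightarrow> 'a" where
  "elim_numer w T k n =
     (\<Sum>q\<in>{k..<n} \<rightarrow>\<^sub>E elim_idx w k. (\<Prod>j\<in>{k..<n}. elim_coeff w T k j (q j)) *
        chs w T k (\<Sum>j\<in>{k..<n}. w j * snd (q j)))"

lemma finite_elim_idx [simp]: "finite (elim_idx w k)"
  unfolding elim_idx_def by (intro finite_SigmaI) auto

lemma prod_monom: "(\<Prod>j\<in>A. monom (c j) (d j)) = monom (\<Prod>j\<in>A. c j) (\<Sum>j\<in>A. d j :: nat)"
  for c :: "_ \<Rightarrow> 'a :: comm_ring_1"
  by (induction A rule: infinite_finite_induct) (simp_all add: mult_monom)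

lemma elim_numer_eq:
  "elim_numer w T k n = seqfun (chs w T k) (\<Prod>j\<in>{k..<n}. elim_poly w T k j)"
  unfolding elim_poly_def elim_numer_def
  by (subst prod_sum_PiE) (simp_all add: prod_monom seqfun_sum)

lemma (in comm_ring_hom) hom_chs: "hom (chs w T k e) = chs w (\<lambda>i. hom (T i)) k e"
proof (induction w T k e rule: chs.induct)
  case (2 w T k e)
  then show ?case
    by (subst (1 2) chs.simps(2)) (auto simp: hom_distribs)
qed simp

lemma (in comm_ring_hom) hom_elim_coeff:
  "hom (elim_coeff w T k j q) = elim_coeff w (\<lambda>i. hom (T i)) k j q"
  by (simp add: elim_coeff_def hom_distribs)

lemma (in comm_ring_hom) hom_elim_den: "hom (elim_den w T k j) = elim_den w (\<lambda>i. hom (T i)) k j"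
  by (simp add: elim_den_def hom_distribs)

lemma (in comm_ring_hom) hom_elim_numer:
  "hom (elim_numer w T k n) = elim_numer w (\<lambda>i. hom (T i)) k n"
  by (simp add: elim_numer_def hom_distribs hom_chs hom_elim_coeff)

section \<open>Counting monomials of weight zero\<close>

definition wt_monoms :: "(nat \<Rightarrow> int) \<Rightarrow> nat \<Rightarrow> int \<Rightarrow> nat \<Rightarrow> (nat \<Rightarrow>\<^sub>0 nat) set" where
  "wt_monoms a r v d = {m. Poly_Mapping.keys m \<subseteq> {..<r} \<and>
     (\<Sum>i<r. Poly_Mapping.lookup m i) = d \<and> (\<Sum>i<r. a i * int (Poly_Mapping.lookup m i)) = v}"

lemma finite_wt_monoms [simp]: "finite (wt_monoms a r v d)"
proof (rule inj_on_finite)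
  show "inj_on (\<lambda>m. restrict (Poly_Mapping.lookup m) {..<r}) (wt_monoms a r v d)"
  proof (rule inj_onI)
    fix m m' assume m: "m \<in> wt_monoms a r v d" "m' \<in> wt_monoms a r v d"
      and e: "restrict (Poly_Mapping.lookup m) {..<r} = restrict (Poly_Mapping.lookup m') {..<r}"
    show "m = m'"
    proof (rule poly_mapping_eqI)
      fix i show "Poly_Mapping.lookup m i = Poly_Mapping.lookup m' i"
      proof (cases "i < r")
        case True
        then show ?thesis using fun_cong[OF e, of i] by simp
      next
        case False
        then have "i \<notin> Poly_Mapping.keys m" "i \<notin> Poly_Mapping.keys m'"
          using m by (auto simp: wt_monoms_def)
        then show ?thesis by (simp add: in_keys_iff)
      qed
    qed
  qed
  show "(\<lambda>m. restrict (Poly_Mapping.lookup m) {..<r}) ` wt_monoms a r v d \<subseteq> {..<r} \<rightarrow>\<^sub>E {..d}"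
  proof (intro image_subsetI PiE_I)
    fix m i assume "m \<in> wt_monoms a r v d" "i \<in> {..<r}"
    then show "restrict (Poly_Mapping.lookup m) {..<r} i \<in> {..d}"
      by (auto simp: wt_monoms_def intro: member_le_sum)
  qed auto
qed (auto intro: finite_PiE)

lemma wt_monoms_0: "wt_monoms a 0 v d = (if v = 0 \<and> d = 0 then {0} else {})"
  by (auto simp: wt_monoms_def)

text \<open>Either the variable \<open>r\<close> does not occur, or one copy of it can be divided
  out. This is the recurrence belonging to the factor \<open>1 / (1 - t z^(a r))\<close>.\<close>

lemma wt_monoms_Suc:
  "wt_monoms a (Suc r) v d = wt_monoms a r v d \<union>
     (if d = 0 then {} else (\<lambda>m. m + Poly_Mapping.single r 1) ` wt_monoms a (Suc r) (v - a r) (d - 1))"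
    (is "?l = ?r")
proof (rule Set.set_eqI)
  fix m :: "nat \<Rightarrow>\<^sub>0 nat"
  show "m \<in> ?l \<longleftrightarrow> m \<in> ?r"
  proof (cases "Poly_Mapping.lookup m r = 0")
    case True
    then have "m \<notin> (\<lambda>m. m + Poly_Mapping.single r 1) ` A" for A
      by (auto simp: lookup_add)
    moreover have "m \<in> ?l \<longleftrightarrow> m \<in> wt_monoms a r v d"
    proof -
      have "Poly_Mapping.keys m \<subseteq> {..<Suc r} \<longleftrightarrow> Poly_Mapping.keys m \<subseteq> {..<r}"
        using True by (metis in_keys_iff lessThan_iff less_Suc_eq subset_iff)
      then show ?thesis using True by (simp add: wt_monoms_def)
    qed
    ultimately show ?thesis by simp
  next
    case False
    define m' where "m' = m - Poly_Mapping.single r 1"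
    have lk: "Poly_Mapping.lookup m i = Poly_Mapping.lookup m' i + (if i = r then 1 else 0)" for i
      using False by (simp add: m'_def lookup_minus lookup_single when_def)
    have m: "m = m' + Poly_Mapping.single r 1"
      by (rule poly_mapping_eqI) (auto simp: lookup_add lk lookup_single)
    have keys: "Poly_Mapping.keys m \<subseteq> {..<Suc r} \<longleftrightarrow> Poly_Mapping.keys m' \<subseteq> {..<Suc r}"
      by (auto simp: subset_iff in_keys_iff lk less_Suc_eq)
    have "m \<notin> wt_monoms a r v d"
      using False by (auto simp: wt_monoms_def in_keys_iff subset_iff)
    moreover have "m \<in> ?l \<longleftrightarrow> d \<noteq> 0 \<and> m' \<in> wt_monoms a (Suc r) (v - a r) (d - 1)"
    proof -
      have "(\<Sum>i<r. Poly_Mapping.lookup m i) = (\<Sum>i<r. Poly_Mapping.lookup m' i)"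
        "(\<Sum>i<r. a i * int (Poly_Mapping.lookup m i)) = (\<Sum>i<r. a i * int (Poly_Mapping.lookup m' i))"
        by (auto simp: lk intro!: sum.cong)
      then show ?thesis unfolding wt_monoms_def using keys
        by (auto simp: lk[of r] algebra_simps)
    qed
    moreover have "m \<in> (\<lambda>m. m + Poly_Mapping.single r 1) ` A \<longleftrightarrow> m' \<in> A" for A
      unfolding m by auto
    ultimately show ?thesis by auto
  qed
qed

definition wt_count :: "(nat \<Rightarrow> int) \<Rightarrow> nat \<Rightarrow> int \<Rightarrow> nat \<Rightarrow> nat" where
  "wt_count a r v d = card (wt_monoms a r v d)"

lemma wt_count_0: "wt_count a 0 v d = (if v = 0 \<and> d = 0 then 1 else 0)"
  by (simp add: wt_count_def wt_monoms_0)

lemma wt_count_Suc: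
  "wt_count a (Suc r) v d = wt_count a r v d +
     (if d = 0 then 0 else wt_count a (Suc r) (v - a r) (d - 1))"
proof (cases "d = 0")
  case False
  let ?B = "wt_monoms a (Suc r) (v - a r) (d - 1)"
  have "wt_monoms a r v d \<inter> (\<lambda>m. m + Poly_Mapping.single r 1) ` ?B = {}"
  proof -
    have "m + Poly_Mapping.single r 1 \<notin> wt_monoms a r v d" for m :: "nat \<Rightarrow>\<^sub>0 nat"
    proof
      assume "m + Poly_Mapping.single r 1 \<in> wt_monoms a r v d"
      then have "r \<notin> Poly_Mapping.keys (m + Poly_Mapping.single r 1)" by (auto simp: wt_monoms_def)
      then show False by (simp add: in_keys_iff lookup_add)
    qed
    then show ?thesis by auto
  qed
  moreover have "inj_on (\<lambda>m. m + Poly_Mapping.single r (1::nat)) ?B"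
    by (rule inj_onI) simp
  ultimately show ?thesis using False
    unfolding wt_count_def by (subst wt_monoms_Suc) (simp add: card_Un_disjoint card_image)
qed (simp add: wt_count_def wt_monoms_Suc[where d = 0])

lemma wt_count_eq_0:
  assumes "\<And>i. i < r \<Longrightarrow> a i < 0" "v > 0"
  shows "wt_count a r v d = 0"
proof -
  have "(\<Sum>i<r. a i * int (Poly_Mapping.lookup m i)) \<le> 0" for m :: "nat \<Rightarrow>\<^sub>0 nat"
    using assms(1) by (intro sum_nonpos mult_nonpos_nonneg) (auto intro: less_imp_le)
  then have "wt_monoms a r v d = {}" using assms(2)
    by (auto simp: wt_monoms_def) (meson linorder_not_less)
  then show ?thesis by (simp add: wt_count_def)
qed

section \<open>Invariants are spanned by the monomials of weight zero\<close>

lemma mixed_radix_inject: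
  fixes f g :: "nat \<Rightarrow> nat"
  assumes "\<And>i. i < n \<Longrightarrow> f i < D" "\<And>i. i < n \<Longrightarrow> g i < D"
    and "(\<Sum>i<n. f i * D ^ i) = (\<Sum>i<n. g i * D ^ i)" and "i < n"
  shows "f i = g i"
  using assms
proof (induction n arbitrary: f g i)
  case (Suc n)
  have s: "(\<Sum>i<Suc n. h i * D ^ i) = h 0 + D * (\<Sum>i<n. h (Suc i) * D ^ i)" for h :: "nat \<Rightarrow> nat"
    unfolding sum.lessThan_Suc_shift by (simp add: sum_distrib_left mult_ac)
  have e: "f 0 + D * (\<Sum>i<n. f (Suc i) * D ^ i) = g 0 + D * (\<Sum>i<n. g (Suc i) * D ^ i)"
    using Suc.prems(3) unfolding s .
  have D: "f 0 < D" "g 0 < D" using Suc.prems(1)[of 0] Suc.prems(2)[of 0] by auto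
  have 0: "f 0 = g 0" using arg_cong[OF e, of "\<lambda>x. x mod D"] D by simp
  then have "(\<Sum>i<n. f (Suc i) * D ^ i) = (\<Sum>i<n. g (Suc i) * D ^ i)" using e D by simp
  then have "f (Suc i') = g (Suc i')" if "i' < n" for i'
    using Suc.IH[of "\<lambda>i. f (Suc i)" "\<lambda>i. g (Suc i)" i'] Suc.prems(1,2) that by simp
  then show ?case using 0 Suc.prems(4) by (cases i) auto
qed simp

text \<open>Kronecker's substitution \<open>z\<^sub>i = x^(D^i)\<close> separates the monomials.\<close>

lemma monomials_independent:
  fixes c :: "(nat \<Rightarrow>\<^sub>0 nat) \<Rightarrow> complex"
  assumes M: "finite M" "\<And>m. m \<in> M \<Longrightarrow> Poly_Mapping.keys m \<subseteq> {..<n}"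
    and 0: "\<And>z. (\<Sum>m\<in>M. c m * (\<Prod>i<n. z i ^ Poly_Mapping.lookup m i)) = 0"
    and "m \<in> M"
  shows "c m = 0"
proof -
  define D where "D = Suc (\<Sum>m\<in>M. \<Sum>i<n. Poly_Mapping.lookup m i)"
  define N where "N m = (\<Sum>i<n. Poly_Mapping.lookup m i * D ^ i)" for m :: "nat \<Rightarrow>\<^sub>0 nat"
  have D: "Poly_Mapping.lookup m i < D" if "m \<in> M" "i < n" for m i
  proof -
    have "Poly_Mapping.lookup m i \<le> (\<Sum>i<n. Poly_Mapping.lookup m i)"
      using that by (intro member_le_sum) auto
    also have "\<dots> \<le> (\<Sum>m\<in>M. \<Sum>i<n. Poly_Mapping.lookup m i)"
      using that M by (intro member_le_sum) auto
    finally show ?thesis by (simp add: D_def)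
  qed
  have inj: "m = m'" if "m \<in> M" "m' \<in> M" "N m = N m'" for m m'
  proof (rule poly_mapping_eqI)
    fix i
    show "Poly_Mapping.lookup m i = Poly_Mapping.lookup m' i"
    proof (cases "i < n")
      case True
      then show ?thesis
        using mixed_radix_inject[of n "Poly_Mapping.lookup m" D "Poly_Mapping.lookup m'" i] D that
        by (simp add: N_def)
    next
      case False
      then have "i \<notin> Poly_Mapping.keys m" "i \<notin> Poly_Mapping.keys m'" using M that by auto
      then show ?thesis by (simp add: in_keys_iff)
    qed
  qed
  define P where "P = (\<Sum>m\<in>M. monom (c m) (N m))"
  have "poly P x = 0" for x
    using 0[of "\<lambda>i. x ^ (D ^ i)"]
    by (simp add: P_def poly_sum poly_monom N_def power_sum power_mult mult.commute flip: power_mult)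
  then have "P = 0" by (simp add: poly_all_0_iff_0[symmetric])
  then have "0 = (\<Sum>m'\<in>M. coeff (monom (c m') (N m')) (N m))"
    by (metis P_def coeff_0 coeff_sum)
  also have "\<dots> = (\<Sum>m'\<in>{m}. coeff (monom (c m') (N m')) (N m))"
    using M(1) \<open>m \<in> M\<close> inj by (intro sum.mono_neutral_right) (auto simp: coeff_monom)
  finally show ?thesis by simp
qed

lemma cpoly_eval_bound:
  assumes "\<And>m. m \<in> Poly_Mapping.keys p \<Longrightarrow> Poly_Mapping.keys m \<subseteq> {..<n}"
  shows "cpoly_eval p z = (\<Sum>m\<in>Poly_Mapping.keys p. Poly_Mapping.lookup p m *
    (\<Prod>i<n. z i ^ Poly_Mapping.lookup m i))"
  unfolding cpoly_eval_def using assms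
  by (intro sum.cong arg_cong2[where f = "(*)"] prod.mono_neutral_left refl)
    (auto simp: in_keys_iff)

lemma monom_torus_act:
  assumes "w \<noteq> 0"
  shows "(\<Prod>i<length a. torus_act a w z i ^ Poly_Mapping.lookup m i) =
    w powi (\<Sum>i<length a. a ! i * int (Poly_Mapping.lookup m i)) *
      (\<Prod>i<length a. z i ^ Poly_Mapping.lookup m i)"
proof -
  have "(\<Prod>i<l. (w powi (a ! i) * z i) ^ Poly_Mapping.lookup m i) =
      w powi (\<Sum>i<l. a ! i * int (Poly_Mapping.lookup m i)) *
      (\<Prod>i<l. z i ^ Poly_Mapping.lookup m i)" for l
    using assms
    by (induction l) (simp_all add: power_int_add power_mult_distrib mult_ac power_int_mult)
  then show ?thesis by (simp add: torus_act_def)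
qed

lemma invariant_polys_deg_eq:
  "invariant_polys_deg a d = {p. Poly_Mapping.keys p \<subseteq> wt_monoms ((!) a) (length a) 0 d}"
proof -
  let ?n = "length a"
  have deg: "(\<Sum>i\<in>Poly_Mapping.keys m. Poly_Mapping.lookup m i) = (\<Sum>i<?n. Poly_Mapping.lookup m i)"
    if "Poly_Mapping.keys m \<subseteq> {..<?n}" for m :: "nat \<Rightarrow>\<^sub>0 nat"
    using that by (intro sum.mono_neutral_left) (auto simp: in_keys_iff)
  have "Poly_Mapping.keys p \<subseteq> wt_monoms ((!) a) ?n 0 d"
    if p: "p \<in> invariant_polys_deg a d" for p
  proof -
    from p have k: "Poly_Mapping.keys m \<subseteq> {..<?n}" if "m \<in> Poly_Mapping.keys p" for m
      using that by (auto simp: invariant_polys_deg_def invariant_polys_def)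
    define wt where "wt m = (\<Sum>i<?n. a ! i * int (Poly_Mapping.lookup m i))" for m :: "nat \<Rightarrow>\<^sub>0 nat"
    have "wt m = 0" if m: "m \<in> Poly_Mapping.keys p" for m
    proof -
      \<comment> \<open>One torus element of infinite order suffices: \<open>2 powi v = 1\<close>
        forces \<open>v = 0\<close>, so invariance under \<open>2\<close> already excludes every
        monomial of nonzero weight.\<close>
      have "Poly_Mapping.lookup p m * (2 powi wt m - 1) = 0"
      proof (rule monomials_independent[where M = "Poly_Mapping.keys p" and n = ?n])
        fix z :: "nat \<Rightarrow> complex"
        have "cpoly_eval p (torus_act a 2 z) = cpoly_eval p z"
          using p by (simp add: invariant_polys_deg_def invariant_polys_def)
        then show "(\<Sum>m\<in>Poly_Mapping.keys p. Poly_Mapping.lookup p m * (2 powi wt m - 1) *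
            (\<Prod>i<?n. z i ^ Poly_Mapping.lookup m i)) = 0"
          by (simp add: cpoly_eval_bound[OF k] monom_torus_act wt_def algebra_simps sum_subtractf)
      qed (use k m in auto)
      then have "(2::complex) powi wt m = 1" using m by (simp add: in_keys_iff)
      then have "norm ((2::complex) powi wt m) = 1" by simp
      then have "(2::real) powi wt m = 1" by (simp add: norm_power_int)
      then have "(2::real) powr of_int (wt m) = 1" by (simp add: powr_real_of_int')
      then show ?thesis by (simp add: powr_eq_one_iff)
    qed
    then show ?thesis
      using p k deg by (simp add: wt_monoms_def wt_def invariant_polys_deg_def subset_iff)
  qed
  moreover have "p \<in> invariant_polys_deg a d"
    if p: "Poly_Mapping.keys p \<subseteq> wt_monoms ((!) a) ?n 0 d" for p
  proof -
    from p have k: "Poly_Mapping.keys m \<subseteq> {..<?n}" if "m \<in> Poly_Mapping.keys p" for m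
      using that by (auto simp: wt_monoms_def)
    have "cpoly_eval p (torus_act a w z) = cpoly_eval p z" if "w \<noteq> 0" for w z
    proof -
      have e: "cpoly_eval p y = (\<Sum>m\<in>Poly_Mapping.keys p. Poly_Mapping.lookup p m *
          (\<Prod>i<?n. y i ^ Poly_Mapping.lookup m i))" for y
        by (rule cpoly_eval_bound) (rule k)
      show ?thesis
        unfolding e monom_torus_act[OF that]
        using p by (intro sum.cong) (auto simp: wt_monoms_def subset_iff)
    qed
    moreover have "(\<Sum>i\<in>Poly_Mapping.keys m. Poly_Mapping.lookup m i) = d"
      if "m \<in> Poly_Mapping.keys p" for m
      using deg[OF k[OF that]] p that by (auto simp: wt_monoms_def)
    ultimately show ?thesis
      using k by (simp add: invariant_polys_deg_def invariant_polys_def)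
  qed
  ultimately show ?thesis by blast
qed

lemma lookup_cpoly_scale: "Poly_Mapping.lookup (cpoly_scale c p) m = c * Poly_Mapping.lookup p m"
  unfolding cpoly_scale_def mult_map_scale_conv_mult[symmetric]
  by (simp add: Poly_Mapping.map.rep_eq when_def)

lemma dim_cpoly:
  assumes "finite M"
  shows "vector_space.dim cpoly_scale {p :: cpoly. Poly_Mapping.keys p \<subseteq> M} = card M"
proof -
  interpret vector_space cpoly_scale by (rule vector_space_cpoly_scale)
  let ?e = "\<lambda>m. Poly_Mapping.single m (1::complex)"
  have inj: "inj ?e" by (rule injI) (metis keys_single one_neq_zero singleton_inject)
  have sum: "(\<Sum>m\<in>Poly_Mapping.keys p. cpoly_scale (Poly_Mapping.lookup p m) (?e m)) = p" for p :: cpoly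
    by (rule poly_mapping_eqI)
      (auto simp: lookup_sum lookup_cpoly_scale lookup_single when_def in_keys_iff if_distrib sum.delta
        cong: if_cong)
  have "card (?e ` M) = dim {p :: cpoly. Poly_Mapping.keys p \<subseteq> M}"
  proof (rule basis_card_eq_dim)
    show "?e ` M \<subseteq> {p. Poly_Mapping.keys p \<subseteq> M}" by auto
    show "{p :: cpoly. Poly_Mapping.keys p \<subseteq> M} \<subseteq> span (?e ` M)"
    proof clarify
      fix p :: cpoly assume "Poly_Mapping.keys p \<subseteq> M"
      then have "(\<Sum>m\<in>Poly_Mapping.keys p. cpoly_scale (Poly_Mapping.lookup p m) (?e m)) \<in> span (?e ` M)"
        by (intro span_sum span_scale span_base) auto
      then show "p \<in> span (?e ` M)" by (simp add: sum)
    qed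
    show "independent (?e ` M)"
    proof (rule independent_if_scalars_zero)
      fix f x assume 0: "(\<Sum>x\<in>?e ` M. cpoly_scale (f x) x) = 0" and "x \<in> ?e ` M"
      then obtain m where m: "m \<in> M" "x = ?e m" by auto
      have "0 = Poly_Mapping.lookup (\<Sum>x\<in>?e ` M. cpoly_scale (f x) x) m" by (simp add: 0)
      also have "\<dots> = (\<Sum>m'\<in>M. f (?e m') * Poly_Mapping.lookup (?e m') m)"
        by (subst sum.reindex) (auto intro: inj_on_subset[OF inj] simp: lookup_sum lookup_cpoly_scale)
      also have "\<dots> = f (?e m)" using m assms
        by (simp add: lookup_single when_def if_distrib sum.delta cong: if_cong)
      finally show "f x = 0" using m by simp
    qed (use assms in auto)
  qed
  then show ?thesis by (simp add: card_image inj_on_subset[OF inj])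
qed

lemma Hilb_eq: "Hilb a = Abs_fps (\<lambda>d. of_nat (wt_count ((!) a) (length a) 0 d))"
  by (simp add: Hilb_def invariant_polys_deg_eq dim_cpoly wt_count_def)

lemma elim_den_nonzero:
  fixes T :: "nat \<Rightarrow> 'a :: idom"
  assumes "\<And>i. i < k \<Longrightarrow> T j ^ w i * T i ^ w j \<noteq> 1"
  shows "elim_den w T k j \<noteq> 0"
  using assms unfolding elim_den_def
  by (simp only: prod_zero_iff finite_lessThan right_minus_eq) (metis lessThan_iff)

abbreviation (input) gen_den :: "(nat \<Rightarrow> nat) \<Rightarrow> (nat \<Rightarrow> 'a :: comm_ring_1) \<Rightarrow> nat \<Rightarrow> nat \<Rightarrow> 'a" where
  "gen_den w T k n \<equiv> (\<Prod>j\<in>{k..<n}. elim_den w T k j)"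

lemma Hilb_elimination:
  fixes a :: "int list"
  assumes n: "length a = n" "0 < k" "k \<le> n"
    and neg: "\<And>i. i < k \<Longrightarrow> a ! i < 0" and pos: "\<And>i. k \<le> i \<Longrightarrow> i < n \<Longrightarrow> a ! i > 0"
    and w: "\<And>i. w i = nat \<bar>a ! i\<bar>"
  shows "Hilb a * gen_den w (\<lambda>_. fps_X) k n = elim_numer w (\<lambda>_. fps_X) k n"
proof -
  let ?X = "fps_X :: complex fps"
  \<comment> \<open>The coefficient of \<open>z^(-e)\<close> in the product of the first
    \<open>r\<close> factors, so that pairing with \<open>z^e\<close> takes a constant term. The
    sign turns the negative weights into the positive exponents that \<open>chs\<close>
    expects.\<close>
  define psi where "psi r e = Abs_fps (\<lambda>d. of_nat (wt_count ((!) a) r (- int e) d) :: complex)" for r e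
  define P where "P = (\<Prod>i<k. monom 1 (w i) - [:?X:])"
  have w_neg: "a ! i = - int (w i)" "0 < w i" if "i < k" for i
    using neg[OF that] by (auto simp: w)
  have w_pos: "a ! i = int (w i)" if "k \<le> i" "i < n" for i
    using pos[OF that] by (auto simp: w)
  have rec: "Abs_fps (\<lambda>d. of_nat (wt_count ((!) a) (Suc r) v d)) =
      Abs_fps (\<lambda>d. of_nat (wt_count ((!) a) r v d)) +
      ?X * Abs_fps (\<lambda>d. of_nat (wt_count ((!) a) (Suc r) (v - a ! r) d))" for r v
    by (rule fps_ext) (simp add: wt_count_Suc[of _ r v])
  have psi_chs: "psi r = chs w (\<lambda>_. ?X) r" if "r \<le> k" for r
  proof
    fix e
    show "psi r e = chs w (\<lambda>_. ?X) r e"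
      using that
    proof (induction r arbitrary: e)
      case 0
      show ?case by (rule fps_ext) (simp add: psi_def wt_count_0)
    next
      case (Suc r)
      show ?case
      proof (induction e rule: less_induct)
        case (less e)
        have wr: "a ! r = - int (w r)" "0 < w r" using w_neg Suc.prems by auto
        have "psi (Suc r) e = psi r e + ?X * Abs_fps (\<lambda>d. of_nat (wt_count ((!) a) (Suc r) (int (w r) - int e) d))"
          unfolding psi_def by (subst rec) (simp add: wr)
        also have "Abs_fps (\<lambda>d. of_nat (wt_count ((!) a) (Suc r) (int (w r) - int e) d)) =
            (if w r \<le> e then psi (Suc r) (e - w r) else 0)"
        proof (cases "w r \<le> e")
          case True
          then show ?thesis by (simp add: psi_def of_nat_diff)
        next
          case False
          then have "wt_count ((!) a) (Suc r) (int (w r) - int e) d = 0" for d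
            using neg Suc.prems by (intro wt_count_eq_0) auto
          then show ?thesis using False by (simp add: fps_ext)
        qed
        also have "psi r e + ?X * \<dots> = chs w (\<lambda>_. ?X) (Suc r) e"
        proof -
          have "psi (Suc r) (e - w r) = chs w (\<lambda>_. ?X) (Suc r) (e - w r)" if "w r \<le> e"
            using less[of "e - w r"] wr that by simp
          moreover have "psi r e = chs w (\<lambda>_. ?X) r e" using Suc.IH Suc.prems by simp
          ultimately show ?thesis using wr by (subst chs.simps(2)) simp
        qed
        finally show ?case .
      qed
    qed
  qed
  have psi_step: "seqfun (psi (Suc r)) (p * (1 - monom ?X (w r))) = seqfun (psi r) p"
    if "k \<le> r" "r < n" for r p
  proof -
    have e: "psi (Suc r) e - ?X * psi (Suc r) (e + w r) = psi r e" for e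
    proof -
      have "- int e - a ! r = - int (e + w r)" using w_pos[OF that] by simp
      then show ?thesis unfolding psi_def rec[of r "- int e"] by (simp only: add_diff_cancel_right')
    qed
    have "seqfun (psi (Suc r)) (p * (1 - monom ?X (w r))) = seqfun (psi r) (p * 1)"
      by (rule seqfun_mult_eqI) (simp only: right_diff_distrib seqfun_diff mult_monom
        seqfun_monom mult_1_left mult_1_right e)
    then show ?thesis by simp
  qed
  have kills: "seqfun (psi r) (p * P) = 0" if "k \<le> r" "r \<le> n" for r p
    using that
  proof (induction r arbitrary: p rule: dec_induct)
    case base
    show ?case using w_neg n unfolding P_def psi_chs[OF order_refl] by (intro chs_kills_0) auto
  next
    case (step r)
    \<comment> \<open>The functional for \<open>r\<close> vanishes on multiples of \<open>P\<close>,
      so for \<open>Suc r\<close> a factor \<open>t\<close> can be extracted, and extracted again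
      from what remains. A power series divisible by every power of \<open>t\<close> is 0.\<close>
    have shift: "seqfun (psi (Suc r)) (p * P) = ?X * seqfun (psi (Suc r)) (p * monom 1 (w r) * P)" for p
    proof -
      have "0 = seqfun (psi (Suc r)) (p * P * (1 - monom ?X (w r)))"
        using step psi_step[of r "p * P"] by simp
      also have "p * P * (1 - monom ?X (w r)) =
          p * P - Polynomial.smult ?X (p * monom 1 (w r) * P)"
      proof -
        have "monom ?X (w r) = Polynomial.smult ?X (monom 1 (w r))" by (simp add: smult_monom)
        then show ?thesis by (simp add: algebra_simps)
      qed
      finally show ?thesis by (simp add: seqfun_diff seqfun_smult)
    qed
    have "fps_nth (seqfun (psi (Suc r)) (p * P)) d = 0" for d
    proof (induction d arbitrary: p)
      case 0
      show ?case by (subst shift) simp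
    next
      case (Suc d)
      show ?case by (subst shift) (simp add: Suc)
    qed
    then show ?case by (simp add: fps_ext)
  qed
  have "gen_den w (\<lambda>_. ?X) k n * seqfun (psi n) 1 =
      seqfun (psi k) (1 * (\<Prod>j\<in>{k..<n}. elim_poly w (\<lambda>_. ?X) k j))"
  proof (rule elimination)
    show "seqfun (psi (Suc r)) (p * (1 - monom ?X (w r))) = seqfun (psi r) p"
      if "k \<le> r" "r < n" for r p
      using that by (rule psi_step)
    show "seqfun (psi r) (p * (\<Prod>i<k. monom 1 (w i) - [:?X:])) = 0" if "k \<le> r" "r \<le> n" for r p
      using kills[OF that] unfolding P_def .
  qed (simp_all add: n seqfun_diff seqfun_smult)
  moreover have "seqfun (psi n) 1 = Hilb a"
    by (simp add: seqfun_def psi_def Hilb_eq n)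
  ultimately show ?thesis
    unfolding elim_numer_eq psi_chs[OF order_refl] mult_1_left by (metis mult.commute)
qed

section \<open>Passing to the expansion at t = 1\<close>

interpretation fps_of_poly_hom: comm_ring_hom "fps_of_poly :: 'a :: comm_ring_1 poly \<Rightarrow> 'a fps"
  by unfold_locales (simp_all add: fps_of_poly_add fps_of_poly_mult)

interpretation fps_to_fls_hom: comm_ring_hom "fps_to_fls :: 'a :: comm_ring_1 fps \<Rightarrow> 'a fls"
  by unfold_locales (simp_all add: fls_times_fps_to_fls)

definition at_1 :: "complex poly \<Rightarrow> complex fps" where
  "at_1 p = fps_of_poly (pcompose p [:1, -1:])"

interpretation at_1_hom: comm_ring_hom at_1
proof
  fix p q :: "complex poly"
  show "at_1 (p + q) = at_1 p + at_1 q"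
    by (simp only: at_1_def pcompose_add fps_of_poly_add)
  show "at_1 (p * q) = at_1 p * at_1 q"
    by (simp only: at_1_def pcompose_mult fps_of_poly_mult)
  show "at_1 1 = 1"
    by (simp only: at_1_def pcompose_1 fps_of_poly_1)
  show "at_1 0 = 0"
    by (simp only: at_1_def pcompose_0 fps_of_poly_0)
qed

lemma elim_den_var_nonzero:
  assumes "\<And>i. i < k \<Longrightarrow> w i \<noteq> 0"
  shows "elim_den w (\<lambda>_. [:0, 1 :: complex:]) k j \<noteq> 0"
proof -
  have False if i: "i < k" and e: "[:0, 1 :: complex:] ^ w i * [:0, 1:] ^ w j = 1" for i
  proof -
    have "poly ([:0, 1 :: complex:] ^ w i * [:0, 1:] ^ w j) 2 = poly 1 2" using e by (rule arg_cong)
    then have "(2 :: complex) ^ w i * 2 ^ w j = 1"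
      by (simp only: poly_mult poly_power poly_pCons poly_0 poly_1 mult_1_right add_0_left add_0_right mult_zero_right)
    then have "(2 :: complex) ^ (w i + w j) = 1" by (simp only: power_add)
    then have "norm ((2 :: complex) ^ (w i + w j)) = 1" by (simp only: norm_one)
    then have "(2 :: real) ^ (w i + w j) = 1" by (simp only: norm_power norm_numeral)
    moreover have "(1 :: real) < 2 ^ (w i + w j)" using assms[OF i] by (intro one_less_power) auto
    ultimately show False by simp
  qed
  then show ?thesis by (intro elim_den_nonzero) blast
qed

text \<open>The fraction is first written with polynomials in \<open>t\<close>, as the definition of
  the expansion demands. The specialisations \<open>t = fps_X\<close> and
  \<open>t = 1 - fps_X\<close> are then images of the same two polynomials under ring
  homomorphisms.\<close>

lemma laurent_at_1_Hilb:
  fixes a :: "int list"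
  assumes "length a = n" "0 < k" "k \<le> n"
    and "\<And>i. i < k \<Longrightarrow> a ! i < 0" and "\<And>i. k \<le> i \<Longrightarrow> i < n \<Longrightarrow> a ! i > 0"
    and w: "\<And>i. w i = nat \<bar>a ! i\<bar>"
  shows "laurent_at_1 (Hilb a) =
    fps_to_fls (elim_numer w (\<lambda>_. 1 - fps_X) k n) / fps_to_fls (gen_den w (\<lambda>_. 1 - fps_X) k n)"
proof -
  let ?t = "[:0, 1 :: complex:]"
  have t1: "at_1 ?t = 1 - fps_X"
  proof -
    have "pcompose ?t [:1, -1:] = [:1, -1:]" by (simp add: pcompose_pCons)
    also have "fps_of_poly \<dots> = 1 - fps_X" by (simp add: fps_of_poly_pCons)
    finally show ?thesis by (simp only: at_1_def)
  qed
  have "gen_den w (\<lambda>_. ?t) k n \<noteq> 0"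
  proof -
    have "elim_den w (\<lambda>_. ?t) k j \<noteq> 0" for j
      by (rule elim_den_var_nonzero) (use assms(4) in \<open>force simp: w\<close>)
    then show ?thesis by (simp only: prod_zero_iff finite_atLeastLessThan) blast
  qed
  moreover have "Hilb a * fps_of_poly (gen_den w (\<lambda>_. ?t) k n) = fps_of_poly (elim_numer w (\<lambda>_. ?t) k n)"
  proof -
    have X: "fps_of_poly ?t = fps_X" by (simp add: fps_of_poly_pCons)
    show ?thesis
      unfolding fps_of_poly_hom.hom_elim_numer fps_of_poly_hom.hom_prod fps_of_poly_hom.hom_elim_den X
      by (rule Hilb_elimination[OF assms])
  qed
  ultimately have "laurent_at_1 (Hilb a) =
      fps_to_fls (at_1 (elim_numer w (\<lambda>_. ?t) k n)) / fps_to_fls (at_1 (gen_den w (\<lambda>_. ?t) k n))"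
    unfolding at_1_def by (rule laurent_at_1_eqI)
  then show ?thesis
    unfolding at_1_hom.hom_elim_numer at_1_hom.hom_prod at_1_hom.hom_elim_den t1 .
qed

section \<open>Partial fractions\<close>

lemma chs_fps:
  fixes T :: "nat \<Rightarrow> 'a :: comm_ring_1"
  assumes "\<And>i. i < k \<Longrightarrow> 0 < w i"
  shows "Abs_fps (chs w T k) * (\<Prod>i<k. 1 - fps_const (T i) * fps_X ^ w i) = 1"
  using assms
proof (induction k)
  case 0
  have "Abs_fps (chs w T 0) = 1" by (rule fps_ext) simp
  then show ?case by (simp del: chs.simps)
next
  case (Suc k)
  have "Abs_fps (chs w T (Suc k)) * (1 - fps_const (T k) * fps_X ^ w k) = Abs_fps (chs w T k)"
  proof (rule fps_ext)
    fix e
    have "Abs_fps (chs w T (Suc k)) * (1 - fps_const (T k) * fps_X ^ w k) =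
        Abs_fps (chs w T (Suc k)) - fps_const (T k) * (fps_X ^ w k * Abs_fps (chs w T (Suc k)))"
      by (simp add: algebra_simps)
    then show "fps_nth (Abs_fps (chs w T (Suc k)) * (1 - fps_const (T k) * fps_X ^ w k)) e =
        fps_nth (Abs_fps (chs w T k)) e"
      using Suc.prems[of k] by (simp add: fps_X_power_mult_nth chs.simps(2)[of w T k e])
  qed
  moreover have "Abs_fps (chs w T (Suc k)) * (\<Prod>i<Suc k. 1 - fps_const (T i) * fps_X ^ w i) =
      Abs_fps (chs w T (Suc k)) * (1 - fps_const (T k) * fps_X ^ w k) *
        (\<Prod>i<k. 1 - fps_const (T i) * fps_X ^ w i)"
    by (simp add: mult_ac)
  ultimately show ?case using Suc by simp
qed

text \<open>\<open>\<Theta> i\<close> collects all roots of \<open>z^(w i) = T i\<close>, and the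
  hypotheses make the poles \<open>1 / \<theta>\<close> simple and distinct. Lagrange interpolation
  writes 1 as a combination of the polynomials \<open>Q / (1 - \<theta> z)\<close>; dividing by
  \<open>Q\<close> leaves geometric series with coefficients \<open>\<theta>^e\<close>.\<close>

lemma chs_partial_fractions:
  fixes T :: "nat \<Rightarrow> 'a :: field" and \<Theta> :: "nat \<Rightarrow> 'a set"
  assumes k: "0 < k" and w: "\<And>i. i < k \<Longrightarrow> 0 < w i"
    and card: "\<And>i. i < k \<Longrightarrow> card (\<Theta> i) = w i"
    and root: "\<And>i \<theta>. i < k \<Longrightarrow> \<theta> \<in> \<Theta> i \<Longrightarrow> \<theta> ^ w i = T i"
    and nz: "\<And>i \<theta>. i < k \<Longrightarrow> \<theta> \<in> \<Theta> i \<Longrightarrow> \<theta> \<noteq> 0"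
    and nonroot: "\<And>i i' \<theta>. i < k \<Longrightarrow> i' < k \<Longrightarrow> i' \<noteq> i \<Longrightarrow> \<theta> \<in> \<Theta> i \<Longrightarrow> \<theta> ^ w i' \<noteq> T i'"
    and char: "\<And>i. i < k \<Longrightarrow> of_nat (w i) \<noteq> (0 :: 'a)"
  shows "chs w T k e = (\<Sum>i<k. \<Sum>\<theta>\<in>\<Theta> i.
    \<theta> ^ e / (of_nat (w i) * (\<Prod>i'\<in>{..<k} - {i}. 1 - T i' / \<theta> ^ w i')))"
proof -
  define q where "q i = 1 - monom (T i) (w i)" for i
  define Q where "Q = (\<Prod>i<k. q i)"
  \<comment> \<open>This is \<open>Q / (1 - \<theta> z)\<close>: the geometric sum is the cofactor
    of \<open>1 - \<theta> z\<close> in \<open>q i\<close>. At \<open>1 / \<theta>\<close> every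
    term of that sum is 1, which explains the factor \<open>w i\<close> in \<open>R\<close>.\<close>
  define G where "G i \<theta> = (\<Sum>l<w i. monom \<theta> 1 ^ l) * (\<Prod>i'\<in>{..<k} - {i}. q i')" for i \<theta>
  define R where "R i \<theta> = of_nat (w i) * (\<Prod>i'\<in>{..<k} - {i}. 1 - T i' / \<theta> ^ w i')" for i \<theta>
  define B where "B = (\<Sum>i<k. w i)"
  have fin: "finite (\<Theta> i)" if "i < k" for i
    using card[OF that] w[OF that] by (metis card.infinite less_irrefl)
  have B: "B > 0" unfolding B_def using k w by (intro sum_pos) auto
  have GQ: "G i \<theta> * (1 - monom \<theta> 1) = Q" if "i < k" "\<theta> \<in> \<Theta> i" for i \<theta>
  proof -
    have "(1 - monom \<theta> 1) * (\<Sum>l<w i. monom \<theta> 1 ^ l) = q i"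
      unfolding one_diff_power_eq[symmetric] q_def using root[OF that] by (simp add: monom_power)
    then show ?thesis unfolding G_def Q_def
      using that by (subst prod.remove[of _ i]) (auto simp: mult_ac)
  qed
  have Gself: "poly (G i \<theta>) (1 / \<theta>) = R i \<theta>" if "i < k" "\<theta> \<in> \<Theta> i" for i \<theta>
    using nz[OF that]
    by (simp add: G_def R_def poly_mult poly_sum poly_prod poly_power poly_monom q_def power_one_over
        divide_inverse power_inverse)
  have Rnz: "R i \<theta> \<noteq> 0" if "i < k" "\<theta> \<in> \<Theta> i" for i \<theta>
  proof -
    have "1 - T i' / \<theta> ^ w i' \<noteq> 0" if "i' < k" "i' \<noteq> i" for i'
      using nonroot[OF \<open>i < k\<close> that \<open>\<theta> \<in> \<Theta> i\<close>] nz[OF \<open>i < k\<close> \<open>\<theta> \<in> \<Theta> i\<close>] by (simp add: field_simps)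
    then show ?thesis using char[of i] that by (auto simp: R_def)
  qed
  have Gother: "poly (G i' \<theta>') (1 / \<theta>) = 0"
    if "i < k" "\<theta> \<in> \<Theta> i" "i' < k" "\<theta>' \<in> \<Theta> i'" "\<theta>' \<noteq> \<theta>" for i \<theta> i' \<theta>'
  proof -
    have "poly Q (1 / \<theta>) = 0"
    proof -
      have "poly (q i) (1 / \<theta>) = 0"
        using nz[OF that(1,2)]
        by (simp add: q_def poly_monom power_one_over root[OF that(1,2), symmetric])
      then show ?thesis unfolding Q_def poly_prod using that(1) by auto
    qed
    then have "poly (G i' \<theta>') (1 / \<theta>) * (1 - \<theta>' / \<theta>) = 0"
      unfolding GQ[OF that(3,4), symmetric] by (simp add: poly_monom)
    then show ?thesis using that(5) nz[OF that(1,2)] by auto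
  qed
  define F where "F = (\<Sum>i<k. \<Sum>\<theta>\<in>\<Theta> i. Polynomial.smult (1 / R i \<theta>) (G i \<theta>))"
  have disj: "\<Theta> i \<inter> \<Theta> i' = {}" if "i < k" "i' < k" "i \<noteq> i'" for i i'
    using nonroot[of i' i] root[of i] that by blast
  \<comment> \<open>Both sides have degree below \<open>B\<close> and agree at the \<open>B\<close>
    points \<open>1 / \<theta>\<close>.\<close>
  have "F = 1"
  proof (rule poly_eqI_degree)
    let ?A = "(\<lambda>\<theta>. 1 / \<theta>) ` (\<Union>i<k. \<Theta> i)"
    have cA: "card ?A = B"
    proof -
      have "card ?A = card (\<Union>i<k. \<Theta> i)" by (rule card_image) (auto intro: inj_onI)
      also have "\<dots> = (\<Sum>i<k. card (\<Theta> i))" using fin disj by (intro card_UN_disjoint) auto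
      finally show ?thesis by (simp add: B_def card)
    qed
    show "degree 1 < card ?A" using B by (simp add: cA)
    have "degree F \<le> B - 1" unfolding F_def
    proof (rule degree_sum_le)
      fix i assume i: "i \<in> {..<k}"
      then have wi: "w i > 0" using w by simp
      show "degree (\<Sum>\<theta>\<in>\<Theta> i. Polynomial.smult (1 / R i \<theta>) (G i \<theta>)) \<le> B - 1"
      proof (rule degree_sum_le)
        fix \<theta> assume "\<theta> \<in> \<Theta> i"
        have "degree (Polynomial.smult (1 / R i \<theta>) (G i \<theta>)) \<le> degree (G i \<theta>)" by (rule degree_smult_le)
        also have "\<dots> \<le> degree (\<Sum>l<w i. monom \<theta> 1 ^ l) + degree (\<Prod>i'\<in>{..<k} - {i}. q i')"
          unfolding G_def by (rule degree_mult_le)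
        also have "degree (\<Sum>l<w i. monom \<theta> 1 ^ l) \<le> w i - 1"
          by (rule degree_sum_le) (auto simp: monom_power intro!: degree_monom_le[THEN order_trans])
        also have "degree (\<Prod>i'\<in>{..<k} - {i}. q i') \<le> (\<Sum>i'\<in>{..<k} - {i}. degree (q i'))"
          using degree_prod_sum_le[of "{..<k} - {i}" q] by (simp add: o_def)
        also have "\<dots> \<le> (\<Sum>i'\<in>{..<k} - {i}. w i')"
          unfolding q_def by (intro sum_mono degree_diff_le degree_monom_le) simp
        also have "w i - 1 + (\<Sum>i'\<in>{..<k} - {i}. w i') = B - 1"
          unfolding B_def using i wi by (subst sum.remove[of _ i]) auto
        finally show "degree (Polynomial.smult (1 / R i \<theta>) (G i \<theta>)) \<le> B - 1" by simp
      qed (use fin i in auto)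
    qed simp
    then show "degree F < card ?A" using B by (simp add: cA)
    fix x assume "x \<in> ?A"
    then obtain i \<theta> where i: "i < k" "\<theta> \<in> \<Theta> i" and x: "x = 1 / \<theta>" by auto
    have "poly F x = (\<Sum>i'<k. \<Sum>\<theta>'\<in>\<Theta> i'. poly (G i' \<theta>') x / R i' \<theta>')"
      by (simp add: F_def poly_sum)
    also have "\<dots> = (\<Sum>i'<k. \<Sum>\<theta>'\<in>\<Theta> i'. if i' = i \<and> \<theta>' = \<theta> then 1 else 0)"
    proof (intro sum.cong refl)
      fix i' \<theta>' assume a: "i' \<in> {..<k}" "\<theta>' \<in> \<Theta> i'"
      show "poly (G i' \<theta>') x / R i' \<theta>' = (if i' = i \<and> \<theta>' = \<theta> then 1 else 0)"
      proof (cases "\<theta>' = \<theta>")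
        case True
        then have "i' = i" using disj[of i i'] i a by auto
        then show ?thesis using True Gself[OF i] Rnz[OF i] x by simp
      qed (use Gother[OF i] a x in auto)
    qed
    also have "\<dots> = (\<Sum>i'<k. if i' = i then 1 else 0)"
      using i fin by (intro sum.cong refl) auto
    finally show "poly F x = poly 1 x" using i by simp
  qed
  let ?A = "Abs_fps (chs w T k)"
  have AQ: "?A * fps_of_poly Q = 1"
    using chs_fps[of k w T] w
    by (simp add: Q_def q_def fps_of_poly_prod fps_of_poly_diff fps_of_poly_monom)
  have AG: "?A * fps_of_poly (G i \<theta>) = Abs_fps (\<lambda>e. \<theta> ^ e)" if "i < k" "\<theta> \<in> \<Theta> i" for i \<theta>
  proof -
    have 1: "Abs_fps (\<lambda>e. \<theta> ^ e) * (1 - fps_const \<theta> * fps_X) = 1"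
      by (rule fps_ext) (simp add: algebra_simps power_eq_if)
    have "?A * fps_of_poly (G i \<theta>) * (1 - fps_const \<theta> * fps_X) = ?A * fps_of_poly Q"
      unfolding GQ[OF that, symmetric]
      by (simp add: fps_of_poly_mult fps_of_poly_diff fps_of_poly_monom mult.assoc)
    then have "?A * fps_of_poly (G i \<theta>) * (1 - fps_const \<theta> * fps_X) =
        Abs_fps (\<lambda>e. \<theta> ^ e) * (1 - fps_const \<theta> * fps_X)"
      by (simp only: AQ 1)
    moreover have "1 - fps_const \<theta> * fps_X \<noteq> 0" using 1 by auto
    ultimately show ?thesis by simp
  qed
  have "?A = ?A * fps_of_poly F" by (simp add: \<open>F = 1\<close>)
  also have "\<dots> = (\<Sum>i<k. \<Sum>\<theta>\<in>\<Theta> i. fps_const (1 / R i \<theta>) * (?A * fps_of_poly (G i \<theta>)))"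
    unfolding F_def by (simp add: fps_of_poly_sum fps_of_poly_smult sum_distrib_left mult_ac)
  also have "\<dots> = (\<Sum>i<k. \<Sum>\<theta>\<in>\<Theta> i. fps_const (1 / R i \<theta>) * Abs_fps (\<lambda>e. \<theta> ^ e))"
    by (intro sum.cong refl) (simp add: AG)
  finally have "fps_nth ?A e =
      fps_nth (\<Sum>i<k. \<Sum>\<theta>\<in>\<Theta> i. fps_const (1 / R i \<theta>) * Abs_fps (\<lambda>e. \<theta> ^ e)) e"
    by (rule arg_cong)
  then show ?thesis by (simp add: fps_sum_nth R_def)
qed

text \<open>The second use of \<open>elimination\<close>. By partial fractions the functional of
  \<open>chs\<close> is a weighted sum of evaluations at the roots. Dividing the weights by further
  factors \<open>1 - T j * \<theta> ^ w j\<close> yields the functionals \<open>L r\<close>; they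
  kill the product of the \<open>z^(w i) - T i\<close> simply because it vanishes at every
  root.\<close>

lemma elim_numer_roots:
  fixes T :: "nat \<Rightarrow> 'a :: field" and \<Theta> :: "nat \<Rightarrow> 'a set"
  assumes k: "0 < k" "k \<le> n" and w: "\<And>i. i < k \<Longrightarrow> 0 < w i"
    and card: "\<And>i. i < k \<Longrightarrow> card (\<Theta> i) = w i"
    and root: "\<And>i \<theta>. i < k \<Longrightarrow> \<theta> \<in> \<Theta> i \<Longrightarrow> \<theta> ^ w i = T i"
    and nz: "\<And>i \<theta>. i < k \<Longrightarrow> \<theta> \<in> \<Theta> i \<Longrightarrow> \<theta> \<noteq> 0"
    and nonroot: "\<And>i i' \<theta>. i < k \<Longrightarrow> i' < k \<Longrightarrow> i' \<noteq> i \<Longrightarrow> \<theta> \<in> \<Theta> i \<Longrightarrow> \<theta> ^ w i' \<noteq> T i'"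
    and nonpole: "\<And>i j \<theta>. i < k \<Longrightarrow> k \<le> j \<Longrightarrow> j < n \<Longrightarrow> \<theta> \<in> \<Theta> i \<Longrightarrow> T j * \<theta> ^ w j \<noteq> 1"
    and char: "\<And>i. i < k \<Longrightarrow> of_nat (w i) \<noteq> (0 :: 'a)"
  shows "elim_numer w T k n = (\<Prod>j\<in>{k..<n}. elim_den w T k j) *
    (\<Sum>i<k. \<Sum>\<theta>\<in>\<Theta> i. 1 / (of_nat (w i) * (\<Prod>i'\<in>{..<k} - {i}. 1 - T i' / \<theta> ^ w i') *
       (\<Prod>j\<in>{k..<n}. 1 - T j * \<theta> ^ w j)))"
proof -
  define R where "R i \<theta> = of_nat (w i) * (\<Prod>i'\<in>{..<k} - {i}. 1 - T i' / \<theta> ^ w i')" for i \<theta>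
  define L where "L r p = (\<Sum>i<k. \<Sum>\<theta>\<in>\<Theta> i. poly p \<theta> / (R i \<theta> * (\<Prod>j\<in>{k..<r}. 1 - T j * \<theta> ^ w j)))"
    for r p
  have "seqfun (chs w T k) p = L k p" for p
  proof -
    have "seqfun (chs w T k) p =
        (\<Sum>e\<le>degree p. \<Sum>i<k. \<Sum>\<theta>\<in>\<Theta> i. coeff p e * \<theta> ^ e / R i \<theta>)"
      unfolding seqfun_def R_def
      by (subst chs_partial_fractions[OF k(1) w card root nz nonroot char])
        (simp_all add: sum_distrib_left)
    also have "\<dots> = (\<Sum>i<k. \<Sum>\<theta>\<in>\<Theta> i. \<Sum>e\<le>degree p. coeff p e * \<theta> ^ e / R i \<theta>)"
      by (subst sum.swap, intro sum.cong refl, rule sum.swap)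
    also have "\<dots> = L k p"
      by (simp add: L_def poly_altdef sum_divide_distrib)
    finally show ?thesis .
  qed
  moreover have "(\<Prod>j\<in>{k..<n}. elim_den w T k j) * L n 1 =
      L k (1 * (\<Prod>j\<in>{k..<n}. elim_poly w T k j))"
  proof (rule elimination)
    show "L (Suc r) (p * (1 - monom (T r) (w r))) = L r p" if "k \<le> r" "r < n" for r p
    proof -
      have "1 - T r * \<theta> ^ w r \<noteq> 0" if "i < k" "\<theta> \<in> \<Theta> i" for i \<theta>
        using nonpole[of i r \<theta>] that \<open>k \<le> r\<close> \<open>r < n\<close> by auto
      then show ?thesis unfolding L_def using \<open>k \<le> r\<close>
        by (intro sum.cong refl) (simp add: poly_monom)
    qed
    show "L r (p * (\<Prod>i<k. monom 1 (w i) - [:T i:])) = 0" for r p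
    proof -
      have "(\<Prod>i<k. poly (monom 1 (w i) - [:T i:]) \<theta>) = 0" if "i < k" "\<theta> \<in> \<Theta> i" for i \<theta>
        using root[OF that] that by (auto simp: poly_monom)
      then show ?thesis unfolding L_def poly_mult poly_prod
        by (intro sum.neutral ballI) (simp only: lessThan_iff mult_zero_right div_0)
    qed
  qed (simp_all add: k L_def diff_divide_distrib sum_subtractf sum_distrib_left)
  ultimately show ?thesis by (simp add: elim_numer_eq L_def R_def)
qed

section \<open>Binomial series\<close>

text \<open>The variable is \<open>s = 1 - t\<close>, so that this binomial series stands for \<open>t\<^sup>\<alpha>\<close>.\<close>

definition bpow :: "complex \<Rightarrow> complex fps" where
  "bpow \<alpha> = Abs_fps (\<lambda>d. (-1) ^ d * (\<alpha> gchoose d))"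

lemma bpow_compose: "bpow \<alpha> = fps_compose (fps_binomial \<alpha>) (fps_const (-1) * fps_X)"
  by (rule fps_ext) (simp only: bpow_def fps_nth_Abs_fps fps_nth_compose_linear fps_binomial_nth)

lemma bpow_add: "bpow (\<alpha> + \<beta>) = bpow \<alpha> * bpow \<beta>"
  unfolding bpow_compose fps_binomial_add_mult by (rule fps_compose_mult_distrib) simp

lemma bpow_0 [simp]: "bpow 0 = 1"
  by (simp add: bpow_compose)

lemma bpow_power: "bpow \<alpha> ^ m = bpow (of_nat m * \<alpha>)"
  by (induction m) (simp_all add: bpow_add algebra_simps)

lemma bpow_1: "bpow 1 = 1 - fps_X"
  by (simp add: bpow_compose fps_binomial_1 fps_compose_add_distrib)

lemma bpow_nth_0 [simp]: "fps_nth (bpow \<alpha>) 0 = 1"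
  and bpow_nth_1: "fps_nth (bpow \<alpha>) (Suc 0) = - \<alpha>"
  and bpow_nth_2: "fps_nth (bpow \<alpha>) 2 = \<alpha> * (\<alpha> - 1) / 2"
  and bpow_nth_3: "fps_nth (bpow \<alpha>) 3 = - (\<alpha> * (\<alpha> - 1) * (\<alpha> - 2) / 6)"
  by (simp_all add: bpow_def gbinomial_prod_rev numeral_2_eq_2 numeral_3_eq_3 lessThan_Suc
      atLeast0LessThan field_simps)

text \<open>The coefficients of \<open>s^0\<close> and \<open>s^1\<close> decide. As a consequence,
  nonzero exponents keep all denominators nonzero whatever the roots of unity are.\<close>

lemma const_bpow_eq_1_iff: "fps_const u * bpow \<alpha> = 1 \<longleftrightarrow> u = 1 \<and> \<alpha> = 0"
proof
  assume e: "fps_const u * bpow \<alpha> = 1"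
  have "u = 1" using arg_cong[OF e, of "\<lambda>f. fps_nth f 0"] by simp
  then show "u = 1 \<and> \<alpha> = 0"
    using arg_cong[OF e, of "\<lambda>f. fps_nth f (Suc 0)"] by (simp add: bpow_nth_1)
qed simp

text \<open>\<open>s / (1 - u (1 - s)\<^sup>\<alpha>)\<close>, which has no pole at \<open>s = 0\<close> when \<open>\<alpha> \<noteq> 0\<close>.\<close>

definition fac_inv :: "complex \<Rightarrow> complex \<Rightarrow> complex fps" where
  "fac_inv u \<alpha> = (if u = 1 then inverse (fps_shift 1 (1 - bpow \<alpha>))
     else fps_X * inverse (1 - fps_const u * bpow \<alpha>))"

lemma fac_inv:
  assumes "\<alpha> \<noteq> 0"
  shows "(1 - fps_const u * bpow \<alpha>) * fac_inv u \<alpha> = fps_X"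
proof (cases "u = 1")
  case True
  define g where "g = fps_shift 1 (1 - bpow \<alpha>)"
  have "1 - bpow \<alpha> = g * fps_X"
    unfolding g_def by (rule fps_ext) (auto simp: fps_X_mult_right_nth)
  moreover have "g * inverse g = 1"
    using assms by (intro inverse_mult_eq_1') (simp add: g_def bpow_nth_1)
  ultimately have "(1 - bpow \<alpha>) * inverse g = fps_X"
    by (simp add: mult_ac)
  then show ?thesis using True by (simp add: fac_inv_def g_def)
next
  case False
  then have "(1 - fps_const u * bpow \<alpha>) * inverse (1 - fps_const u * bpow \<alpha>) = 1"
    by (intro inverse_mult_eq_1') simp
  then show ?thesis using False by (simp add: fac_inv_def mult_ac)
qed

text \<open>For \<open>u = 1\<close> these are the first terms of
  \<open>s / (1 - (1 - s)^\<alpha>)\<close>; the 12 in the third one is where the denominators 12 of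
  the final formulas come from.\<close>

lemma fac_inv_nth:
  assumes a: "\<alpha> \<noteq> 0"
  shows "fps_nth (fac_inv u \<alpha>) 0 = (if u = 1 then 1 / \<alpha> else 0)"
    and "fps_nth (fac_inv u \<alpha>) (Suc 0) = (if u = 1 then (\<alpha> - 1) / (2 * \<alpha>) else 1 / (1 - u))"
    and "fps_nth (fac_inv u \<alpha>) 2 =
      (if u = 1 then (\<alpha>\<^sup>2 - 1) / (12 * \<alpha>) else - u * \<alpha> / (1 - u)\<^sup>2)"
proof -
  define F where "F d = fps_nth (fac_inv u \<alpha>) d" for d
  define f where "f d = fps_nth (1 - fps_const u * bpow \<alpha>) d" for d
  have f: "f 0 = 1 - u" "f 1 = u * \<alpha>" "f 2 = - u * (\<alpha> * (\<alpha> - 1)) / 2"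
    "f 3 = u * (\<alpha> * (\<alpha> - 1) * (\<alpha> - 2)) / 6"
    by (simp_all add: f_def bpow_nth_1 bpow_nth_2 bpow_nth_3)
  \<comment> \<open>Comparison of coefficients in
    \<open>(1 - u t^\<alpha>) * fac_inv u \<alpha> = s\<close>. If \<open>u = 1\<close>, then
    \<open>f 0 = 0\<close> and the coefficient \<open>F d\<close> is determined only by the equation
    of degree \<open>d + 1\<close>; hence degree 3 is needed for \<open>F 2\<close>.\<close>
  have c: "(\<Sum>i=0..d. f i * F (d - i)) = (if d = 1 then 1 else 0)" for d
    using arg_cong[OF fac_inv[OF a, of u], of "\<lambda>g. fps_nth g d"] unfolding f_def F_def
    by (simp add: fps_mult_nth)
  have c0: "f 0 * F 0 = 0" using c[of 0] by simp
  have c1: "f 0 * F 1 + f 1 * F 0 = 1" using c[of 1] by simp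
  have c2: "f 0 * F 2 + f 1 * F 1 + f 2 * F 0 = 0"
    using c[of 2] by (simp add: numeral_2_eq_2)
  have c3: "f 0 * F 3 + f 1 * F 2 + f 2 * F 1 + f 3 * F 0 = 0"
    using c[of 3] by (simp add: numeral_2_eq_2 numeral_3_eq_3)
  show F0: "fps_nth (fac_inv u \<alpha>) 0 = (if u = 1 then 1 / \<alpha> else 0)"
    using c0 c1 a unfolding f F_def[symmetric] by (auto simp: field_simps)
  show F1: "fps_nth (fac_inv u \<alpha>) (Suc 0) = (if u = 1 then (\<alpha> - 1) / (2 * \<alpha>) else 1 / (1 - u))"
  proof (cases "u = 1")
    case True
    have "\<alpha> * F 1 = (\<alpha> - 1) / 2 * (\<alpha> * F 0)"
      using c2 True unfolding f by (simp add: field_simps)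
    also have "\<alpha> * F 0 = 1" using F0 a True by (simp add: F_def)
    finally have "\<alpha> * F 1 = (\<alpha> - 1) / 2" by simp
    then show ?thesis using a True by (simp add: F_def field_simps)
  next
    case False
    then show ?thesis using c1 F0 unfolding f F_def[symmetric] by (simp add: field_simps)
  qed
  show "fps_nth (fac_inv u \<alpha>) 2 =
      (if u = 1 then (\<alpha>\<^sup>2 - 1) / (12 * \<alpha>) else - u * \<alpha> / (1 - u)\<^sup>2)"
  proof (cases "u = 1")
    case True
    define p q where "p = \<alpha> * (\<alpha> - 1) / 2" and "q = \<alpha> * (\<alpha> - 1) * (\<alpha> - 2) / 6"
    have "\<alpha> * F 2 + - p * F 1 + q * F 0 = 0"
      using c3 True unfolding f p_def q_def by simp
    moreover have "\<alpha> * F 2 - (p * F 1 - q * F 0) = \<alpha> * F 2 + - p * F 1 + q * F 0"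
      by (simp add: algebra_simps)
    ultimately have "\<alpha> * F 2 = p * F 1 - q * F 0" by (simp only: right_minus_eq)
    also have "\<dots> = (\<alpha>\<^sup>2 - 1) / 12"
      using F0 F1 a True unfolding p_def q_def
      by (simp add: F_def power2_eq_square) (simp add: field_simps)
    finally show ?thesis using a True by (simp add: F_def field_simps)
  next
    case False
    then have "(1 - u) * F 2 = - u * \<alpha> / (1 - u)" using c2 F0 F1 unfolding f
      by (simp add: F_def field_simps)
    moreover have "F 2 = (1 - u) * F 2 / (1 - u)" using False by simp
    ultimately have "F 2 = - u * \<alpha> / (1 - u) / (1 - u)" by (simp only:)
    then show ?thesis using False by (simp add: F_def power2_eq_square)
  qed
qed

section \<open>Perturbed exponents\<close>

text \<open>Coefficientwise convergence is enough, since a single coefficient is wanted in the end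
  and products and inverses involve only finitely many coefficients at a time.\<close>

definition fps_lim :: "('b \<Rightarrow> complex fps) \<Rightarrow> complex fps \<Rightarrow> 'b filter \<Rightarrow> bool" where
  "fps_lim F G \<F> \<longleftrightarrow> (\<forall>d. ((\<lambda>x. fps_nth (F x) d) \<longlongrightarrow> fps_nth G d) \<F>)"

lemma fps_lim_const [simp]: "fps_lim (\<lambda>_. F) F \<F>"
  by (simp add: fps_lim_def)

lemma fps_lim_add: "fps_lim F F' \<F> \<Longrightarrow> fps_lim G G' \<F> \<Longrightarrow> fps_lim (\<lambda>x. F x + G x) (F' + G') \<F>"
  by (auto simp: fps_lim_def intro: tendsto_add)

lemma fps_lim_uminus: "fps_lim F F' \<F> \<Longrightarrow> fps_lim (\<lambda>x. - F x) (- F') \<F>"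
  by (auto simp: fps_lim_def intro: tendsto_minus)

lemma fps_lim_diff: "fps_lim F F' \<F> \<Longrightarrow> fps_lim G G' \<F> \<Longrightarrow> fps_lim (\<lambda>x. F x - G x) (F' - G') \<F>"
  by (auto simp: fps_lim_def intro: tendsto_diff)

lemma fps_lim_mult: "fps_lim F F' \<F> \<Longrightarrow> fps_lim G G' \<F> \<Longrightarrow> fps_lim (\<lambda>x. F x * G x) (F' * G') \<F>"
  by (auto simp: fps_lim_def fps_mult_nth intro!: tendsto_sum tendsto_mult)

lemma fps_lim_sum: "(\<And>i. i \<in> A \<Longrightarrow> fps_lim (\<lambda>x. F x i) (G i) \<F>) \<Longrightarrow>
    fps_lim (\<lambda>x. \<Sum>i\<in>A. F x i) (\<Sum>i\<in>A. G i) \<F>"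
  by (induction A rule: infinite_finite_induct) (auto intro: fps_lim_add)

lemma fps_lim_prod: "(\<And>i. i \<in> A \<Longrightarrow> fps_lim (\<lambda>x. F x i) (G i) \<F>) \<Longrightarrow>
    fps_lim (\<lambda>x. \<Prod>i\<in>A. F x i) (\<Prod>i\<in>A. G i) \<F>"
  by (induction A rule: infinite_finite_induct) (auto intro: fps_lim_mult)

lemma fps_lim_power: "fps_lim F G \<F> \<Longrightarrow> fps_lim (\<lambda>x. F x ^ m) (G ^ m) \<F>"
  by (induction m) (auto intro: fps_lim_mult)

lemma fps_lim_shift: "fps_lim F G \<F> \<Longrightarrow> fps_lim (\<lambda>x. fps_shift m (F x)) (fps_shift m G) \<F>"
  by (auto simp: fps_lim_def)

text \<open>Induction along the recurrence for the coefficients of an inverse, where the only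
  division is by the constant term.\<close>

lemma fps_lim_inverse:
  assumes F: "fps_lim F G \<F>" and 0: "fps_nth G 0 \<noteq> 0"
  shows "fps_lim (\<lambda>x. inverse (F x)) (inverse G) \<F>"
proof -
  have lim: "((\<lambda>x. fps_nth (F x) d) \<longlongrightarrow> fps_nth G d) \<F>" for d
    using F by (simp add: fps_lim_def)
  have "((\<lambda>x. fps_nth (inverse (F x)) d) \<longlongrightarrow> fps_nth (inverse G) d) \<F>" for d
  proof (induction d rule: less_induct)
    case (less d)
    show ?case
    proof (cases "d = 0")
      case True
      then show ?thesis using lim[of 0] 0 by (auto intro: tendsto_inverse)
    next
      case False
      have "fps_nth (inverse f) d = - inverse (fps_nth f 0) *
          (\<Sum>i=1..d. fps_nth f i * fps_nth (inverse f) (d - i))" for f :: "complex fps"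
        using False by (cases d) (simp_all add: fps_inverse_def)
      then show ?thesis using lim 0 less
        by (auto intro!: tendsto_intros)
    qed
  qed
  then show ?thesis by (simp add: fps_lim_def)
qed

lemma fps_lim_bpow:
  assumes "(f \<longlongrightarrow> l) \<F>"
  shows "fps_lim (\<lambda>x. bpow (f x)) (bpow l) \<F>"
  unfolding fps_lim_def bpow_def
  by (auto simp: gbinomial_prod_rev intro!: tendsto_intros assms)

lemma fps_lim_chs:
  assumes "\<And>i. fps_lim (\<lambda>x. T x i) (T' i) \<F>"
  shows "fps_lim (\<lambda>x. chs w (T x) k e) (chs w T' k e) \<F>"
  using assms
proof (induction w T' k e rule: chs.induct)
  case (2 w T' k e)
  show ?case
    by (subst (1 2) chs.simps(2)) (use 2 in \<open>auto intro!: fps_lim_add fps_lim_mult\<close>)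
qed simp

lemma fps_lim_elim_numer:
  assumes "\<And>i. fps_lim (\<lambda>x. T x i) (T' i) \<F>"
  shows "fps_lim (\<lambda>x. elim_numer w (T x) k n) (elim_numer w T' k n) \<F>"
  unfolding elim_numer_def elim_coeff_def
  by (intro fps_lim_sum fps_lim_mult fps_lim_prod fps_lim_power fps_lim_uminus fps_lim_chs assms)

section \<open>The sum over the poles for perturbed exponents\<close>

locale torus_weights =
  fixes a :: "int list" and n k :: nat
  assumes len: "length a = n" and k: "0 < k" "k < n"
    and neg: "i < k \<Longrightarrow> a ! i < 0" and pos: "k \<le> i \<Longrightarrow> i < n \<Longrightarrow> a ! i > 0"
begin

definition w :: "nat \<Rightarrow> nat" where "w i = nat \<bar>a ! i\<bar>"

lemma w_neg: "i < k \<Longrightarrow> a ! i = - int (w i)" and w_pos: "k \<le> i \<Longrightarrow> i < n \<Longrightarrow> a ! i = int (w i)"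
  using neg[of i] pos[of i] by (simp_all add: w_def)

lemma w_gt_0: "i < n \<Longrightarrow> 0 < w i"
  using neg[of i] pos[of i] by (cases "i < k") (simp_all add: w_def)

text \<open>Up to the factor \<open>u = \<zeta>^a\<^sub>j\<close>, the number \<open>lin c i j\<close> is the exponent of \<open>t\<close> in
  \<open>t^c\<^sub>j z^a\<^sub>j\<close> at the pole \<open>z = \<zeta> t^(-c\<^sub>i/a\<^sub>i)\<close>.\<close>

definition lin :: "(nat \<Rightarrow> complex) \<Rightarrow> nat \<Rightarrow> nat \<Rightarrow> complex" where
  "lin c i j = c j - of_int (a ! j) * c i / of_int (a ! i)"

text \<open>The generating function at \<open>T j = t^(c j)\<close>, multiplied by
  \<open>s^(n - 1)\<close>: one power of \<open>s\<close> clears the possible pole of each of the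
  \<open>n - 1\<close> factors. Coefficient 2 of \<open>Phi\<close> is therefore the perturbed
  counterpart of \<open>gamma_coeff 2\<close>.\<close>

definition Phi :: "(nat \<Rightarrow> complex) \<Rightarrow> complex fps" where
  "Phi c = (\<Sum>i<k. \<Sum>\<zeta> | \<zeta> ^ w i = 1. fps_const (1 / of_nat (w i)) *
     (\<Prod>j\<in>{..<n} - {i}. fac_inv (\<zeta> powi (a ! j)) (lin c i j)))"

text \<open>Precisely the condition that no factor \<open>1 - \<zeta>^(a j) t^(lin c i j)\<close> is
  the zero series for any of the roots of unity, among which \<open>\<zeta> = 1\<close> always
  occurs.\<close>

definition generic :: "(nat \<Rightarrow> complex) \<Rightarrow> bool" where
  "generic c \<longleftrightarrow> (\<forall>i<k. \<forall>j<n. j \<noteq> i \<longrightarrow> lin c i j \<noteq> 0)"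

text \<open>The roots of \<open>z^(w i) = t^(c i)\<close> are the power series
  \<open>th i \<zeta>\<close>; Laurent series in \<open>s\<close> enter only because the partial
  fractions need a field. For negative and positive \<open>a j\<close> the factors look different in
  terms of \<open>w j\<close>, but both become the same expression in \<open>lin c i j\<close>, by
  \<open>fneg\<close> and \<open>fpos\<close>.\<close>

lemma elim_numer_Phi:
  assumes "generic c"
  shows "elim_numer w (\<lambda>i. bpow (c i)) k n * fps_X ^ (n - 1) =
    gen_den w (\<lambda>i. bpow (c i)) k n * Phi c"
proof -
  define T where "T i = fps_to_fls (bpow (c i))" for i
  define th where "th i \<zeta> = fps_const \<zeta> * bpow (c i / of_nat (w i))" for i \<zeta>
  define \<Theta> where "\<Theta> i = (\<lambda>\<zeta>. fps_to_fls (th i \<zeta>)) ` {\<zeta>. \<zeta> ^ w i = 1}" for i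
  define fc where "fc i j \<zeta> = 1 - fps_const (\<zeta> powi (a ! j)) * bpow (lin c i j)" for i j \<zeta>
  have wk: "0 < w i" if "i < k" for i using w_gt_0[of i] that k by simp
  have lin0: "lin c i j \<noteq> 0" if "i < k" "j < n" "j \<noteq> i" for i j
    using assms that by (simp add: generic_def)
  have th_pow: "th i \<zeta> ^ m = fps_const (\<zeta> ^ m) * bpow (of_nat m * (c i / of_nat (w i)))" for i \<zeta> m
    by (simp add: th_def power_mult_distrib fps_const_power bpow_power)
  have inj: "inj (\<lambda>\<zeta>. fps_to_fls (th i \<zeta>))" for i
  proof (rule injI)
    fix x y assume "fps_to_fls (th i x) = fps_to_fls (th i y)"
    then have "fps_nth (th i x) 0 = fps_nth (th i y) 0" by simp
    then show "x = y" by (simp add: th_def)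
  qed
  have z0: "\<zeta> \<noteq> 0" if "\<zeta> ^ w i = 1" "i < k" for \<zeta> :: complex and i
    using that wk[of i] by (metis power_0_left zero_neq_one less_irrefl)
  have fneg: "T j / fps_to_fls (th i \<zeta>) ^ w j =
      fps_to_fls (fps_const (\<zeta> powi (a ! j)) * bpow (lin c i j))"
    if "i < k" "j < k" "\<zeta> ^ w i = 1" for i j \<zeta>
  proof -
    have "lin c i j + of_nat (w j) * (c i / of_nat (w i)) = c j"
      by (simp add: lin_def w_neg that)
    then have "bpow (c j) = bpow (lin c i j) * bpow (of_nat (w j) * (c i / of_nat (w i)))"
      by (simp add: bpow_add[symmetric])
    moreover have "fps_const (\<zeta> powi (a ! j)) * fps_const (\<zeta> ^ w j) = 1"
      using z0[OF that(3,1)] by (simp add: w_neg that power_int_minus)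
    ultimately have "bpow (c j) = fps_const (\<zeta> powi (a ! j)) * bpow (lin c i j) * th i \<zeta> ^ w j"
      unfolding th_pow by (simp add: mult_ac)
    then have "T j = fps_to_fls (fps_const (\<zeta> powi (a ! j)) * bpow (lin c i j)) * fps_to_fls (th i \<zeta>) ^ w j"
      by (simp add: T_def fls_times_fps_to_fls fps_to_fls_power)
    moreover have "fps_to_fls (th i \<zeta>) \<noteq> 0"
    proof
      assume "fps_to_fls (th i \<zeta>) = 0"
      then have "fps_nth (th i \<zeta>) 0 = 0" by simp
      then show False using z0[OF that(3,1)] by (simp add: th_def)
    qed
    ultimately show ?thesis by simp
  qed
  have fpos: "T j * fps_to_fls (th i \<zeta>) ^ w j =
      fps_to_fls (fps_const (\<zeta> powi (a ! j)) * bpow (lin c i j))"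
    if "i < k" "k \<le> j" "j < n" for i j \<zeta>
  proof -
    have "lin c i j = c j + of_nat (w j) * (c i / of_nat (w i))"
      by (simp add: lin_def w_neg w_pos that)
    then have "bpow (lin c i j) = bpow (c j) * bpow (of_nat (w j) * (c i / of_nat (w i)))"
      by (simp add: bpow_add)
    then have "bpow (c j) * th i \<zeta> ^ w j = fps_const (\<zeta> powi (a ! j)) * bpow (lin c i j)"
      unfolding th_pow by (simp add: w_pos that mult_ac)
    then show ?thesis
      by (simp add: T_def fls_times_fps_to_fls[symmetric] fps_to_fls_power[symmetric])
  qed
  have "elim_numer w T k n = gen_den w T k n *
    (\<Sum>i<k. \<Sum>\<theta>\<in>\<Theta> i. 1 / (of_nat (w i) * (\<Prod>i'\<in>{..<k} - {i}. 1 - T i' / \<theta> ^ w i') *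
       (\<Prod>j\<in>{k..<n}. 1 - T j * \<theta> ^ w j)))"
  proof (rule elim_numer_roots)
    fix i assume i: "i < k"
    show "card (\<Theta> i) = w i"
      unfolding \<Theta>_def using wk[OF i]
      by (subst card_image) (auto intro: inj_on_subset[OF inj] simp: card_roots_unity_eq)
    fix \<theta> assume "\<theta> \<in> \<Theta> i"
    then obtain \<zeta> where \<zeta>: "\<zeta> ^ w i = 1" and \<theta>: "\<theta> = fps_to_fls (th i \<zeta>)" by (auto simp: \<Theta>_def)
    show "\<theta> ^ w i = T i"
      unfolding \<theta> fps_to_fls_power[symmetric] th_pow T_def using \<zeta> wk[OF i] by simp
    show nz: "\<theta> \<noteq> 0"
    proof
      assume "\<theta> = 0"
      then have "fps_nth (th i \<zeta>) 0 = 0" by (simp add: \<theta>)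
      then show False using z0[OF \<zeta> i] by (simp add: th_def)
    qed
    show "\<theta> ^ w i' \<noteq> T i'" if "i' < k" "i' \<noteq> i" for i'
    proof
      assume "\<theta> ^ w i' = T i'"
      then have "T i' / \<theta> ^ w i' = 1" using nz by (metis divide_self power_not_zero)
      then have "fps_to_fls (fps_const (\<zeta> powi (a ! i')) * bpow (lin c i i')) = fps_to_fls 1"
        unfolding \<theta> fneg[OF i that(1) \<zeta>] by simp
      then show False using lin0[of i i'] that i k by (simp add: const_bpow_eq_1_iff)
    qed
    show "T j * \<theta> ^ w j \<noteq> 1" if "k \<le> j" "j < n" for j
    proof
      assume "T j * \<theta> ^ w j = 1"
      then have "fps_to_fls (fps_const (\<zeta> powi (a ! j)) * bpow (lin c i j)) = fps_to_fls 1"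
        unfolding \<theta> fpos[OF i that] by simp
      then show False using lin0[of i j] that i k by (simp add: const_bpow_eq_1_iff)
    qed
  qed (use k wk in auto)
  also have "(\<Sum>i<k. \<Sum>\<theta>\<in>\<Theta> i. 1 / (of_nat (w i) * (\<Prod>i'\<in>{..<k} - {i}. 1 - T i' / \<theta> ^ w i') *
       (\<Prod>j\<in>{k..<n}. 1 - T j * \<theta> ^ w j))) = fps_to_fls (Phi c) / fps_to_fls (fps_X ^ (n - 1))"
  proof -
    have "1 / (of_nat (w i) * (\<Prod>i'\<in>{..<k} - {i}. 1 - T i' / fps_to_fls (th i \<zeta>) ^ w i') *
       (\<Prod>j\<in>{k..<n}. 1 - T j * fps_to_fls (th i \<zeta>) ^ w j)) =
       fps_to_fls (fps_const (1 / of_nat (w i)) *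
         (\<Prod>j\<in>{..<n} - {i}. fac_inv (\<zeta> powi (a ! j)) (lin c i j))) / fps_to_fls (fps_X ^ (n - 1))"
      if i: "i < k" and \<zeta>: "\<zeta> ^ w i = 1" for i \<zeta>
    proof -
      have "(\<Prod>i'\<in>{..<k} - {i}. 1 - T i' / fps_to_fls (th i \<zeta>) ^ w i') =
          (\<Prod>j\<in>{..<k} - {i}. fps_to_fls (fc i j \<zeta>))"
        by (intro prod.cong refl) (simp add: fneg i \<zeta> fc_def)
      moreover have "(\<Prod>j\<in>{k..<n}. 1 - T j * fps_to_fls (th i \<zeta>) ^ w j) =
          (\<Prod>j\<in>{k..<n}. fps_to_fls (fc i j \<zeta>))"
        by (intro prod.cong refl) (simp add: fpos i fc_def)
      moreover have "(\<Prod>j\<in>{..<k} - {i}. fps_to_fls (fc i j \<zeta>)) * (\<Prod>j\<in>{k..<n}. fps_to_fls (fc i j \<zeta>)) =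
          (\<Prod>j\<in>{..<n} - {i}. fps_to_fls (fc i j \<zeta>))"
        using i k by (subst prod.union_disjoint[symmetric]) (auto intro!: prod.cong)
      moreover have "(\<Prod>j\<in>{..<n} - {i}. fps_to_fls (fc i j \<zeta>)) = fps_to_fls (\<Prod>j\<in>{..<n} - {i}. fc i j \<zeta>)"
        by (simp add: fps_to_fls_hom.hom_prod)
      ultimately have e: "of_nat (w i) * (\<Prod>i'\<in>{..<k} - {i}. 1 - T i' / fps_to_fls (th i \<zeta>) ^ w i') *
         (\<Prod>j\<in>{k..<n}. 1 - T j * fps_to_fls (th i \<zeta>) ^ w j) =
         of_nat (w i) * fps_to_fls (\<Prod>j\<in>{..<n} - {i}. fc i j \<zeta>)"
        by (simp add: mult.assoc)
      have "(\<Prod>j\<in>{..<n} - {i}. fc i j \<zeta>) * (\<Prod>j\<in>{..<n} - {i}. fac_inv (\<zeta> powi (a ! j)) (lin c i j)) =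
          (\<Prod>j\<in>{..<n} - {i}. fps_X)"
        unfolding prod.distrib[symmetric] fc_def
        by (intro prod.cong refl fac_inv lin0) (use i in auto)
      also have "\<dots> = fps_X ^ (n - 1)" using i k by simp
      finally have p: "fps_to_fls (\<Prod>j\<in>{..<n} - {i}. fc i j \<zeta>) *
          fps_to_fls (\<Prod>j\<in>{..<n} - {i}. fac_inv (\<zeta> powi (a ! j)) (lin c i j)) = fps_to_fls (fps_X ^ (n - 1))"
        by (simp only: fls_times_fps_to_fls[symmetric])
      have X0: "fps_to_fls (fps_X ^ (n - 1) :: complex fps) \<noteq> 0" by simp
      have c: "of_nat (w i) * fps_to_fls (fps_const (1 / of_nat (w i))) = (1 :: complex fls)"
      proof -
        have "of_nat (w i) * fps_to_fls (fps_const (1 / of_nat (w i))) =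
            fps_to_fls (of_nat (w i) * fps_const (1 / of_nat (w i)) :: complex fps)"
          by (simp add: fls_times_fps_to_fls)
        also have "of_nat (w i) * fps_const (1 / of_nat (w i)) = (1 :: complex fps)"
          using wk[OF i] by (simp add: fps_of_nat[symmetric])
        finally show ?thesis by simp
      qed
      have frac: "1 / (W * P) = C * G / X" if "W * C = 1" "P * G = X" "X \<noteq> 0"
        for W P C G X :: "complex fls"
      proof -
        have "(C * G) * (W * P) = (W * C) * (P * G)" by (simp only: mult_ac)
        then have "(C * G) * (W * P) = X" by (simp only: that mult_1_left)
        moreover have "W * P \<noteq> 0" using that by auto
        ultimately show ?thesis using that(3) by (simp add: frac_eq_eq)
      qed
      show ?thesis unfolding e fls_times_fps_to_fls using c p X0 by (rule frac)
    qed
    then show ?thesis unfolding \<Theta>_def Phi_def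
      by (simp add: sum.reindex inj_on_subset[OF inj] fps_to_fls_hom.hom_sum sum_divide_distrib)
  qed
  finally have "fps_to_fls (elim_numer w (\<lambda>i. bpow (c i)) k n * fps_X ^ (n - 1)) =
      fps_to_fls (gen_den w (\<lambda>i. bpow (c i)) k n * Phi c)"
    unfolding fls_times_fps_to_fls fps_to_fls_hom.hom_elim_numer fps_to_fls_hom.hom_prod
      fps_to_fls_hom.hom_elim_den T_def[symmetric]
    by simp
  then show ?thesis by simp
qed

text \<open>Single terms of \<open>Phi (c x)\<close> may diverge, but their sum is a numerator over
  a denominator, and both of these converge. The denominator tends to a series that still vanishes
  at \<open>s = 0\<close>, so a fixed power of \<open>s\<close> is divided out before passing to the
  limit.\<close>

lemma gamma_2_lim:
  assumes lim: "\<And>j. ((\<lambda>x. c x j) \<longlongrightarrow> 1) \<F>" and gen: "\<forall>\<^sub>F x in \<F>. generic (c x)"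
  shows "((\<lambda>x. fps_nth (Phi (c x)) 2) \<longlongrightarrow> gamma_coeff 2 a) \<F>"
proof -
  \<comment> \<open>The number of factors \<open>1 - t^e\<close> in the denominator. In the limit
    \<open>e\<close> is \<open>w i + w j\<close>, which is positive, so each factor vanishes to
    order exactly one at \<open>s = 0\<close>; the remaining \<open>U\<close> is invertible there
    and hence also near the limit.\<close>
  define r where "r = (n - k) * k"
  define N where "N c = elim_numer w (\<lambda>i. bpow (c i)) k n" for c
  define U where "U c = (\<Prod>j\<in>{k..<n}. \<Prod>i<k. fps_shift 1 (1 - bpow (c j) ^ w i * bpow (c i) ^ w j))" for c
  define one where "one = (\<lambda>_ :: nat. 1 :: complex)"
  have den: "gen_den w (\<lambda>i. bpow (c i)) k n = fps_X ^ r * U c" for c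
  proof -
    have shift: "f = fps_X * fps_shift 1 f" if "fps_nth f 0 = 0" for f :: "complex fps"
      using that by (intro fps_ext) (auto simp: fps_X_mult_nth)
    have "gen_den w (\<lambda>i. bpow (c i)) k n = (\<Prod>j\<in>{k..<n}. \<Prod>i<k. fps_X *
        fps_shift 1 (1 - bpow (c j) ^ w i * bpow (c i) ^ w j))"
      unfolding elim_den_def by (intro prod.cong refl shift) (simp add: bpow_power)
    then show ?thesis by (simp add: prod.distrib U_def r_def power_mult mult.commute flip: power_mult)
  qed
  have U0: "fps_nth (U one) 0 \<noteq> 0"
  proof -
    have prod_nth_0: "fps_nth (\<Prod>i\<in>A. f i) 0 = (\<Prod>i\<in>A. fps_nth (f i) 0)"
      for A :: "nat set" and f :: "nat \<Rightarrow> complex fps"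
      by (induction A rule: infinite_finite_induct) simp_all
    have "fps_nth (fps_shift 1 (1 - bpow 1 ^ w i * bpow 1 ^ w j)) 0 \<noteq> 0" if "i < k" for i j
      using w_gt_0[of i] that k
      by (simp add: bpow_power bpow_add[symmetric] bpow_nth_1 flip: of_nat_add)
    then show ?thesis
      unfolding U_def one_def prod_nth_0
      by (simp only: prod_zero_iff finite_lessThan finite_atLeastLessThan) blast
  qed
  have UL: "fps_lim (\<lambda>x. U (c x)) (U one) \<F>"
    unfolding U_def one_def by (intro fps_lim_prod fps_lim_mult fps_lim_power fps_lim_shift
      fps_lim_diff fps_lim_const fps_lim_bpow lim)
  have NU: "fps_lim (\<lambda>x. N (c x) * inverse (U (c x)) * fps_X ^ (n - 1))
      (N one * inverse (U one) * fps_X ^ (n - 1)) \<F>"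
    unfolding N_def
    by (intro fps_lim_mult fps_lim_elim_numer fps_lim_inverse UL U0 fps_lim_const fps_lim_bpow)
      (simp add: one_def lim)
  have ev: "\<forall>\<^sub>F x in \<F>. fps_nth (N (c x) * inverse (U (c x)) * fps_X ^ (n - 1)) (r + 2) =
      fps_nth (Phi (c x)) 2"
  proof -
    have "((\<lambda>x. fps_nth (U (c x)) 0) \<longlongrightarrow> fps_nth (U one) 0) \<F>"
      using UL by (simp add: fps_lim_def)
    then have "\<forall>\<^sub>F x in \<F>. fps_nth (U (c x)) 0 \<noteq> 0"
      using U0 by (rule tendsto_imp_eventually_ne)
    then show ?thesis using gen
    proof eventually_elim
      case (elim x)
      have "U (c x) * inverse (U (c x)) = 1" using elim by (intro inverse_mult_eq_1') simp
      then have "N (c x) * inverse (U (c x)) * fps_X ^ (n - 1) = fps_X ^ r * Phi (c x)"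
        using elim_numer_Phi[OF elim(2)] unfolding N_def[symmetric] den
        by (metis (no_types, lifting) mult.assoc mult.commute mult_1_right)
      then show ?case by (simp add: fps_X_power_mult_nth)
    qed
  qed
  define G where "G = N one * inverse (U one)"
  define L where "L = laurent_at_1 (Hilb a)"
  have U_inv: "U one * inverse (U one) = 1" using U0 by (intro inverse_mult_eq_1') simp
  then have U_nz: "fps_to_fls (U one) \<noteq> 0" by auto
  have "L = fps_to_fls (N one) / fps_to_fls (fps_X ^ r * U one)"
    unfolding den[symmetric] N_def one_def bpow_1 L_def
    by (rule laurent_at_1_Hilb) (use len k neg pos in \<open>auto simp: w_def\<close>)
  moreover have "N one = U one * G" using U_inv unfolding G_def by (metis mult.left_commute mult_1_right)
  ultimately have "L * fps_to_fls (fps_X ^ r) = fps_to_fls G"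
    using U_nz by (simp add: fls_times_fps_to_fls)
  then have "fps_to_fls G = fls_X ^ r * L" by (simp add: fps_to_fls_power mult.commute)
  then have "fls_nth (fps_to_fls G) (3 - int n + int r) = fls_nth L (3 - int n)"
    by (simp add: fls_X_power_times_conv_shift)
  then have "gamma_coeff 2 a = fls_nth (fps_to_fls G) (3 - int n + int r)"
    by (simp add: gamma_coeff_def len L_def)
  also have "\<dots> = fps_nth (G * fps_X ^ (n - 1)) (r + 2)"
  \<comment> \<open>In this case both sides are 0, the left one as a coefficient of a power series
    at a negative index. Otherwise the integer index is a natural number and the truncated
    subtraction is exact.\<close>
  proof (cases "r + 2 < n - 1")
    case False
    then have "\<not> 3 - int n + int r < 0" "nat (3 - int n + int r) = r + 2 - (n - 1)"
      using k by linarith+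
    then have "fls_nth (fps_to_fls G) (3 - int n + int r) = fps_nth G (r + 2 - (n - 1))"
      by (simp only: fps_to_fls_nth if_False)
    then show ?thesis using False by (simp add: fps_X_power_mult_right_nth)
  qed (simp add: fps_X_power_mult_right_nth)
  finally have "gamma_coeff 2 a = fps_nth (N one * inverse (U one) * fps_X ^ (n - 1)) (r + 2)"
    by (simp only: G_def)
  moreover have "((\<lambda>x. fps_nth (N (c x) * inverse (U (c x)) * fps_X ^ (n - 1)) (r + 2)) \<longlongrightarrow>
      fps_nth (N one * inverse (U one) * fps_X ^ (n - 1)) (r + 2)) \<F>"
    using NU by (simp add: fps_lim_def)
  ultimately show ?thesis using ev by (simp add: tendsto_cong)
qed

end

section \<open>Sums over roots of unity\<close>

text \<open>Bezout: the exponents that send \<open>\<zeta>\<close> to 1 form an ideal of the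
  integers. Simultaneous conditions on several weights thus become one condition on a gcd.\<close>

lemma powi_Gcd_eq_1_iff:
  fixes \<zeta> :: complex
  assumes "finite A" "\<zeta> \<noteq> 0"
  shows "\<zeta> powi Gcd A = 1 \<longleftrightarrow> (\<forall>x\<in>A. \<zeta> powi x = 1)"
  using assms(1)
proof (induction A rule: finite_induct)
  case (insert x A)
  have "\<zeta> powi gcd x y = 1 \<longleftrightarrow> \<zeta> powi x = 1 \<and> \<zeta> powi y = 1" for y
  proof safe
    assume *: "\<zeta> powi gcd x y = 1"
    obtain u v where "x = gcd x y * u" "y = gcd x y * v" by (meson dvdE gcd_dvd1 gcd_dvd2)
    then show "\<zeta> powi x = 1" "\<zeta> powi y = 1"
      using * by (metis power_int_1_left power_int_mult)+
  next
    assume *: "\<zeta> powi x = 1" "\<zeta> powi y = 1"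
    obtain u v where "u * x + v * y = gcd x y" using bezout_int by blast
    then have "\<zeta> powi gcd x y = \<zeta> powi (x * u) * \<zeta> powi (y * v)"
      using assms(2) by (metis mult.commute power_int_add)
    then show "\<zeta> powi gcd x y = 1" using * by (simp add: power_int_mult)
  qed
  then show ?case using insert by simp
qed simp

lemma finite_roots_powi: "0 < g \<Longrightarrow> finite {\<zeta> :: complex. \<zeta> powi g = 1}"
  using finite_roots_unity[of "nat g", where ?'a = complex] by (simp add: power_int_def Suc_le_eq)

lemma powi_coprime_eq_1:
  fixes \<zeta> :: complex
  assumes "gcd x y = 1" "\<zeta> \<noteq> 0" "\<zeta> powi x = 1" "\<zeta> powi y = 1"
  shows "\<zeta> = 1"
  using powi_Gcd_eq_1_iff[of "{x, y}" \<zeta>] assms by simp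

text \<open>As \<open>b\<close> is prime to \<open>g\<close>, raising to the power \<open>b\<close>
  permutes the nontrivial \<open>g\<close>-th roots of unity.\<close>

lemma sum_roots_powi_coprime:
  fixes f :: "complex \<Rightarrow> complex"
  assumes g: "0 < g" and c: "gcd b g = 1"
  shows "(\<Sum>\<zeta> | \<zeta> powi g = 1 \<and> \<zeta> \<noteq> 1. f (\<zeta> powi b)) = (\<Sum>\<zeta> | \<zeta> powi g = 1 \<and> \<zeta> \<noteq> 1. f \<zeta>)"
proof (rule sum.reindex_bij_betw)
  let ?S = "{\<zeta> :: complex. \<zeta> powi g = 1 \<and> \<zeta> \<noteq> 1}"
  have nz: "\<zeta> \<noteq> 0" if "\<zeta> powi g = 1" for \<zeta> :: complex
    using that g by (auto simp: power_int_0_left_if)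
  have inj: "inj_on (\<lambda>\<zeta>. \<zeta> powi b) ?S"
  proof (rule inj_onI)
    fix x y assume *: "x \<in> ?S" "y \<in> ?S" "x powi b = y powi b"
    have "x / y = 1"
      by (rule powi_coprime_eq_1[OF c]) (use * nz in \<open>auto simp: power_int_divide_distrib\<close>)
    then show "x = y" using nz[of y] * by simp
  qed
  moreover have "(\<lambda>\<zeta>. \<zeta> powi b) ` ?S \<subseteq> ?S"
  proof safe
    fix \<zeta> :: complex assume *: "\<zeta> powi g = 1" "\<zeta> \<noteq> 1"
    show "(\<zeta> powi b) powi g = 1"
      using * by (metis mult.commute power_int_1_left power_int_mult)
    assume "\<zeta> powi b = 1"
    then show False using powi_coprime_eq_1[OF c nz[OF *(1)] _ *(1)] * by simp
  qed
  moreover have "finite ?S" using finite_roots_powi[OF g] by (rule rev_finite_subset) auto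
  ultimately show "bij_betw (\<lambda>\<zeta>. \<zeta> powi b) ?S ?S"
    by (simp add: bij_betw_def endo_inj_surj)
qed

text \<open>Partial fractions of \<open>1 / (1 - z^g)\<close> express its coefficient of
  \<open>z^l\<close> as the average of the \<open>\<zeta>^l\<close>, and this coefficient is 0 for
  \<open>0 < l < g\<close>.\<close>

lemma sum_roots_power:
  assumes "0 < l" "l < g"
  shows "(\<Sum>\<zeta> | \<zeta> ^ g = 1. \<zeta> ^ l) = (0 :: complex)"
proof -
  have "chs (\<lambda>_. g) (\<lambda>_. 1 :: complex) 1 l = (\<Sum>i<(1::nat). \<Sum>\<zeta> | \<zeta> ^ g = 1.
      \<zeta> ^ l / (of_nat g * (\<Prod>i'\<in>{..<1} - {i}. 1 - 1 / \<zeta> ^ g)))"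
    by (rule chs_partial_fractions[where \<Theta> = "\<lambda>_. {\<zeta>. \<zeta> ^ g = 1}"])
      (use assms in \<open>auto simp: card_roots_unity_eq power_0_left\<close>)
  also have "\<dots> = (\<Sum>\<zeta> | \<zeta> ^ g = 1. \<zeta> ^ l / of_nat g)"
    by (simp add: lessThan_Suc)
  finally have "chs (\<lambda>_. g) (\<lambda>_. 1 :: complex) 1 l = (\<Sum>\<zeta> | \<zeta> ^ g = 1. \<zeta> ^ l / of_nat g)" .
  moreover have "chs (\<lambda>_. g) (\<lambda>_. 1 :: complex) 1 l = 0"
    using assms by (simp add: chs.simps(2)[of _ _ 0 l])
  ultimately have "(\<Sum>\<zeta> | \<zeta> ^ g = 1. \<zeta> ^ l) / of_nat g = (0 :: complex)"
    unfolding sum_divide_distrib by simp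
  then show ?thesis using assms by simp
qed

text \<open>This is \<open>\<Sum>\<zeta>. 1 / (1 - \<zeta> t) = g / (1 - t^g)\<close> multiplied by
  \<open>s = 1 - t\<close>. It is a generating function for the sums over roots of unity that have a
  closed form.\<close>

lemma sum_fac_inv_roots:
  assumes "0 < g"
  shows "(\<Sum>\<zeta> | \<zeta> ^ g = 1. fac_inv \<zeta> 1) = of_nat g * fac_inv 1 (of_nat g)"
proof -
  have "fac_inv \<zeta> 1 * (1 - bpow (of_nat g)) = fps_X * (\<Sum>l<g. fps_const (\<zeta> ^ l) * bpow (of_nat l))"
    if "\<zeta> ^ g = 1" for \<zeta>
  proof -
    have p: "(fps_const \<zeta> * bpow 1) ^ l = fps_const (\<zeta> ^ l) * bpow (of_nat l)" for l
      by (simp add: power_mult_distrib bpow_power fps_const_power)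
    have "1 - bpow (of_nat g) = (1 - fps_const \<zeta> * bpow 1) * (\<Sum>l<g. (fps_const \<zeta> * bpow 1) ^ l)"
      unfolding one_diff_power_eq[symmetric] using that by (simp add: p)
    then have "fac_inv \<zeta> 1 * (1 - bpow (of_nat g)) =
        ((1 - fps_const \<zeta> * bpow 1) * fac_inv \<zeta> 1) * (\<Sum>l<g. (fps_const \<zeta> * bpow 1) ^ l)"
      by (simp only: mult_ac)
    then show ?thesis using fac_inv[of 1 \<zeta>] unfolding p by simp
  qed
  then have "(\<Sum>\<zeta> | \<zeta> ^ g = 1. fac_inv \<zeta> 1) * (1 - bpow (of_nat g)) =
      (\<Sum>\<zeta> | \<zeta> ^ g = 1. fps_X * (\<Sum>l<g. fps_const (\<zeta> ^ l) * bpow (of_nat l)))"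
    by (simp add: sum_distrib_right)
  also have "\<dots> = fps_X * (\<Sum>l<g. fps_const (\<Sum>\<zeta> | \<zeta> ^ g = 1. \<zeta> ^ l) * bpow (of_nat l))"
  proof -
    have "(\<Sum>\<zeta>\<in>A. fps_const (f \<zeta>)) = fps_const (\<Sum>\<zeta>\<in>A. f \<zeta>)" for A and f :: "complex \<Rightarrow> complex"
      by (induction A rule: infinite_finite_induct) simp_all
    then show ?thesis
      unfolding sum_distrib_left[symmetric]
      by (subst sum.swap) (simp add: sum_distrib_right[symmetric])
  qed
  also have "(\<Sum>l<g. fps_const (\<Sum>\<zeta> | \<zeta> ^ g = 1. \<zeta> ^ l) * bpow (of_nat l)) =
      (\<Sum>l<g. if l = 0 then of_nat g else 0 :: complex fps)"
    using assms by (intro sum.cong refl) (auto simp: sum_roots_power card_roots_unity_eq fps_of_nat)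
  also have "\<dots> = of_nat g" using assms by simp
  finally have "(\<Sum>\<zeta> | \<zeta> ^ g = 1. fac_inv \<zeta> 1) * (1 - bpow (of_nat g)) = fps_X * of_nat g" .
  moreover have "of_nat g * fac_inv 1 (of_nat g) * (1 - bpow (of_nat g)) = fps_X * of_nat g"
    using fac_inv[of "of_nat g" 1] assms by (simp add: mult_ac)
  moreover have "1 - bpow (of_nat g) \<noteq> 0"
    using const_bpow_eq_1_iff[of 1 "of_nat g"] assms by simp
  ultimately show ?thesis by (metis mult_right_cancel)
qed

text \<open>Coefficients of \<open>s\<close> and \<open>s^2\<close> in
  \<open>sum_fac_inv_roots\<close>. The root \<open>\<zeta> = 1\<close> contributes 0 to both, since
  the exponent of its factor is 1.\<close>

lemma sum_roots_inverse:
  assumes "0 < g"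
  shows "(\<Sum>\<zeta> | \<zeta> ^ g = 1 \<and> \<zeta> \<noteq> 1. 1 / (1 - \<zeta>)) = (of_nat g - 1 :: complex) / 2" (is ?A)
    and "(\<Sum>\<zeta> | \<zeta> ^ g = 1 \<and> \<zeta> \<noteq> 1. - \<zeta> / (1 - \<zeta>)\<^sup>2) = (of_nat g ^ 2 - 1 :: complex) / 12" (is ?B)
proof -
  have fin: "finite {\<zeta> :: complex. \<zeta> ^ g = 1}" using assms by (intro finite_roots_unity) simp
  have split: "(\<Sum>\<zeta> | \<zeta> ^ g = 1. f \<zeta>) = f 1 + (\<Sum>\<zeta> | \<zeta> ^ g = 1 \<and> \<zeta> \<noteq> 1. f \<zeta>)" for f :: "complex \<Rightarrow> complex"
  proof -
    have "{\<zeta> :: complex. \<zeta> ^ g = 1} = insert 1 {\<zeta>. \<zeta> ^ g = 1 \<and> \<zeta> \<noteq> 1}" by auto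
    then show ?thesis using fin by simp
  qed
  have nth: "(\<Sum>\<zeta> | \<zeta> ^ g = 1. fps_nth (fac_inv \<zeta> 1) d) = of_nat g * fps_nth (fac_inv 1 (of_nat g)) d" for d
    using arg_cong[OF sum_fac_inv_roots[OF assms], of "\<lambda>f. fps_nth f d"]
    by (simp add: fps_sum_nth fps_of_nat[symmetric])
  have g0: "(of_nat g :: complex) \<noteq> 0" using assms by simp
  have "(\<Sum>\<zeta> | \<zeta> ^ g = 1 \<and> \<zeta> \<noteq> 1. fps_nth (fac_inv \<zeta> 1) (Suc 0)) =
      (\<Sum>\<zeta> | \<zeta> ^ g = 1 \<and> \<zeta> \<noteq> 1. 1 / (1 - \<zeta>))"
    by (intro sum.cong refl) (simp add: fac_inv_nth)
  then show ?A using nth[of "Suc 0"] g0 unfolding split by (simp add: fac_inv_nth)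
  have "(\<Sum>\<zeta> | \<zeta> ^ g = 1 \<and> \<zeta> \<noteq> 1. fps_nth (fac_inv \<zeta> 1) 2) =
      (\<Sum>\<zeta> | \<zeta> ^ g = 1 \<and> \<zeta> \<noteq> 1. - \<zeta> / (1 - \<zeta>)\<^sup>2)"
    by (intro sum.cong refl) (simp add: fac_inv_nth)
  then show ?B using nth[of 2] g0 unfolding split by (simp add: fac_inv_nth)
qed

section \<open>Second-order coefficients of the pole sums\<close>

lemma fps_prod_nth_0: "fps_nth (\<Prod>j\<in>J. F j) 0 = (\<Prod>j\<in>J. fps_nth (F j) 0)"
  for F :: "'i \<Rightarrow> 'a :: comm_ring_1 fps"
  by (induction J rule: infinite_finite_induct) simp_all

lemma fps_prod_nth_1:
  fixes F :: "'i \<Rightarrow> 'a :: comm_ring_1 fps"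
  assumes "finite J"
  shows "fps_nth (\<Prod>j\<in>J. F j) 1 = (\<Sum>j\<in>J. fps_nth (F j) 1 * (\<Prod>p\<in>J - {j}. fps_nth (F p) 0))"
  using assms
proof (induction J rule: finite_induct)
  case (insert x J)
  have "(\<Prod>p\<in>insert x J - {j}. fps_nth (F p) 0) = fps_nth (F x) 0 * (\<Prod>p\<in>J - {j}. fps_nth (F p) 0)"
    if "j \<in> J" for j
  proof -
    have "insert x J - {j} = insert x (J - {j})" using that insert.hyps by auto
    then show ?thesis using insert.hyps by simp
  qed
  then show ?case using insert
    by (simp add: fps_mult_nth fps_prod_nth_0 sum_distrib_left mult_ac)
qed simp

text \<open>Degree 2 arises from one factor in degree 2 or from two factors in degree 1. The double
  sum runs over ordered pairs, whence the half.\<close>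

lemma fps_prod_nth_2:
  fixes F :: "'i \<Rightarrow> 'a :: field_char_0 fps"
  assumes "finite J"
  shows "fps_nth (\<Prod>j\<in>J. F j) 2 = (\<Sum>j\<in>J. fps_nth (F j) 2 * (\<Prod>p\<in>J - {j}. fps_nth (F p) 0)) +
      (\<Sum>j\<in>J. \<Sum>l\<in>J - {j}. fps_nth (F j) 1 * fps_nth (F l) 1 *
        (\<Prod>p\<in>J - {j, l}. fps_nth (F p) 0)) / 2"
  using assms
proof (induction J rule: finite_induct)
  case (insert x J)
  define f where "f d j = fps_nth (F j) d" for d j
  have a: "(\<Prod>p\<in>insert x J - {j}. f 0 p) = f 0 x * (\<Prod>p\<in>J - {j}. f 0 p)" if "j \<in> J" for j
  proof -
    have "insert x J - {j} = insert x (J - {j})" using that insert.hyps by auto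
    then show ?thesis using insert.hyps by simp
  qed
  have b: "(\<Sum>l\<in>insert x J - {j}. f 1 j * f 1 l * (\<Prod>p\<in>insert x J - {j, l}. f 0 p)) =
      f 1 j * f 1 x * (\<Prod>p\<in>J - {j}. f 0 p) +
      f 0 x * (\<Sum>l\<in>J - {j}. f 1 j * f 1 l * (\<Prod>p\<in>J - {j, l}. f 0 p))"
    if j: "j \<in> J" for j
  proof -
    have "insert x J - {j} = insert x (J - {j})" using j insert.hyps by auto
    moreover have "insert x J - {j, x} = J - {j}" using insert.hyps by auto
    moreover have "(\<Prod>p\<in>insert x J - {j, l}. f 0 p) = f 0 x * (\<Prod>p\<in>J - {j, l}. f 0 p)"
      if "l \<in> J - {j}" for l
    proof -
      have "insert x J - {j, l} = insert x (J - {j, l})" using j that insert.hyps by auto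
      then show ?thesis using insert.hyps by simp
    qed
    ultimately show ?thesis using insert.hyps by (simp add: sum_distrib_left mult_ac)
  qed
  have c: "(\<Sum>l\<in>insert x J - {x}. f 1 x * f 1 l * (\<Prod>p\<in>insert x J - {x, l}. f 0 p)) =
      (\<Sum>l\<in>J. f 1 x * f 1 l * (\<Prod>p\<in>J - {l}. f 0 p))"
  proof -
    have "insert x J - {x} = J" using insert.hyps by auto
    moreover have "insert x J - {x, l} = J - {l}" for l using insert.hyps by auto
    ultimately show ?thesis by simp
  qed
  define B where "B = (\<Sum>l\<in>J. f 1 l * (\<Prod>p\<in>J - {l}. f 0 p))"
  define C where "C = (\<Sum>j\<in>J. \<Sum>l\<in>J - {j}. f 1 j * f 1 l * (\<Prod>p\<in>J - {j, l}. f 0 p))"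
  define A where "A = (\<Sum>j\<in>J. f 2 j * (\<Prod>p\<in>J - {j}. f 0 p))"
  have "(\<Sum>j\<in>insert x J. \<Sum>l\<in>insert x J - {j}. f 1 j * f 1 l * (\<Prod>p\<in>insert x J - {j, l}. f 0 p)) =
      (\<Sum>l\<in>J. f 1 x * f 1 l * (\<Prod>p\<in>J - {l}. f 0 p)) +
      (\<Sum>j\<in>J. f 1 j * f 1 x * (\<Prod>p\<in>J - {j}. f 0 p) +
        f 0 x * (\<Sum>l\<in>J - {j}. f 1 j * f 1 l * (\<Prod>p\<in>J - {j, l}. f 0 p)))"
    unfolding sum.insert[OF insert.hyps] c by (intro arg_cong2[where f = "(+)"] sum.cong refl b)
  also have "\<dots> = 2 * (f 1 x * B) + f 0 x * C"
    unfolding B_def C_def by (simp add: sum.distrib sum_distrib_left mult_ac)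
  finally have D: "(\<Sum>j\<in>insert x J. \<Sum>l\<in>insert x J - {j}. f 1 j * f 1 l * (\<Prod>p\<in>insert x J - {j, l}. f 0 p)) =
      2 * (f 1 x * B) + f 0 x * C" .
  have "(\<Sum>j\<in>insert x J. f 2 j * (\<Prod>p\<in>insert x J - {j}. f 0 p)) =
      f 2 x * (\<Prod>p\<in>J. f 0 p) + (\<Sum>j\<in>J. f 2 j * (f 0 x * (\<Prod>p\<in>J - {j}. f 0 p)))"
    unfolding sum.insert[OF insert.hyps]
    by (intro arg_cong2[where f = "(+)"] sum.cong) (use insert.hyps a in auto)
  also have "\<dots> = f 2 x * (\<Prod>p\<in>J. f 0 p) + f 0 x * A"
    by (simp add: A_def sum_distrib_left mult_ac)
  finally have E: "(\<Sum>j\<in>insert x J. f 2 j * (\<Prod>p\<in>insert x J - {j}. f 0 p)) =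
      f 2 x * (\<Prod>p\<in>J. f 0 p) + f 0 x * A" .
  have "fps_nth (\<Prod>j\<in>insert x J. F j) 2 =
      f 0 x * fps_nth (\<Prod>j\<in>J. F j) 2 + f 1 x * fps_nth (\<Prod>j\<in>J. F j) 1 + f 2 x * fps_nth (\<Prod>j\<in>J. F j) 0"
    using insert.hyps by (simp add: f_def fps_mult_nth numeral_2_eq_2)
  also have "\<dots> = f 0 x * (A + C / 2) + f 1 x * B + f 2 x * (\<Prod>p\<in>J. f 0 p)"
    using insert.IH fps_prod_nth_1[OF insert.hyps(1), of F]
    by (simp add: fps_prod_nth_0 A_def B_def C_def f_def)
  also have "\<dots> = f 2 x * (\<Prod>p\<in>J. f 0 p) + f 0 x * A + (2 * (f 1 x * B) + f 0 x * C) / 2"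
    by (simp add: field_simps)
  finally show ?case using D E by (simp add: f_def)
qed simp

lemma powi_eq_1_nat: "0 \<le> g \<Longrightarrow> \<zeta> powi g = 1 \<longleftrightarrow> \<zeta> ^ nat g = (1 :: complex)"
  by (simp add: power_int_def)

lemma sum_roots_powi_inverse:
  assumes g: "0 < g" and b: "gcd b g = 1"
  shows "(\<Sum>\<zeta> | \<zeta> powi g = 1 \<and> \<zeta> \<noteq> 1. 1 / (1 - \<zeta> powi b)) = (of_int g - 1 :: complex) / 2"
    and "(\<Sum>\<zeta> | \<zeta> powi g = 1 \<and> \<zeta> \<noteq> 1. - (\<zeta> powi b) / (1 - \<zeta> powi b)\<^sup>2) =
      (of_int g ^ 2 - 1 :: complex) / 12"
proof -
  have e: "(of_nat (nat g) :: complex) = of_int g" using g by simp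
  show "(\<Sum>\<zeta> | \<zeta> powi g = 1 \<and> \<zeta> \<noteq> 1. 1 / (1 - \<zeta> powi b)) = (of_int g - 1 :: complex) / 2"
    unfolding sum_roots_powi_coprime[OF g b, of "\<lambda>\<zeta>. 1 / (1 - \<zeta>)"]
    using sum_roots_inverse(1)[of "nat g"] g by (simp add: powi_eq_1_nat e)
  show "(\<Sum>\<zeta> | \<zeta> powi g = 1 \<and> \<zeta> \<noteq> 1. - (\<zeta> powi b) / (1 - \<zeta> powi b)\<^sup>2) =
      (of_int g ^ 2 - 1 :: complex) / 12"
    unfolding sum_roots_powi_coprime[OF g b, of "\<lambda>\<zeta>. - \<zeta> / (1 - \<zeta>)\<^sup>2"]
    using sum_roots_inverse(2)[of "nat g"] g by (simp add: powi_eq_1_nat e)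
qed

lemma root_powi_nonzero: "0 < g \<Longrightarrow> \<zeta> powi g = 1 \<Longrightarrow> \<zeta> \<noteq> (0 :: complex)"
  by (auto simp: power_int_0_left_if)

text \<open>Coprimality of \<open>b\<close> and \<open>g\<close> keeps \<open>\<zeta>^b\<close> away
  from 1 except at \<open>\<zeta> = 1\<close>. That root gives the first summand, all others
  together the second.\<close>

lemma sum_fac_inv_nth_2:
  assumes g: "0 < g" and b: "gcd b g = 1" and L: "L \<noteq> 0"
  shows "(\<Sum>\<zeta> | \<zeta> powi g = 1. fps_nth (fac_inv (\<zeta> powi b) L) 2) =
    (L\<^sup>2 - 1) / (12 * L) + L * (of_int g ^ 2 - 1) / 12"
proof -
  have "{\<zeta> :: complex. \<zeta> powi g = 1} = insert 1 {\<zeta>. \<zeta> powi g = 1 \<and> \<zeta> \<noteq> 1}" by auto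
  moreover have "finite {\<zeta> :: complex. \<zeta> powi g = 1 \<and> \<zeta> \<noteq> 1}"
    using finite_roots_powi[OF g] by (rule rev_finite_subset) auto
  ultimately have "(\<Sum>\<zeta> | \<zeta> powi g = 1. fps_nth (fac_inv (\<zeta> powi b) L) 2) =
      fps_nth (fac_inv 1 L) 2 + (\<Sum>\<zeta> | \<zeta> powi g = 1 \<and> \<zeta> \<noteq> 1. fps_nth (fac_inv (\<zeta> powi b) L) 2)"
    by simp
  also have "(\<Sum>\<zeta> | \<zeta> powi g = 1 \<and> \<zeta> \<noteq> 1. fps_nth (fac_inv (\<zeta> powi b) L) 2) =
      (\<Sum>\<zeta> | \<zeta> powi g = 1 \<and> \<zeta> \<noteq> 1. L * (- (\<zeta> powi b) / (1 - \<zeta> powi b)\<^sup>2))"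
  proof (intro sum.cong refl)
    fix \<zeta> :: complex assume "\<zeta> \<in> {\<zeta>. \<zeta> powi g = 1 \<and> \<zeta> \<noteq> 1}"
    then have "\<zeta> powi b \<noteq> 1" using powi_coprime_eq_1[OF b root_powi_nonzero[OF g]] by auto
    then show "fps_nth (fac_inv (\<zeta> powi b) L) 2 = L * (- (\<zeta> powi b) / (1 - \<zeta> powi b)\<^sup>2)"
      using L by (simp add: fac_inv_nth)
  qed
  also have "\<dots> = L * ((of_int g ^ 2 - 1) / 12)"
    unfolding sum_distrib_left[symmetric] sum_roots_powi_inverse(2)[OF g b] ..
  finally show ?thesis using L by (simp add: fac_inv_nth)
qed

text \<open>The \<open>h\<close>-th roots of unity are sorted by which of the two factors has a pole
  at \<open>s = 0\<close>: both at \<open>\<zeta> = 1\<close>, only the first on \<open>S'\<close>,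
  only the second on \<open>S\<close>, neither on \<open>Z\<close>. Coprimality makes 1 the only
  root where both do. On \<open>S'\<close> and \<open>S\<close> the factor without pole is summed in
  closed form; the sum over \<open>Z\<close> is kept and becomes \<open>zeta_sum\<close>.\<close>

lemma sum_fac_inv_nth_1_1:
  fixes h b b' :: int
  assumes h: "0 < h" and c: "gcd (gcd h b) b' = 1" and L: "L \<noteq> 0" "L' \<noteq> 0"
    and g': "g' = gcd h b" and g: "g = gcd h b'"
  shows "(\<Sum>\<zeta> | \<zeta> powi h = 1. fps_nth (fac_inv (\<zeta> powi b) L) 1 * fps_nth (fac_inv (\<zeta> powi b') L') 1) =
    (L - 1) * (L' - 1) / (4 * L * L') + (L - 1) / (2 * L) * ((of_int g' - 1) / 2) +
    (L' - 1) / (2 * L') * ((of_int g - 1) / 2) +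
    (\<Sum>\<zeta> | \<zeta> powi h = 1 \<and> \<zeta> powi g \<noteq> 1 \<and> \<zeta> powi g' \<noteq> 1.
       1 / ((1 - \<zeta> powi b) * (1 - \<zeta> powi b')))"
proof -
  define f where "f \<zeta> = fps_nth (fac_inv (\<zeta> powi b) L) 1 * fps_nth (fac_inv (\<zeta> powi b') L') 1" for \<zeta>
  define S' where "S' = {\<zeta> :: complex. \<zeta> powi g' = 1 \<and> \<zeta> \<noteq> 1}"
  define S where "S = {\<zeta> :: complex. \<zeta> powi g = 1 \<and> \<zeta> \<noteq> 1}"
  define Z where "Z = {\<zeta> :: complex. \<zeta> powi h = 1 \<and> \<zeta> powi g \<noteq> 1 \<and> \<zeta> powi g' \<noteq> 1}"
  have pos: "0 < g" "0 < g'" using h unfolding g g' by (auto simp: gcd_pos_int)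
  have c': "gcd g b = 1" "gcd g' b' = 1" "gcd g' g = 1" "gcd b' g' = 1" "gcd b g = 1"
    using c unfolding g g' by (simp_all add: gcd.commute gcd.left_commute gcd.assoc)
  have iff': "\<zeta> powi g' = 1 \<longleftrightarrow> \<zeta> powi h = 1 \<and> \<zeta> powi b = 1" if "\<zeta> \<noteq> 0" for \<zeta> :: complex
    using powi_Gcd_eq_1_iff[of "{h, b}" \<zeta>] that by (simp add: g')
  have iff: "\<zeta> powi g = 1 \<longleftrightarrow> \<zeta> powi h = 1 \<and> \<zeta> powi b' = 1" if "\<zeta> \<noteq> 0" for \<zeta> :: complex
    using powi_Gcd_eq_1_iff[of "{h, b'}" \<zeta>] that by (simp add: g)
  have nz: "\<zeta> powi h = 1 \<Longrightarrow> \<zeta> \<noteq> 0" "\<zeta> powi g = 1 \<Longrightarrow> \<zeta> \<noteq> 0" "\<zeta> powi g' = 1 \<Longrightarrow> \<zeta> \<noteq> 0"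
    for \<zeta> :: complex using root_powi_nonzero h pos by blast+
  have one: "\<zeta> = 1" if "\<zeta> powi g = 1" "\<zeta> powi g' = 1" for \<zeta> :: complex
    using powi_coprime_eq_1[OF c'(3) nz(2)] that by blast
  have S'S: "\<zeta> powi b = 1 \<and> \<zeta> powi b' \<noteq> 1 \<and> \<zeta> powi h = 1" if "\<zeta> \<in> S'" for \<zeta>
  proof -
    have *: "\<zeta> powi g' = 1" "\<zeta> \<noteq> 1" using that by (simp_all add: S'_def)
    then show ?thesis using iff'[OF nz(3)] iff[OF nz(3)] one by blast
  qed
  have SS: "\<zeta> powi b' = 1 \<and> \<zeta> powi b \<noteq> 1 \<and> \<zeta> powi h = 1" if "\<zeta> \<in> S" for \<zeta>
  proof -
    have *: "\<zeta> powi g = 1" "\<zeta> \<noteq> 1" using that by (simp_all add: S_def)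
    then show ?thesis using iff'[OF nz(2)] iff[OF nz(2)] one by blast
  qed
  have ZZ: "\<zeta> powi b' \<noteq> 1 \<and> \<zeta> powi b \<noteq> 1" if "\<zeta> \<in> Z" for \<zeta>
  proof -
    have *: "\<zeta> powi h = 1" "\<zeta> powi g \<noteq> 1" "\<zeta> powi g' \<noteq> 1" using that by (simp_all add: Z_def)
    then show ?thesis using iff'[OF nz(1)] iff[OF nz(1)] by blast
  qed
  have part: "{\<zeta>. \<zeta> powi h = 1} = insert 1 (S' \<union> (S \<union> Z))"
  proof (intro subset_antisym subsetI)
    fix \<zeta> :: complex assume "\<zeta> \<in> {\<zeta>. \<zeta> powi h = 1}"
    then show "\<zeta> \<in> insert 1 (S' \<union> (S \<union> Z))" by (simp add: Z_def S_def S'_def) blast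
  next
    fix \<zeta> :: complex assume "\<zeta> \<in> insert 1 (S' \<union> (S \<union> Z))"
    then consider "\<zeta> = 1" | "\<zeta> \<in> S'" | "\<zeta> \<in> S" | "\<zeta> \<in> Z" by blast
    then show "\<zeta> \<in> {\<zeta>. \<zeta> powi h = 1}"
      using S'S[of \<zeta>] SS[of \<zeta>] by cases (simp_all add: Z_def)
  qed
  have "finite {\<zeta> :: complex. \<zeta> powi h = 1}" using h by (rule finite_roots_powi)
  then have fin: "finite S'" "finite S" "finite Z" unfolding part by auto
  have disj: "S' \<inter> (S \<union> Z) = {}" "S \<inter> Z = {}"
    unfolding Z_def S_def S'_def using one by blast+
  have "1 \<notin> S' \<union> (S \<union> Z)" by (simp add: Z_def S_def S'_def)
  have "(\<Sum>\<zeta> | \<zeta> powi h = 1. f \<zeta>) = f 1 + (sum f S' + (sum f S + sum f Z))"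
    unfolding part using fin disj \<open>1 \<notin> S' \<union> (S \<union> Z)\<close> by (simp add: sum.union_disjoint)
  moreover have "f 1 = (L - 1) * (L' - 1) / (4 * L * L')"
    using L by (simp add: f_def fac_inv_nth)
  moreover have "sum f S' = (L - 1) / (2 * L) * ((of_int g' - 1) / 2)"
  proof -
    have "sum f S' = (\<Sum>\<zeta>\<in>S'. (L - 1) / (2 * L) * (1 / (1 - \<zeta> powi b')))"
      using L S'S by (intro sum.cong refl) (simp add: f_def fac_inv_nth)
    then show ?thesis
      unfolding S'_def sum_distrib_left[symmetric] sum_roots_powi_inverse(1)[OF pos(2) c'(4)] .
  qed
  moreover have "sum f S = (L' - 1) / (2 * L') * ((of_int g - 1) / 2)"
  proof -
    have "sum f S = (\<Sum>\<zeta>\<in>S. (L' - 1) / (2 * L') * (1 / (1 - \<zeta> powi b)))"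
      using L SS by (intro sum.cong refl) (simp add: f_def fac_inv_nth)
    then show ?thesis
      unfolding S_def sum_distrib_left[symmetric] sum_roots_powi_inverse(1)[OF pos(1) c'(5)] .
  qed
  moreover have "sum f Z = (\<Sum>\<zeta>\<in>Z. 1 / ((1 - \<zeta> powi b) * (1 - \<zeta> powi b')))"
    using L ZZ by (intro sum.cong refl) (simp add: f_def fac_inv_nth)
  ultimately show ?thesis by (simp add: f_def Z_def)
qed

context torus_weights
begin

text \<open>The coefficient of \<open>s^2\<close> in the sum over \<open>\<zeta>\<close> at a fixed
  pole index \<open>i\<close>, without the weight \<open>1 / w i\<close>. In the first sum one
  factor contributes degree 2 and the rest are constant terms, which leaves the
  \<open>g1 a j\<close>-th roots of unity; in the second sum two factors contribute degree 1, which
  leaves the \<open>g2 a j l\<close>-th roots.\<close>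

definition G2 :: "(nat \<Rightarrow> complex) \<Rightarrow> nat \<Rightarrow> complex" where
  "G2 c i = (\<Sum>j\<in>{..<n} - {i}. 1 / (\<Prod>p\<in>{..<n} - {i, j}. lin c i p) *
      (((lin c i j)\<^sup>2 - 1) / (12 * lin c i j) + lin c i j * (of_int (g1 a j) ^ 2 - 1) / 12)) +
    (\<Sum>j\<in>{..<n} - {i}. \<Sum>l\<in>{..<n} - {i, j}. 1 / (\<Prod>p\<in>{..<n} - {i, j, l}. lin c i p) *
      ((lin c i j - 1) * (lin c i l - 1) / (4 * lin c i j * lin c i l) +
       (lin c i j - 1) / (2 * lin c i j) * ((of_int (g1 a l) - 1) / 2) +
       (lin c i l - 1) / (2 * lin c i l) * ((of_int (g1 a j) - 1) / 2) + zeta_sum a j l)) / 2"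

lemma a_nonzero: "i < n \<Longrightarrow> a ! i \<noteq> 0"
  using neg[of i] pos[of i] by (cases "i < k") auto

lemma common_roots_eq:
  assumes i: "i < k" and X: "finite X"
  shows "{\<zeta> :: complex. \<zeta> ^ w i = 1 \<and> (\<forall>p\<in>X. \<zeta> powi (a ! p) = 1)} =
    {\<zeta>. \<zeta> powi Gcd ((!) a ` insert i X) = 1}"
proof (intro Collect_cong)
  fix \<zeta> :: complex
  have g0: "Gcd ((!) a ` insert i X) > 0"
    using a_nonzero[of i] i k by (simp add: less_le gcd_eq_0_iff)
  have wi: "w i > 0" using w_gt_0[of i] i k by simp
  show "(\<zeta> ^ w i = 1 \<and> (\<forall>p\<in>X. \<zeta> powi (a ! p) = 1)) \<longleftrightarrow> \<zeta> powi Gcd ((!) a ` insert i X) = 1"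
  proof (cases "\<zeta> = 0")
    case False
    have "\<zeta> ^ w i = 1 \<longleftrightarrow> \<zeta> powi (a ! i) = 1"
      by (simp add: w_neg i power_int_minus)
    then show ?thesis using powi_Gcd_eq_1_iff[of "(!) a ` insert i X" \<zeta>] X False by simp
  qed (use g0 wi in \<open>simp add: power_int_0_left_if power_0_left\<close>)
qed

lemma g1_eq: "g1 a j = Gcd ((!) a ` ({..<n} - {j}))"
  unfolding g1_def len by (rule arg_cong[where f = Gcd]) auto

lemma g2_eq: "g2 a j l = Gcd ((!) a ` ({..<n} - {j, l}))"
  unfolding g2_def len by (rule arg_cong[where f = Gcd]) auto

lemma set_a_eq: "set a = (!) a ` {..<n}"
  by (auto simp: set_conv_nth len)

lemma gcd_g1: "Gcd (set a) = 1 \<Longrightarrow> j < n \<Longrightarrow> gcd (a ! j) (g1 a j) = 1"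
proof -
  assume *: "Gcd (set a) = 1" "j < n"
  then have "{..<n} = insert j ({..<n} - {j})" by auto
  then show ?thesis using * unfolding set_a_eq g1_eq by (metis Gcd_insert image_insert)
qed

lemma g1_g2: "j < n \<Longrightarrow> l < n \<Longrightarrow> j \<noteq> l \<Longrightarrow> g1 a j = gcd (g2 a j l) (a ! l)"
proof -
  assume "j < n" "l < n" "j \<noteq> l"
  then have "{..<n} - {j} = insert l ({..<n} - {j, l})" by auto
  then show ?thesis unfolding g1_eq g2_eq by (metis Gcd_insert image_insert gcd.commute)
qed

lemma prod_fac_inv_nth_0:
  assumes "finite X" "\<And>p. p \<in> X \<Longrightarrow> L p \<noteq> 0"
  shows "(\<Prod>p\<in>X. fps_nth (fac_inv (u p) (L p)) 0) =
    (if \<forall>p\<in>X. u p = 1 then 1 / (\<Prod>p\<in>X. L p) else 0)"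
  using assms by (auto simp: fac_inv_nth prod_dividef cong: prod.cong)

lemma Phi_2:
  assumes gen: "generic c" and gcd: "Gcd (set a) = 1"
  shows "fps_nth (Phi c) 2 = (\<Sum>i<k. 1 / of_nat (w i) * G2 c i)"
proof -
  have "(\<Sum>\<zeta> | \<zeta> ^ w i = 1. fps_nth (\<Prod>j\<in>{..<n} - {i}. fac_inv (\<zeta> powi (a ! j)) (lin c i j)) 2) = G2 c i"
    if i: "i < k" for i
  proof -
    define J where "J = {..<n} - {i}"
    define L where "L = lin c i"
    define F where "F \<zeta> j d = fps_nth (fac_inv (\<zeta> powi (a ! j)) (L j)) d" for \<zeta> j d
    have L0: "L j \<noteq> 0" if "j \<in> J" for j using gen i that by (simp add: generic_def L_def J_def)
    have fin: "finite {\<zeta> :: complex. \<zeta> ^ w i = 1}"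
      using w_gt_0[of i] i k by (intro finite_roots_unity) auto
    \<comment> \<open>The constant term of a factor vanishes unless
      \<open>\<zeta>^(a p) = 1\<close>. A product of constant terms over \<open>X\<close> therefore
      cuts the sum down to the roots killed by \<open>a i\<close> and all \<open>a p\<close> with
      \<open>p\<close> in \<open>X\<close>, that is, by their gcd.\<close>
    have restrict: "(\<Sum>\<zeta> | \<zeta> ^ w i = 1. f \<zeta> * (\<Prod>p\<in>X. F \<zeta> p 0)) =
        1 / (\<Prod>p\<in>X. L p) * (\<Sum>\<zeta> | \<zeta> powi Gcd ((!) a ` insert i X) = 1. f \<zeta>)"
      if X: "X \<subseteq> J" for X and f :: "complex \<Rightarrow> complex"
    proof -
      have fX: "finite X" using X by (rule finite_subset) (simp add: J_def)
      have "(\<Sum>\<zeta> | \<zeta> ^ w i = 1. f \<zeta> * (\<Prod>p\<in>X. F \<zeta> p 0)) =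
          (\<Sum>\<zeta> | \<zeta> ^ w i = 1. if \<forall>p\<in>X. \<zeta> powi (a ! p) = 1 then 1 / (\<Prod>p\<in>X. L p) * f \<zeta> else 0)"
        unfolding F_def by (intro sum.cong refl, subst prod_fac_inv_nth_0) (use fX L0 X in auto)
      also have "\<dots> = (\<Sum>\<zeta> | \<zeta> ^ w i = 1 \<and> (\<forall>p\<in>X. \<zeta> powi (a ! p) = 1). 1 / (\<Prod>p\<in>X. L p) * f \<zeta>)"
        using fin by (subst sum.inter_filter[symmetric]) simp_all
      finally show ?thesis unfolding common_roots_eq[OF i fX] sum_distrib_left .
    qed
    have ins1: "insert i (J - {j}) = {..<n} - {j}" if "j \<in> J" for j
      using that i k by (auto simp: J_def)
    have ins2: "insert i (J - {j, l}) = {..<n} - {j, l}" if "j \<in> J" "l \<in> J" for j l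
      using that i k by (auto simp: J_def)
    have g1_pos: "0 < g1 a j" if "j \<in> J" for j
    proof -
      have "a ! i \<in> (!) a ` ({..<n} - {j})" using that i k by (auto simp: J_def)
      then have "g1 a j \<noteq> 0" unfolding g1_eq using a_nonzero[of i] i k by (auto simp: Gcd_0_iff)
      then show ?thesis unfolding g1_eq using Gcd_int_greater_eq_0 by (metis less_le)
    qed
    have g2_pos: "0 < g2 a j l" if "j \<in> J" "l \<in> J" for j l
    proof -
      have "a ! i \<in> (!) a ` ({..<n} - {j, l})" using that i k by (auto simp: J_def)
      then have "g2 a j l \<noteq> 0" unfolding g2_eq using a_nonzero[of i] i k by (auto simp: Gcd_0_iff)
      then show ?thesis unfolding g2_eq using Gcd_int_greater_eq_0 by (metis less_le)
    qed
    have one: "(\<Sum>\<zeta> | \<zeta> ^ w i = 1. F \<zeta> j 2 * (\<Prod>p\<in>J - {j}. F \<zeta> p 0)) =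
        1 / (\<Prod>p\<in>J - {j}. L p) *
        (((L j)\<^sup>2 - 1) / (12 * L j) + L j * (of_int (g1 a j) ^ 2 - 1) / 12)" if j: "j \<in> J" for j
    proof -
      have "(\<Sum>\<zeta> | \<zeta> powi g1 a j = 1. F \<zeta> j 2) =
          (((L j)\<^sup>2 - 1) / (12 * L j) + L j * (of_int (g1 a j) ^ 2 - 1) / 12)"
        unfolding F_def
        by (rule sum_fac_inv_nth_2) (use g1_pos gcd_g1[OF gcd] L0 j in \<open>auto simp: J_def\<close>)
      moreover have "J - {j} \<subseteq> J" by blast
      ultimately show ?thesis using restrict[of "J - {j}" "\<lambda>\<zeta>. F \<zeta> j 2"]
        by (simp only: ins1[OF j] g1_eq)
    qed
    have two: "(\<Sum>\<zeta> | \<zeta> ^ w i = 1. F \<zeta> j 1 * F \<zeta> l 1 * (\<Prod>p\<in>J - {j, l}. F \<zeta> p 0)) =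
        1 / (\<Prod>p\<in>J - {j, l}. L p) *
        ((L j - 1) * (L l - 1) / (4 * L j * L l) + (L j - 1) / (2 * L j) * ((of_int (g1 a l) - 1) / 2) +
          (L l - 1) / (2 * L l) * ((of_int (g1 a j) - 1) / 2) + zeta_sum a j l)"
      if j: "j \<in> J" and l: "l \<in> J - {j}" for j l
    proof -
      have jl: "j < n" "l < n" "j \<noteq> l" "l \<in> J" using j l by (auto simp: J_def)
      have sym: "g2 a l j = g2 a j l" by (simp add: g2_eq insert_commute)
      \<comment> \<open>The indices cross: \<open>g1 a l\<close> omits only \<open>a l\<close>, so
        it refines \<open>g2 a j l\<close> by the condition on \<open>a j\<close>.\<close>
      have gl: "g1 a l = gcd (g2 a j l) (a ! j)" using g1_g2[of l j] jl sym by simp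
      have gj: "g1 a j = gcd (g2 a j l) (a ! l)" using g1_g2[of j l] jl by simp
      have cop: "gcd (gcd (g2 a j l) (a ! j)) (a ! l) = 1"
        using gcd_g1[OF gcd jl(2)] gl by (simp add: gcd.commute)
      have "(\<Sum>\<zeta> | \<zeta> powi g2 a j l = 1. F \<zeta> j 1 * F \<zeta> l 1) =
        (L j - 1) * (L l - 1) / (4 * L j * L l) + (L j - 1) / (2 * L j) * ((of_int (g1 a l) - 1) / 2) +
          (L l - 1) / (2 * L l) * ((of_int (g1 a j) - 1) / 2) + zeta_sum a j l"
        unfolding F_def zeta_sum_def
        by (rule sum_fac_inv_nth_1_1[OF g2_pos[OF j jl(4)] cop L0[OF j] L0[OF jl(4)] gl gj])
      moreover have "J - {j, l} \<subseteq> J" by blast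
      ultimately show ?thesis using restrict[of "J - {j, l}" "\<lambda>\<zeta>. F \<zeta> j 1 * F \<zeta> l 1"]
        by (simp only: ins2[OF j jl(4)] g2_eq)
    qed
    have "(\<Sum>\<zeta> | \<zeta> ^ w i = 1. fps_nth (\<Prod>j\<in>J. fac_inv (\<zeta> powi (a ! j)) (L j)) 2) =
        (\<Sum>\<zeta> | \<zeta> ^ w i = 1. (\<Sum>j\<in>J. F \<zeta> j 2 * (\<Prod>p\<in>J - {j}. F \<zeta> p 0)) +
          (\<Sum>j\<in>J. \<Sum>l\<in>J - {j}. F \<zeta> j 1 * F \<zeta> l 1 * (\<Prod>p\<in>J - {j, l}. F \<zeta> p 0)) / 2)"
      by (subst fps_prod_nth_2) (simp_all add: J_def F_def)
    also have "\<dots> = (\<Sum>j\<in>J. \<Sum>\<zeta> | \<zeta> ^ w i = 1. F \<zeta> j 2 * (\<Prod>p\<in>J - {j}. F \<zeta> p 0)) +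
        (\<Sum>j\<in>J. \<Sum>l\<in>J - {j}. \<Sum>\<zeta> | \<zeta> ^ w i = 1. F \<zeta> j 1 * F \<zeta> l 1 * (\<Prod>p\<in>J - {j, l}. F \<zeta> p 0)) / 2"
    proof -
      have "(\<Sum>\<zeta>\<in>A. \<Sum>j\<in>J. \<Sum>l\<in>B j. f \<zeta> j l) = (\<Sum>j\<in>J. \<Sum>l\<in>B j. \<Sum>\<zeta>\<in>A. f \<zeta> j l)"
        for A :: "complex set" and B and f :: "complex \<Rightarrow> nat \<Rightarrow> nat \<Rightarrow> complex"
        by (subst sum.swap) (intro sum.cong refl sum.swap)
      then show ?thesis
        unfolding sum.distrib sum_divide_distrib[symmetric] by (subst sum.swap) simp
    qed
    also have "\<dots> = (\<Sum>j\<in>J. 1 / (\<Prod>p\<in>J - {j}. L p) *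
        (((L j)\<^sup>2 - 1) / (12 * L j) + L j * (of_int (g1 a j) ^ 2 - 1) / 12)) +
      (\<Sum>j\<in>J. \<Sum>l\<in>J - {j}. 1 / (\<Prod>p\<in>J - {j, l}. L p) *
        ((L j - 1) * (L l - 1) / (4 * L j * L l) + (L j - 1) / (2 * L j) * ((of_int (g1 a l) - 1) / 2) +
          (L l - 1) / (2 * L l) * ((of_int (g1 a j) - 1) / 2) + zeta_sum a j l)) / 2"
      by (intro arg_cong2[where f = "(+)"] arg_cong2[where f = "(/)"] sum.cong refl one two)
    also have "\<dots> = G2 c i"
    proof -
      have "J - {j} = {..<n} - {i, j}" "J - {j, l} = {..<n} - {i, j, l}" for j l
        by (auto simp: J_def)
      then show ?thesis by (simp only: G2_def L_def J_def)
    qed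
    finally show ?thesis by (simp only: J_def L_def)
  qed
  then show ?thesis
    by (simp add: Phi_def fps_sum_nth sum_distrib_left[symmetric])
qed

end

section \<open>The Laurent polynomials \<open>S\<^sub>u\<close>\<close>

text \<open>The map given by the universal property of a monoid algebra, from a map of coefficients
  and a character of the monoid. Substitution of monomials and evaluation at a point are both
  instances.\<close>

definition char_hom ::
    "('b :: zero \<Rightarrow> 'r :: comm_ring_1) \<Rightarrow> ('m :: cancel_comm_monoid_add \<Rightarrow> 'r) \<Rightarrow> ('m \<Rightarrow>\<^sub>0 'b) \<Rightarrow> 'r" where
  "char_hom \<iota> \<chi> P = (\<Sum>m\<in>Poly_Mapping.keys P. \<iota> (Poly_Mapping.lookup P m) * \<chi> m)"

lemma char_hom_superset:
  assumes "\<iota> 0 = 0" "finite A" "Poly_Mapping.keys P \<subseteq> A"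
  shows "char_hom \<iota> \<chi> P = (\<Sum>m\<in>A. \<iota> (Poly_Mapping.lookup P m) * \<chi> m)"
  unfolding char_hom_def using assms by (intro sum.mono_neutral_left) (auto simp: in_keys_iff)

lemma char_hom_add:
  assumes "\<iota> 0 = 0" "\<And>x y. \<iota> (x + y) = \<iota> x + \<iota> y"
  shows "char_hom \<iota> \<chi> (P + Q) = char_hom \<iota> \<chi> P + char_hom \<iota> \<chi> Q"
proof -
  let ?A = "Poly_Mapping.keys P \<union> Poly_Mapping.keys Q"
  have "Poly_Mapping.keys (P + Q) \<subseteq> ?A" by (rule keys_add)
  then have "char_hom \<iota> \<chi> R = (\<Sum>m\<in>?A. \<iota> (Poly_Mapping.lookup R m) * \<chi> m)" if "R \<in> {P, Q, P + Q}" for R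
    using that by (intro char_hom_superset assms(1)) auto
  then show ?thesis by (simp add: lookup_add assms(2) algebra_simps sum.distrib)
qed

lemma char_hom_single: "\<iota> 0 = 0 \<Longrightarrow> char_hom \<iota> \<chi> (Poly_Mapping.single m c) = \<iota> c * \<chi> m"
  by (simp add: char_hom_def)

lemma char_hom_sum:
  assumes "\<iota> 0 = 0" "\<And>x y. \<iota> (x + y) = \<iota> x + \<iota> y"
  shows "char_hom \<iota> \<chi> (\<Sum>i\<in>A. F i) = (\<Sum>i\<in>A. char_hom \<iota> \<chi> (F i))"
  by (induction A rule: infinite_finite_induct)
    (simp_all add: char_hom_add[of \<iota>, OF assms] char_hom_def[of _ _ 0])

lemma poly_mapping_sum_single:
  "(\<Sum>m\<in>Poly_Mapping.keys P. Poly_Mapping.single m (Poly_Mapping.lookup P m)) = P"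
  by (rule poly_mapping_eqI)
    (auto simp: lookup_sum lookup_single when_def in_keys_iff sum.delta)

lemma char_hom:
  fixes \<iota> :: "'b :: comm_ring_1 \<Rightarrow> 'r :: comm_ring_1"
    and \<chi> :: "'m :: cancel_comm_monoid_add \<Rightarrow> 'r"
  assumes "comm_ring_hom \<iota>" and "\<chi> 0 = 1" "\<And>m m'. \<chi> (m + m') = \<chi> m * \<chi> m'"
  shows "comm_ring_hom (char_hom \<iota> \<chi>)"
proof
  interpret comm_ring_hom \<iota> by fact
  have add: "\<iota> 0 = 0" "\<And>x y. \<iota> (x + y) = \<iota> x + \<iota> y" by (simp_all add: hom_add)
  fix P Q :: "'m \<Rightarrow>\<^sub>0 'b"
  show "char_hom \<iota> \<chi> (P + Q) = char_hom \<iota> \<chi> P + char_hom \<iota> \<chi> Q"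
    by (rule char_hom_add[OF add])
  let ?P = "Poly_Mapping.lookup P" and ?Q = "Poly_Mapping.lookup Q"
  have "P * Q = (\<Sum>m\<in>Poly_Mapping.keys P. Poly_Mapping.single m (?P m)) *
      (\<Sum>m'\<in>Poly_Mapping.keys Q. Poly_Mapping.single m' (?Q m'))"
    by (simp only: poly_mapping_sum_single)
  also have "\<dots> = (\<Sum>m\<in>Poly_Mapping.keys P. \<Sum>m'\<in>Poly_Mapping.keys Q.
      Poly_Mapping.single (m + m') (?P m * ?Q m'))"
    by (simp only: sum_product mult_single)
  also have "char_hom \<iota> \<chi> \<dots> = (\<Sum>m\<in>Poly_Mapping.keys P. \<Sum>m'\<in>Poly_Mapping.keys Q.
      \<iota> (?P m) * \<chi> m * (\<iota> (?Q m') * \<chi> m'))"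
    by (simp only: char_hom_sum[of \<iota>, OF add] char_hom_single[of \<iota>, OF add(1)] hom_mult assms(3) mult_ac)
  also have "\<dots> = char_hom \<iota> \<chi> P * char_hom \<iota> \<chi> Q"
    by (simp only: char_hom_def sum_product)
  finally show "char_hom \<iota> \<chi> (P * Q) = char_hom \<iota> \<chi> P * char_hom \<iota> \<chi> Q" .
  show "char_hom \<iota> \<chi> 1 = 1"
    unfolding single_one[symmetric] using add(1) by (subst char_hom_single) (simp_all add: assms(2))
  show "char_hom \<iota> \<chi> 0 = 0" by (simp add: char_hom_def)
qed

definition subst_monoms :: "((nat \<Rightarrow>\<^sub>0 int) \<Rightarrow> (nat \<Rightarrow>\<^sub>0 int)) \<Rightarrow> laurent_poly \<Rightarrow> laurent_poly" where
  "subst_monoms \<mu> = char_hom (Poly_Mapping.single 0) (\<lambda>m. Poly_Mapping.single (\<mu> m) 1)"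

lemma subst_monoms_hom:
  assumes "\<mu> 0 = 0" "\<And>m m'. \<mu> (m + m') = \<mu> m + \<mu> m'"
  shows "comm_ring_hom (subst_monoms \<mu>)"
  unfolding subst_monoms_def
proof (rule char_hom)
  show "comm_ring_hom (Poly_Mapping.single 0 :: complex \<Rightarrow> laurent_poly)"
    by unfold_locales (simp_all add: single_add mult_single)
qed (simp_all add: assms mult_single)

lemma subst_monoms_var_pow: "subst_monoms \<mu> (var_pow i e) = Poly_Mapping.single (\<mu> (Poly_Mapping.single i e)) 1"
  unfolding subst_monoms_def var_pow_def by (subst char_hom_single) simp_all

lemma subst_monoms_eq:
  "subst_monoms \<mu> P = (\<Sum>m\<in>Poly_Mapping.keys P. Poly_Mapping.single (\<mu> m) (Poly_Mapping.lookup P m))"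
  unfolding subst_monoms_def char_hom_def by (simp add: mult_single)

text \<open>The substitution \<open>x\<^sub>p := x\<^sub>q\<close>, and the substitution \<open>x\<^sub>p := 1\<close>.\<close>

definition merge_var :: "nat \<Rightarrow> nat \<Rightarrow> (nat \<Rightarrow>\<^sub>0 int) \<Rightarrow> (nat \<Rightarrow>\<^sub>0 int)" where
  "merge_var p q m = m + Poly_Mapping.single q (Poly_Mapping.lookup m p) -
     Poly_Mapping.single p (Poly_Mapping.lookup m p)"

definition drop_var :: "nat \<Rightarrow> (nat \<Rightarrow>\<^sub>0 int) \<Rightarrow> (nat \<Rightarrow>\<^sub>0 int)" where
  "drop_var p m = m - Poly_Mapping.single p (Poly_Mapping.lookup m p)"

lemma merge_hom: "comm_ring_hom (subst_monoms (merge_var p q))"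
  by (rule subst_monoms_hom) (simp_all add: merge_var_def lookup_add single_add algebra_simps)

lemma drop_hom: "comm_ring_hom (subst_monoms (drop_var p))"
  by (rule subst_monoms_hom) (simp_all add: drop_var_def lookup_add single_add algebra_simps)

lemma merge_var_pow: "subst_monoms (merge_var p q) (var_pow i e) = var_pow (if i = p then q else i) e"
  unfolding subst_monoms_var_pow
  by (auto simp: merge_var_def var_pow_def lookup_single when_def)

lemma drop_var_pow: "i \<noteq> p \<Longrightarrow> subst_monoms (drop_var p) (var_pow i e) = var_pow i e"
  unfolding subst_monoms_var_pow
  by (simp add: drop_var_def var_pow_def lookup_single when_def)

lemma var_pow_add: "var_pow i (e + f) = var_pow i e * var_pow i f"
  by (simp add: var_pow_def mult_single single_add)

lemma var_pow_0 [simp]: "var_pow i 0 = 1"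
  by (simp add: var_pow_def)

lemma var_pow_nat: "var_pow i (int e) = var_pow i 1 ^ e"
proof (induction e)
  case (Suc e)
  have "var_pow i (int (Suc e)) = var_pow i 1 * var_pow i (int e)"
    by (simp add: var_pow_add[symmetric])
  then show ?case using Suc by simp
qed simp

text \<open>Negative exponents reduce to positive ones: \<open>x^(-f) - y^(-f)\<close> is
  \<open>y^f - x^f\<close> times the monomial \<open>x^(-f) y^(-f)\<close>.\<close>

lemma var_diff_dvd: "var_pow p 1 - var_pow q 1 dvd var_pow p e - var_pow q e"
proof -
  have nat: "var_pow p 1 - var_pow q 1 dvd var_pow p (int e) - var_pow q (int e)" for e
    unfolding var_pow_nat by (metis dvd_triv_left power_diff_sumr2)
  show ?thesis
  proof (cases "0 \<le> e")
    case True
    then show ?thesis using nat[of "nat e"] by simp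
  next
    case False
    then obtain f where e: "e = - int f" by (metis int_cases2 nle_le of_nat_0_le_iff)
    have inv: "var_pow i (- int f) * var_pow i (int f) = 1" for i
      by (simp add: var_pow_add[symmetric])
    have "var_pow p e - var_pow q e =
        (var_pow p (- int f) * (var_pow q (- int f) * var_pow q (int f)) -
         var_pow q (- int f) * (var_pow p (- int f) * var_pow p (int f)))"
      unfolding inv e by simp
    also have "\<dots> = (var_pow p (int f) - var_pow q (int f)) * (- (var_pow p (- int f) * var_pow q (- int f)))"
      by (simp add: algebra_simps)
    finally show ?thesis using nat[of f] dvd_mult2 by metis
  qed
qed

text \<open>The factor theorem, proved monomial by monomial. It turns vanishing under the
  substitution into divisibility by the difference of the two variables.\<close>

lemma var_diff_dvd_merge: "var_pow p 1 - var_pow q 1 dvd P - subst_monoms (merge_var p q) P"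
proof -
  have "var_pow p 1 - var_pow q 1 dvd
      Poly_Mapping.single m c - Poly_Mapping.single (merge_var p q m) c" for m and c :: complex
  proof -
    let ?e = "Poly_Mapping.lookup m p"
    have "Poly_Mapping.single m c - Poly_Mapping.single (merge_var p q m) c =
        Poly_Mapping.single (m - Poly_Mapping.single p ?e) c * (var_pow p ?e - var_pow q ?e)"
      by (simp add: var_pow_def right_diff_distrib mult_single merge_var_def algebra_simps)
    then show ?thesis using var_diff_dvd[of p q ?e] by simp
  qed
  then have "var_pow p 1 - var_pow q 1 dvd (\<Sum>m\<in>Poly_Mapping.keys P.
      Poly_Mapping.single m (Poly_Mapping.lookup P m) -
      Poly_Mapping.single (merge_var p q m) (Poly_Mapping.lookup P m))"
    by (intro dvd_sum)
  then show ?thesis by (simp only: sum_subtractf poly_mapping_sum_single subst_monoms_eq)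
qed

text \<open>The differences of variables are pairwise non-associated primes.\<close>

lemma prod_var_diff_dvd:
  assumes "finite T" "\<And>p q. (p, q) \<in> T \<Longrightarrow> p < q"
    and "\<And>p q. (p, q) \<in> T \<Longrightarrow> subst_monoms (merge_var p q) P = 0"
  shows "(\<Prod>(p, q)\<in>T. var_pow p 1 - var_pow q 1) dvd P"
  using assms
proof (induction T rule: finite_induct)
  case (insert x T)
  obtain p q where x: "x = (p, q)" by (cases x)
  interpret comm_ring_hom "subst_monoms (merge_var p q)" by (rule merge_hom)
  have "(\<Prod>(p, q)\<in>T. var_pow p 1 - var_pow q 1) dvd P" by (rule insert.IH) (use insert.prems in auto)
  then obtain E where E: "P = (\<Prod>(p, q)\<in>T. var_pow p 1 - var_pow q 1) * E" by (elim dvdE)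
  have "subst_monoms (merge_var p q) P = 0" using insert.prems x by simp
  moreover have "subst_monoms (merge_var p q) (\<Prod>(r, s)\<in>T. var_pow r 1 - var_pow s 1) \<noteq> 0"
  proof -
    have "subst_monoms (merge_var p q) (var_pow r 1 - var_pow s 1) \<noteq> 0" if "(r, s) \<in> T" for r s
    proof -
      have "r < s" "p < q" "(r, s) \<noteq> (p, q)" using insert that x by auto
      then have "(if r = p then q else r) \<noteq> (if s = p then q else s)" by auto
      then show ?thesis unfolding hom_minus merge_var_pow by (simp add: var_pow_inject)
    qed
    then show ?thesis unfolding hom_prod using insert.hyps by auto
  qed
  ultimately have "subst_monoms (merge_var p q) E = 0" unfolding E hom_mult by simp
  then have "var_pow p 1 - var_pow q 1 dvd E" using var_diff_dvd_merge[of p q E] by simp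
  then have "(\<Prod>(p, q)\<in>T. var_pow p 1 - var_pow q 1) * (var_pow p 1 - var_pow q 1) dvd P"
    unfolding E by (rule mult_dvd_mono[OF dvd_refl])
  then show ?case using insert.hyps x by (simp add: mult.commute)
qed simp

section \<open>The quotient of determinants: existence and variables\<close>

lemma S_matrix_carrier [simp]: "S_matrix k m u \<in> carrier_mat (k + m) (k + m)"
  by (simp add: S_matrix_def Let_def)

text \<open>Identifying two variables of the same block makes two columns equal and the determinant
  zero, so the determinant is divisible by all differences within the blocks. This gives the
  existence behind the description in \<open>S_poly\<close>.\<close>

lemma S_poly_times: "S_poly k m u * (vandermonde 0 k * vandermonde k (k + m)) = det (S_matrix k m u)"
proof -
  define T where "T = {(i, j). 0 \<le> i \<and> i < j \<and> j < k} \<union> {(i, j). k \<le> i \<and> i < j \<and> j < k + m}"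
  have fin: "finite {(i, j). lo \<le> i \<and> i < j \<and> j < hi}" for lo hi :: nat
    by (rule finite_subset[of _ "{..<hi} \<times> {..<hi}"]) auto
  have dvd: "(\<Prod>(p, q)\<in>T. var_pow p 1 - var_pow q 1) dvd det (S_matrix k m u)"
  proof (rule prod_var_diff_dvd)
    show "finite T" unfolding T_def by (intro finite_UnI fin)
    fix p q assume pq: "(p, q) \<in> T"
    interpret comm_ring_hom "subst_monoms (merge_var p q)" by (rule merge_hom)
    have "col (map_mat (subst_monoms (merge_var p q)) (S_matrix k m u)) p =
        col (map_mat (subst_monoms (merge_var p q)) (S_matrix k m u)) q"
      using pq by (intro eq_vecI) (auto simp: T_def S_matrix_def Let_def merge_var_pow)
    then have "det (map_mat (subst_monoms (merge_var p q)) (S_matrix k m u)) = 0"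
      by (intro det_identical_columns[where n = "k + m" and i = p and j = q]) (use pq in \<open>auto simp: T_def\<close>)
    then show "subst_monoms (merge_var p q) (det (S_matrix k m u)) = 0" by (simp only: hom_det)
  qed (auto simp: T_def)
  have VV: "(\<Prod>(p, q)\<in>T. var_pow p 1 - var_pow q 1) = vandermonde 0 k * vandermonde k (k + m)"
    unfolding T_def vandermonde_def by (intro prod.union_disjoint fin) auto
  obtain P where "det (S_matrix k m u) = vandermonde 0 k * vandermonde k (k + m) * P"
    using dvd unfolding VV by (elim dvdE)
  then have P: "P * (vandermonde 0 k * vandermonde k (k + m)) = det (S_matrix k m u)"
    by (simp add: mult.commute)
  then show ?thesis using S_poly_eqI[OF P] by simp
qed

text \<open>Setting a variable outside the matrix to 1 fixes the determinant and the Vandermonde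
  products, hence fixes their quotient by uniqueness. An evaluation thus depends on the first
  \<open>k + m\<close> values only, and list entries beyond the length are harmless in
  \<open>S_fun\<close>.\<close>

lemma S_poly_vars:
  assumes "M \<in> Poly_Mapping.keys (S_poly k m u)"
  shows "Poly_Mapping.keys M \<subseteq> {..<k + m}"
proof
  fix p assume p: "p \<in> Poly_Mapping.keys M"
  show "p \<in> {..<k + m}"
  proof (rule ccontr)
    assume "p \<notin> {..<k + m}"
    then have pN: "k + m \<le> p" by simp
    interpret comm_ring_hom "subst_monoms (drop_var p)" by (rule drop_hom)
    have v: "subst_monoms (drop_var p) (vandermonde lo hi) = vandermonde lo hi" if "hi \<le> k + m" for lo hi
      unfolding vandermonde_def hom_prod using that pN
      by (intro prod.cong refl) (auto simp: hom_minus drop_var_pow)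
    have "map_mat (subst_monoms (drop_var p)) (S_matrix k m u) = S_matrix k m u"
      using pN by (intro eq_matI) (auto simp: S_matrix_def Let_def drop_var_pow)
    then have "subst_monoms (drop_var p) (det (S_matrix k m u)) = det (S_matrix k m u)"
      by (metis hom_det)
    then have "subst_monoms (drop_var p) (S_poly k m u) * (vandermonde 0 k * vandermonde k (k + m)) =
        det (S_matrix k m u)"
      unfolding S_poly_times[symmetric] hom_mult by (simp add: v)
    then have "S_poly k m u = subst_monoms (drop_var p) (S_poly k m u)"
      by (rule S_poly_eqI)
    then have "M \<in> Poly_Mapping.keys (\<Sum>M'\<in>Poly_Mapping.keys (S_poly k m u).
        Poly_Mapping.single (drop_var p M') (Poly_Mapping.lookup (S_poly k m u) M'))"
      using assms unfolding subst_monoms_eq by simp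
    then obtain M' where "M \<in> Poly_Mapping.keys
        (Poly_Mapping.single (drop_var p M') (Poly_Mapping.lookup (S_poly k m u) M'))"
      by (rule UN_E[OF subsetD[OF keys_sum]])
    then have "M = drop_var p M'" by (simp split: if_splits)
    then show False using p by (simp add: in_keys_iff drop_var_def lookup_minus)
  qed
qed

lemma laurent_eval_hom:
  assumes "\<And>i. z i \<noteq> 0"
  shows "comm_ring_hom (\<lambda>P. laurent_eval P z)"
proof -
  let ?\<chi> = "\<lambda>m. \<Prod>i\<in>Poly_Mapping.keys m. z i powi Poly_Mapping.lookup m i"
  have "laurent_eval P z = char_hom (\<lambda>c. c) ?\<chi> P" for P
    by (simp add: laurent_eval_def char_hom_def)
  moreover have "comm_ring_hom (char_hom (\<lambda>c :: complex. c) ?\<chi>)"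
  proof (rule char_hom)
    fix m m' :: "nat \<Rightarrow>\<^sub>0 int"
    let ?A = "Poly_Mapping.keys m \<union> Poly_Mapping.keys m'"
    have e: "?\<chi> M = (\<Prod>i\<in>?A. z i powi Poly_Mapping.lookup M i)" if "Poly_Mapping.keys M \<subseteq> ?A" for M
      using that by (intro prod.mono_neutral_left) (auto simp: in_keys_iff)
    show "?\<chi> (m + m') = ?\<chi> m * ?\<chi> m'"
      unfolding e[OF keys_add] e[of m, OF Un_upper1] e[of m', OF Un_upper2]
      by (simp add: lookup_add power_int_add prod.distrib assms)
  qed (unfold_locales, auto)
  ultimately show ?thesis by simp
qed

lemma laurent_eval_var_pow: "laurent_eval (var_pow i e) z = z i powi e"
  by (cases "e = 0") (simp_all add: laurent_eval_def var_pow_def)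

lemma laurent_eval_cong:
  assumes "\<And>M. M \<in> Poly_Mapping.keys P \<Longrightarrow> Poly_Mapping.keys M \<subseteq> A" "\<And>i. i \<in> A \<Longrightarrow> z i = z' i"
  shows "laurent_eval P z = laurent_eval P z'"
  unfolding laurent_eval_def
proof (intro sum.cong refl arg_cong2[where f = "(*)"] prod.cong)
  fix M i assume "M \<in> Poly_Mapping.keys P" "i \<in> Poly_Mapping.keys M"
  then have "i \<in> A" using assms(1) by blast
  then show "z i powi Poly_Mapping.lookup M i = z' i powi Poly_Mapping.lookup M i"
    by (simp only: assms(2))
qed

section \<open>Cofactors of the Vandermonde matrix\<close>

definition vdm :: "nat \<Rightarrow> (nat \<Rightarrow> complex) \<Rightarrow> complex mat" where
  "vdm N z = mat N N (\<lambda>(r, c). z c ^ (N - 1 - r))"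

text \<open>Cofactors along the first row do not see that row, so they agree with those of the
  Vandermonde matrix.\<close>

lemma det_vdm_row_0:
  assumes "0 < N"
  shows "det (mat N N (\<lambda>(r, c). if r = 0 then v c else z c ^ (N - 1 - r))) =
    (\<Sum>c<N. v c * cofactor (vdm N z) 0 c)"
proof -
  let ?M = "mat N N (\<lambda>(r, c). if r = 0 then v c else z c ^ (N - 1 - r))"
  have "det ?M = (\<Sum>c<N. ?M $$ (0, c) * cofactor ?M 0 c)"
    by (rule laplace_expansion_row) (use assms in auto)
  moreover have "mat_delete ?M 0 c = mat_delete (vdm N z) 0 c" for c
    by (rule eq_matI) (auto simp: mat_delete_def vdm_def)
  ultimately show ?thesis using assms by (simp add: cofactor_def)
qed

text \<open>The left side expands the matrix whose first row has been replaced by the powers of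
  exponent \<open>e\<close>; for \<open>e < N - 1\<close> that row occurs a second time further
  down.\<close>

lemma sum_power_cofactor_vdm:
  assumes e: "e < N"
  shows "(\<Sum>c<N. z c ^ e * cofactor (vdm N z) 0 c) = (if e = N - 1 then det (vdm N z) else 0)"
proof -
  let ?M = "mat N N (\<lambda>(r, c). if r = 0 then z c ^ e else z c ^ (N - 1 - r))"
  have "det ?M = (if e = N - 1 then det (vdm N z) else 0)"
  proof (cases "e = N - 1")
    case True
    then have "?M = vdm N z" by (intro eq_matI) (auto simp: vdm_def)
    then show ?thesis using True by simp
  next
    case False
    have "row ?M 0 = row ?M (N - 1 - e)"
      using e False by (intro eq_vecI) auto
    then have "det ?M = 0"
      by (intro det_identical_rows[where n = N and i = 0 and j = "N - 1 - e"]) (use e False in auto)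
    then show ?thesis using False by simp
  qed
  then show ?thesis using det_vdm_row_0[of N "\<lambda>c. z c ^ e" z] e by simp
qed

text \<open>Testing \<open>c \<mapsto> cofactor\<close> on the polynomial vanishing at all nodes but \<open>z c\<close>.\<close>

lemma cofactor_vdm:
  assumes c: "c < N"
  shows "cofactor (vdm N z) 0 c * (\<Prod>d\<in>{..<N} - {c}. z c - z d) = det (vdm N z)"
proof -
  define p where "p = (\<Prod>d\<in>{..<N} - {c}. [:- z d, 1:])"
  have deg: "degree p = N - 1"
    unfolding p_def using c by (subst degree_prod_eq_sum_degree) auto
  have lead: "coeff p (N - 1) = 1"
    using lead_coeff_prod[of "\<lambda>d. [:- z d, 1:]" "{..<N} - {c}"] deg unfolding p_def[symmetric] by simp
  have "(\<Sum>d<N. poly p (z d) * cofactor (vdm N z) 0 d) =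
      (\<Sum>e\<le>N - 1. coeff p e * (\<Sum>d<N. z d ^ e * cofactor (vdm N z) 0 d))"
    unfolding poly_altdef deg sum_distrib_left sum_distrib_right
    by (subst sum.swap) (simp add: mult.assoc)
  also have "\<dots> = (\<Sum>e\<le>N - 1. coeff p e * (if e = N - 1 then det (vdm N z) else 0))"
    by (intro sum.cong refl arg_cong2[where f = "(*)"] sum_power_cofactor_vdm) (use c in auto)
  also have "\<dots> = (\<Sum>e\<in>{N - 1}. coeff p e * (if e = N - 1 then det (vdm N z) else 0))"
    by (intro sum.mono_neutral_right) auto
  also have "\<dots> = det (vdm N z)" using lead by simp
  finally have "(\<Sum>d<N. poly p (z d) * cofactor (vdm N z) 0 d) = det (vdm N z)" .
  moreover have "(\<Sum>d<N. poly p (z d) * cofactor (vdm N z) 0 d) =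
      (\<Sum>d\<in>{c}. poly p (z d) * cofactor (vdm N z) 0 d)"
    using c by (intro sum.mono_neutral_right) (auto simp: p_def poly_prod)
  ultimately show ?thesis by (simp add: p_def poly_prod mult.commute)
qed

text \<open>Induction through \<open>cofactor_vdm\<close> at column 0, where the cofactor is a
  Vandermonde determinant in the remaining nodes.\<close>

lemma det_vdm: "det (vdm N z) = (\<Prod>(i, j) | i < j \<and> j < N. z i - z j)"
proof (induction N arbitrary: z)
  case 0
  show ?case by (simp add: det_def vdm_def)
next
  case (Suc N)
  have "mat_delete (vdm (Suc N) z) 0 0 = vdm N (\<lambda>i. z (Suc i))"
    by (rule eq_matI) (auto simp: mat_delete_def vdm_def)
  then have "cofactor (vdm (Suc N) z) 0 0 = (\<Prod>(i, j) | i < j \<and> j < N. z (Suc i) - z (Suc j))"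
    by (simp add: cofactor_def Suc.IH)
  also have "\<dots> = (\<Prod>(i, j)\<in>map_prod Suc Suc ` {(i, j). i < j \<and> j < N}. z i - z j)"
  proof -
    have "inj_on (map_prod Suc Suc) A" for A by (rule inj_onI) auto
    then show ?thesis by (simp add: prod.reindex split_def)
  qed
  finally have c: "cofactor (vdm (Suc N) z) 0 0 =
      (\<Prod>(i, j)\<in>map_prod Suc Suc ` {(i, j). i < j \<and> j < N}. z i - z j)" .
  have d: "(\<Prod>d\<in>{..<Suc N} - {0}. z 0 - z d) = (\<Prod>(i, j)\<in>Pair 0 ` ({..<Suc N} - {0}). z i - z j)"
  proof -
    have "inj_on (Pair (0 :: nat)) A" for A :: "nat set" by (rule inj_onI) auto
    then show ?thesis by (simp add: prod.reindex)
  qed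
  have un: "{(i, j). i < j \<and> j < Suc N} =
      map_prod Suc Suc ` {(i, j). i < j \<and> j < N} \<union> Pair 0 ` ({..<Suc N} - {0})"
  proof (intro subset_antisym subsetI)
    fix x :: "nat \<times> nat" assume "x \<in> {(i, j). i < j \<and> j < Suc N}"
    then obtain i j where x: "x = (i, j)" "i < j" "j < Suc N" by auto
    show "x \<in> map_prod Suc Suc ` {(i, j). i < j \<and> j < N} \<union> Pair 0 ` ({..<Suc N} - {0})"
    proof (cases i)
      case (Suc i')
      then obtain j' where "j = Suc j'" using x by (cases j) auto
      then have "x = map_prod Suc Suc (i', j')" "(i', j') \<in> {(i, j). i < j \<and> j < N}" using x Suc by auto
      then show ?thesis by blast
    qed (use x in auto)
  qed auto
  have fin: "finite {(i, j). i < j \<and> j < (N :: nat)}"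
    by (rule finite_subset[of _ "{..<N} \<times> {..<N}"]) auto
  have "det (vdm (Suc N) z) = cofactor (vdm (Suc N) z) 0 0 * (\<Prod>d\<in>{..<Suc N} - {0}. z 0 - z d)"
    by (rule cofactor_vdm[symmetric]) simp
  also have "\<dots> = (\<Prod>(i, j)\<in>map_prod Suc Suc ` {(i, j). i < j \<and> j < N} \<union> Pair 0 ` ({..<Suc N} - {0}). z i - z j)"
    unfolding c d using fin by (intro prod.union_disjoint[symmetric]) auto
  finally show ?case unfolding un .
qed

text \<open>Only the first \<open>k\<close> entries of the first row are nonzero, and
  \<open>cofactor_vdm\<close> supplies their cofactors. The full Vandermonde product splits into the
  two blocks, which cancel, and the mixed differences, which form the counterpart of
  \<open>D_prod\<close>.\<close>

lemma laurent_eval_S_poly: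
  assumes "0 < k" and z0: "\<And>i. i < k + m \<Longrightarrow> z i \<noteq> 0" and inj: "inj_on z {..<k + m}"
  shows "laurent_eval (S_poly k m u) z = (\<Prod>(i, j)\<in>{..<k} \<times> {k..<k + m}. z i - z j) *
    (\<Sum>i<k. z i powi u / (\<Prod>j\<in>{..<k + m} - {i}. z i - z j))"
proof -
  define N where "N = k + m"
  \<comment> \<open>Evaluation is multiplicative only at nonzero values, because \<open>powi\<close>
    is not additive in the exponent at 0. Changing \<open>z\<close> to 1 beyond \<open>N\<close>
    secures this and does not affect \<open>S_poly\<close>.\<close>
  define y where "y i = (if i < N then z i else 1)" for i
  interpret comm_ring_hom "\<lambda>P. laurent_eval P y"
    by (rule laurent_eval_hom) (use z0 in \<open>auto simp: y_def N_def\<close>)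
  have yN: "y i = z i" if "i < N" for i using that by (simp add: y_def)
  have diff: "z i - z j \<noteq> 0" if "i < N" "j < N" "i \<noteq> j" for i j
    using inj that by (auto simp: N_def inj_on_def)
  have V: "laurent_eval (vandermonde lo hi) y = (\<Prod>(i, j) | lo \<le> i \<and> i < j \<and> j < hi. z i - z j)"
    if "hi \<le> N" for lo hi
    unfolding vandermonde_def hom_prod using that
    by (intro prod.cong refl) (auto simp: hom_minus laurent_eval_var_pow yN)
  have fin: "finite {(i, j). lo \<le> i \<and> i < j \<and> j < hi}" for lo hi :: nat
    by (rule finite_subset[of _ "{..<hi} \<times> {..<hi}"]) auto
  have V0: "(\<Prod>(i, j) | lo \<le> i \<and> i < j \<and> j < hi. z i - z j) \<noteq> 0" if "hi \<le> N" for lo hi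
  proof -
    have "z i - z j \<noteq> 0" if "i < j" "j < hi" for i j
      using diff[of i j] that \<open>hi \<le> N\<close> by simp
    then show ?thesis using fin[of lo hi] by (auto simp: prod_zero_iff simp del: right_minus_eq)
  qed
  have "map_mat (\<lambda>P. laurent_eval P y) (S_matrix k m u) =
      mat N N (\<lambda>(r, c). if r = 0 then (if c < k then z c powi u else 0) else z c ^ (N - 1 - r))"
  proof (rule eq_matI)
    fix r c assume "r < dim_row (mat N N (\<lambda>(r, c). if r = 0 then (if c < k then z c powi u else 0) else z c ^ (N - 1 - r)))"
      and "c < dim_col (mat N N (\<lambda>(r, c). if r = 0 then (if c < k then z c powi u else 0) else z c ^ (N - 1 - r)))"
    then have rc: "r < N" "c < N" by auto
    have "int N - 1 - int r = int (N - 1 - r)" using rc by linarith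
    then have "z c powi (int N - 1 - int r) = z c ^ (N - 1 - r)" by (simp only: power_int_of_nat)
    then show "map_mat (\<lambda>P. laurent_eval P y) (S_matrix k m u) $$ (r, c) =
        mat N N (\<lambda>(r, c). if r = 0 then (if c < k then z c powi u else 0) else z c ^ (N - 1 - r)) $$ (r, c)"
      using rc by (simp add: S_matrix_def Let_def N_def[symmetric] laurent_eval_var_pow yN hom_zero)
  qed (simp_all add: S_matrix_def Let_def N_def)
  then have "laurent_eval (det (S_matrix k m u)) y =
      det (mat N N (\<lambda>(r, c). if r = 0 then (if c < k then z c powi u else 0) else z c ^ (N - 1 - r)))"
    by (metis hom_det)
  also have "\<dots> = (\<Sum>c<N. (if c < k then z c powi u else 0) * cofactor (vdm N z) 0 c)"
    by (rule det_vdm_row_0) (use assms in \<open>simp add: N_def\<close>)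
  also have "\<dots> = (\<Sum>c<k. z c powi u * cofactor (vdm N z) 0 c)"
    by (rule sum.mono_neutral_cong_right) (auto simp: N_def)
  also have "\<dots> = (\<Sum>c<k. z c powi u * (det (vdm N z) / (\<Prod>d\<in>{..<N} - {c}. z c - z d)))"
  proof (intro sum.cong refl)
    fix c assume "c \<in> {..<k}"
    then have c: "c < N" by (simp add: N_def)
    have "(\<Prod>d\<in>{..<N} - {c}. z c - z d) \<noteq> 0" using diff c by (auto simp: prod_zero_iff)
    then show "z c powi u * cofactor (vdm N z) 0 c =
        z c powi u * (det (vdm N z) / (\<Prod>d\<in>{..<N} - {c}. z c - z d))"
      unfolding cofactor_vdm[OF c, symmetric] by simp
  qed
  finally have e: "laurent_eval (det (S_matrix k m u)) y =
      det (vdm N z) * (\<Sum>c<k. z c powi u / (\<Prod>d\<in>{..<N} - {c}. z c - z d))"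
    by (simp add: sum_distrib_left mult_ac)
  define A B where "A = {(i, j). 0 \<le> i \<and> i < j \<and> j < k}" and "B = {(i, j). k \<le> i \<and> i < j \<and> j < N}"
  have "{(i, j). i < j \<and> j < N} = (A \<union> B) \<union> {..<k} \<times> {k..<N}"
    by (auto simp: N_def A_def B_def)
  moreover have "(A \<union> B) \<inter> {..<k} \<times> {k..<N} = {}" "A \<inter> B = {}" by (auto simp: A_def B_def)
  moreover have "finite A" "finite B" unfolding A_def B_def by (rule fin)+
  ultimately have "det (vdm N z) = (\<Prod>(i, j)\<in>A. z i - z j) * (\<Prod>(i, j)\<in>B. z i - z j) *
      (\<Prod>(i, j)\<in>{..<k} \<times> {k..<N}. z i - z j)"
    unfolding det_vdm by (simp add: prod.union_disjoint)
  moreover have "laurent_eval (S_poly k m u) y * ((\<Prod>(i, j)\<in>A. z i - z j) * (\<Prod>(i, j)\<in>B. z i - z j)) =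
      det (vdm N z) * (\<Sum>c<k. z c powi u / (\<Prod>d\<in>{..<N} - {c}. z c - z d))"
  proof -
    have "laurent_eval (vandermonde 0 k) y = (\<Prod>(i, j)\<in>A. z i - z j)"
      unfolding A_def by (rule V) (simp add: N_def)
    moreover have "laurent_eval (vandermonde k (k + m)) y = (\<Prod>(i, j)\<in>B. z i - z j)"
      unfolding B_def N_def[symmetric] by (rule V) simp
    ultimately show ?thesis unfolding e[symmetric] S_poly_times[symmetric] hom_mult by simp
  qed
  moreover have "(\<Prod>(i, j)\<in>A. z i - z j) \<noteq> 0" "(\<Prod>(i, j)\<in>B. z i - z j) \<noteq> 0"
    unfolding A_def B_def by (rule V0, simp add: N_def)+
  ultimately have "laurent_eval (S_poly k m u) y = (\<Prod>(i, j)\<in>{..<k} \<times> {k..<N}. z i - z j) *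
      (\<Sum>c<k. z c powi u / (\<Prod>d\<in>{..<N} - {c}. z c - z d))"
    by (simp add: mult_ac)
  moreover have "laurent_eval (S_poly k m u) z = laurent_eval (S_poly k m u) y"
    by (rule laurent_eval_cong[OF S_poly_vars]) (auto simp: y_def N_def)
  ultimately show ?thesis by (simp add: N_def)
qed

section \<open>Limits of the quotients S / D\<close>

lemma tendsto_laurent_eval:
  assumes "\<And>M. M \<in> Poly_Mapping.keys P \<Longrightarrow> Poly_Mapping.keys M \<subseteq> A"
    and "\<And>i. i \<in> A \<Longrightarrow> ((\<lambda>x. X x i) \<longlongrightarrow> z i) \<F>" "\<And>i. i \<in> A \<Longrightarrow> z i \<noteq> 0"
  shows "((\<lambda>x. laurent_eval P (X x)) \<longlongrightarrow> laurent_eval P z) \<F>"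
  unfolding laurent_eval_def using assms
  by (intro tendsto_sum tendsto_mult tendsto_prod tendsto_const tendsto_power_int) (auto dest: subsetD)

text \<open>At distinct nodes the sum is a Laurent polynomial over the mixed differences. Both are
  continuous at the limit point, where negative and positive entries never coincide. So the limit
  exists even if equal negative entries make single summands blow up.\<close>

lemma S_fun_lim:
  fixes X :: "'e \<Rightarrow> nat \<Rightarrow> complex"
  assumes neg: "\<And>c. c \<in> set b1 \<Longrightarrow> c < 0" and pos: "\<And>c. c \<in> set b2 \<Longrightarrow> c > 0"
    and lim: "\<And>i. i < length (b1 @ b2) \<Longrightarrow> ((\<lambda>x. X x i) \<longlongrightarrow> of_int ((b1 @ b2) ! i)) \<F>"
    and inj: "\<forall>\<^sub>F x in \<F>. inj_on (X x) {..<length (b1 @ b2)}"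
  shows "((\<lambda>x. \<Sum>i<length b1. X x i powi u / (\<Prod>j\<in>{..<length (b1 @ b2)} - {i}. X x i - X x j)) \<longlongrightarrow>
    S_fun u (b1 @ b2) / of_int (D_prod (b1 @ b2))) \<F>"
proof (cases "b1 = []")
  case True
  \<comment> \<open>Without negative entries the sum is empty, and \<open>S_fun\<close> is 0 by
    convention.\<close>
  have "filter (\<lambda>c. c < 0) b2 = []" using pos by (meson filter_False less_asym)
  then show ?thesis using True by (simp add: S_fun_def)
next
  case False
  define k m where "k = length b1" and "m = length b2"
  define z where "z i = (of_int ((b1 @ b2) ! i) :: complex)" for i
  have "filter (\<lambda>c. c < 0) b1 = b1" "filter (\<lambda>c. c > 0) b2 = b2"
    using neg pos by (simp_all add: filter_id_conv)
  moreover have "filter (\<lambda>c. c > 0) b1 = []" "filter (\<lambda>c. c < 0) b2 = []"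
    using neg pos by (meson filter_False less_asym)+
  ultimately have filt: "filter (\<lambda>c. c < 0) (b1 @ b2) = b1" "filter (\<lambda>c. c > 0) (b1 @ b2) = b2"
    by simp_all
  have bneg: "(b1 @ b2) ! i < 0" if "i < k" for i
    using that neg[of "b1 ! i"] by (simp add: nth_append k_def)
  have bpos: "(b1 @ b2) ! i > 0" if "k \<le> i" "i < k + m" for i
  proof -
    have "i - k < m" using that by linarith
    then show ?thesis using that pos[of "b2 ! (i - k)"] by (simp add: nth_append k_def m_def)
  qed
  have z0: "z i \<noteq> 0" if "i < k + m" for i
  proof -
    have "(b1 @ b2) ! i \<noteq> 0"
      using bneg[of i] bpos[OF _ that] by (metis less_irrefl not_less)
    then show ?thesis unfolding z_def of_int_eq_0_iff .
  qed
  have S: "S_fun u (b1 @ b2) = laurent_eval (S_poly k m u) z"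
  proof -
    have "(\<lambda>i. of_int ((b1 @ b2) ! i)) = z" by (simp add: z_def fun_eq_iff)
    then show ?thesis unfolding S_fun_def filt Let_def using False by (simp add: k_def m_def)
  qed
  have D: "of_int (D_prod (b1 @ b2)) = (\<Prod>(i, j)\<in>{..<k} \<times> {k..<k + m}. z i - z j)"
  proof -
    have "{(p, q). p < length (b1 @ b2) \<and> q < length (b1 @ b2) \<and> (b1 @ b2) ! p < 0 \<and> (b1 @ b2) ! q > 0} =
        {..<k} \<times> {k..<k + m}"
    proof -
      have len: "length (b1 @ b2) = k + m" by (simp add: k_def m_def)
      have "\<not> (b1 @ b2) ! i > 0" if "i < k" for i using bneg[OF that] by simp
      moreover have "\<not> (b1 @ b2) ! i < 0" if "k \<le> i" "i < k + m" for i using bpos[OF that] by simp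
      ultimately show ?thesis unfolding len using bneg bpos
        by (intro subset_antisym subsetI) (auto simp del: nth_append, (metis not_less)+)
    qed
    then show ?thesis unfolding D_prod_def by (simp add: z_def of_int_prod split_def)
  qed
  have D0: "(\<Prod>(i, j)\<in>{..<k} \<times> {k..<k + m}. z i - z j) \<noteq> 0"
  proof -
    have "z i - z j \<noteq> 0" if "i < k" "k \<le> j" "j < k + m" for i j
      using bneg[of i] bpos[of j] that by (auto simp: z_def)
    then show ?thesis by (auto simp: prod_zero_iff)
  qed
  have limz: "((\<lambda>x. X x i) \<longlongrightarrow> z i) \<F>" if "i < k + m" for i
    using lim[of i] that by (simp add: z_def k_def m_def)
  have "((\<lambda>x. laurent_eval (S_poly k m u) (X x) / (\<Prod>(i, j)\<in>{..<k} \<times> {k..<k + m}. X x i - X x j)) \<longlongrightarrow>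
      laurent_eval (S_poly k m u) z / (\<Prod>(i, j)\<in>{..<k} \<times> {k..<k + m}. z i - z j)) \<F>"
    unfolding split_def
    by (intro tendsto_divide tendsto_laurent_eval[OF S_poly_vars] tendsto_prod tendsto_diff limz)
      (use z0 D0 in \<open>auto simp: split_def\<close>)
  moreover have "\<forall>\<^sub>F x in \<F>. laurent_eval (S_poly k m u) (X x) / (\<Prod>(i, j)\<in>{..<k} \<times> {k..<k + m}. X x i - X x j) =
      (\<Sum>i<length b1. X x i powi u / (\<Prod>j\<in>{..<length (b1 @ b2)} - {i}. X x i - X x j))"
  proof -
    have "\<forall>\<^sub>F x in \<F>. \<forall>i\<in>{..<k + m}. X x i \<noteq> 0"
      by (intro eventually_ball_finite ballI finite_lessThan, rule tendsto_imp_eventually_ne)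
        (use limz z0 in auto)
    then show ?thesis using inj
    proof eventually_elim
      case (elim x)
      have inj: "inj_on (X x) {..<k + m}" using elim by (simp add: k_def m_def)
      have "(\<Prod>(i, j)\<in>{..<k} \<times> {k..<k + m}. X x i - X x j) \<noteq> 0"
      proof -
        have "X x i - X x j \<noteq> 0" if "i < k" "k \<le> j" "j < k + m" for i j
          using inj_onD[OF inj, of i j] that by auto
        then show ?thesis by (auto simp: prod_zero_iff)
      qed
      then show ?case using laurent_eval_S_poly[of k m "X x" u] False elim inj
        by (simp add: k_def m_def)
    qed
  qed
  ultimately show ?thesis unfolding S D by (rule Lim_transform_eventually)
qed

lemma nths_eq_map: "nths xs A = map ((!) xs) (filter (\<lambda>i. i \<in> A) [0..<length xs])"
proof -
  have "zip xs [0..<length xs] = map (\<lambda>i. (xs ! i, i)) [0..<length xs]"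
    by (rule nth_equalityI) auto
  then show ?thesis by (simp add: nths_def filter_map o_def)
qed

lemma sum_pairs_symmetric:
  fixes f :: "nat \<Rightarrow> nat \<Rightarrow> 'a :: field_char_0"
  assumes "finite J" and sym: "\<And>j l. j \<in> J \<Longrightarrow> l \<in> J \<Longrightarrow> f j l = f l j"
  shows "(\<Sum>j\<in>J. \<Sum>l\<in>J - {j}. f j l) = 2 * (\<Sum>(j, l) | j \<in> J \<and> l \<in> J \<and> j < l. f j l)"
proof -
  define P where "P = {(j, l). j \<in> J \<and> l \<in> J \<and> j < l}"
  have P: "finite P" unfolding P_def by (rule finite_subset[of _ "J \<times> J"]) (use assms in auto)
  have "(SIGMA j:J. J - {j}) = P \<union> prod.swap ` P"
    by (auto simp: P_def image_iff)
  moreover have "P \<inter> prod.swap ` P = {}" by (auto simp: P_def)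
  moreover have "(\<Sum>j\<in>J. \<Sum>l\<in>J - {j}. f j l) = (\<Sum>(j, l)\<in>(SIGMA j:J. J - {j}). f j l)"
    using assms(1) by (intro sum.Sigma) auto
  moreover have "(\<Sum>(j, l)\<in>prod.swap ` P. f j l) = (\<Sum>(j, l)\<in>P. f j l)"
  proof -
    have "inj_on prod.swap P" by (rule inj_onI) auto
    then have "(\<Sum>(j, l)\<in>prod.swap ` P. f j l) = (\<Sum>(j, l)\<in>P. f l j)"
      by (simp add: sum.reindex split_def)
    also have "\<dots> = (\<Sum>(j, l)\<in>P. f j l)"
      by (intro sum.cong refl) (auto simp: P_def sym)
    finally show ?thesis .
  qed
  ultimately show ?thesis using P by (simp add: sum.union_disjoint P_def)
qed

lemma sum_pairs_mult:
  fixes f :: "nat \<Rightarrow> 'a :: field_char_0"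
  assumes "finite J"
  shows "(\<Sum>j\<in>J. \<Sum>l\<in>J - {j}. f j * f l) = (\<Sum>j\<in>J. f j)\<^sup>2 - (\<Sum>j\<in>J. (f j)\<^sup>2)"
proof -
  have "(\<Sum>j\<in>J. f j)\<^sup>2 = (\<Sum>j\<in>J. \<Sum>l\<in>J. f j * f l)"
    by (simp add: power2_eq_square sum_product)
  also have "\<dots> = (\<Sum>j\<in>J. (f j)\<^sup>2 + (\<Sum>l\<in>J - {j}. f j * f l))"
    using assms by (intro sum.cong refl) (subst sum.remove, auto simp: power2_eq_square)
  finally show ?thesis by (simp add: sum.distrib)
qed

context torus_weights
begin

text \<open>Summands keep their positions in \<open>a\<close>, so that the full vector and the
  vectors with one or two entries deleted are the cases \<open>A = UNIV\<close>,
  \<open>A = - {j}\<close> and \<open>A = - {j, l}\<close> of one statement.\<close>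

lemma S_fun_lim_nths:
  fixes X :: "'e \<Rightarrow> nat \<Rightarrow> complex"
  assumes lim: "\<And>i. i < n \<Longrightarrow> ((\<lambda>x. X x i) \<longlongrightarrow> of_int (a ! i)) \<F>"
    and inj: "\<forall>\<^sub>F x in \<F>. inj_on (X x) {..<n}"
  shows "((\<lambda>x. \<Sum>i\<in>A \<inter> {..<k}. X x i powi u / (\<Prod>j\<in>A \<inter> {..<n} - {i}. X x i - X x j)) \<longlongrightarrow>
    S_fun u (nths a A) / of_int (D_prod (nths a A))) \<F>"
proof -
  define js1 where "js1 = filter (\<lambda>i. i \<in> A) [0..<k]"
  define js where "js = js1 @ filter (\<lambda>i. i \<in> A) [k..<n]"
  define b1 b2 where "b1 = map ((!) a) js1" and "b2 = map ((!) a) (filter (\<lambda>i. i \<in> A) [k..<n])"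
  have upt: "[0..<n] = [0..<k] @ [k..<n]" using k upt_add_eq_append[of 0 k "n - k"] by simp
  have b: "nths a A = b1 @ b2" and len_b: "length (b1 @ b2) = length js" and len_b1: "length b1 = length js1"
    by (simp_all add: nths_eq_map len upt b1_def b2_def js_def js1_def)
  have js: "distinct js" "set js = A \<inter> {..<n}" "distinct js1" "set js1 = A \<inter> {..<k}"
    using k by (auto simp: js_def js1_def)
  have nth_b: "(b1 @ b2) ! i = a ! (js ! i)" if "i < length js" for i
  proof -
    have "b1 @ b2 = map ((!) a) js" by (simp add: b1_def b2_def js_def)
    then show ?thesis using that by simp
  qed
  have js_lt: "js ! i < n" if "i < length js" for i using nth_mem[OF that] js by auto
  have inj_nth: "inj_on ((!) js) {..<length js}" using js(1) by (auto intro: inj_onI simp: nth_eq_iff_index_eq)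
  have img: "(!) js ` {..<length js} = A \<inter> {..<n}" using js(2) by (auto simp: set_conv_nth)
  have "((\<lambda>x. \<Sum>i<length b1. X x (js ! i) powi u /
      (\<Prod>j\<in>{..<length (b1 @ b2)} - {i}. X x (js ! i) - X x (js ! j))) \<longlongrightarrow>
      S_fun u (b1 @ b2) / of_int (D_prod (b1 @ b2))) \<F>"
  proof (rule S_fun_lim)
    show "c < 0" if "c \<in> set b1" for c using that neg by (auto simp: b1_def js1_def)
    show "c > 0" if "c \<in> set b2" for c using that pos by (auto simp: b2_def)
    show "((\<lambda>x. X x (js ! i)) \<longlongrightarrow> of_int ((b1 @ b2) ! i)) \<F>" if "i < length (b1 @ b2)" for i
    proof -
      have i: "i < length js" using that unfolding len_b .
      show ?thesis unfolding nth_b[OF i] by (rule lim[OF js_lt[OF i]])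
    qed
    show "\<forall>\<^sub>F x in \<F>. inj_on (\<lambda>i. X x (js ! i)) {..<length (b1 @ b2)}"
      using inj
    proof eventually_elim
      case (elim x)
      have "inj_on (X x) ((!) js ` {..<length js})"
        unfolding img by (rule inj_on_subset[OF elim]) auto
      then show ?case unfolding len_b using comp_inj_on[OF inj_nth] by (simp add: o_def)
    qed
  qed
  moreover have "(\<Sum>i<length b1. X x (js ! i) powi u /
      (\<Prod>j\<in>{..<length (b1 @ b2)} - {i}. X x (js ! i) - X x (js ! j))) =
      (\<Sum>i\<in>A \<inter> {..<k}. X x i powi u / (\<Prod>j\<in>A \<inter> {..<n} - {i}. X x i - X x j))" for x
  proof -
    define f where "f i = X x i powi u / (\<Prod>j\<in>A \<inter> {..<n} - {i}. X x i - X x j)" for i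
    have "X x (js ! i) powi u / (\<Prod>j\<in>{..<length (b1 @ b2)} - {i}. X x (js ! i) - X x (js ! j)) = f (js1 ! i)"
      if i: "i < length js1" for i
    proof -
      have i': "i < length js" and e: "js1 ! i = js ! i" using i by (simp_all add: js_def nth_append)
      have "bij_betw ((!) js) ({..<length js} - {i}) (A \<inter> {..<n} - {js ! i})"
        unfolding bij_betw_def img[symmetric] using i'
        by (auto intro: inj_on_subset[OF inj_nth] simp: inj_on_image_set_diff[OF inj_nth])
      then have "(\<Prod>j\<in>{..<length js} - {i}. X x (js ! i) - X x (js ! j)) =
          (\<Prod>j\<in>A \<inter> {..<n} - {js ! i}. X x (js ! i) - X x j)"
        by (rule prod.reindex_bij_betw)
      then show ?thesis unfolding f_def e len_b by simp
    qed
    then have "(\<Sum>i<length b1. X x (js ! i) powi u /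
        (\<Prod>j\<in>{..<length (b1 @ b2)} - {i}. X x (js ! i) - X x (js ! j))) = (\<Sum>i<length js1. f (js1 ! i))"
      unfolding len_b1 by (intro sum.cong refl) simp
    also have "\<dots> = (\<Sum>i\<in>A \<inter> {..<k}. f i)"
      by (rule sum.reindex_bij_betw) (use bij_betw_nth[OF js(3) refl js(4)[symmetric]] in simp)
    finally show ?thesis by (simp only: f_def)
  qed
  ultimately show ?thesis unfolding b by simp
qed

lemma zeta_sum_sym: "zeta_sum a j l = zeta_sum a l j"
  by (simp add: zeta_sum_def g2_eq insert_commute conj_commute mult.commute conj_left_commute)

text \<open>The terms free of gcds collapse into power sums of \<open>lin - 1\<close>: the squares
  give \<open>(p2 + 2 p1) / 12\<close>, the ordered pairs \<open>(p1^2 - p2) / 4\<close>, and half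
  of the latter is added. This is the bracket \<open>p1 / 6 + p1^2 / 8 - p2 / 24\<close>.\<close>

lemma G2_eq:
  assumes L0: "\<And>j. j < n \<Longrightarrow> j \<noteq> i \<Longrightarrow> lin c i j \<noteq> 0"
  defines "p1 \<equiv> \<Sum>j\<in>{..<n} - {i}. lin c i j - 1" and "p2 \<equiv> \<Sum>j\<in>{..<n} - {i}. (lin c i j - 1)\<^sup>2"
  shows "G2 c i = 1 / (\<Prod>p\<in>{..<n} - {i}. lin c i p) * (p1 / 6 + p1\<^sup>2 / 8 - p2 / 24) +
    (\<Sum>j\<in>{..<n} - {i}. 1 / (\<Prod>p\<in>{..<n} - {i, j}. lin c i p) *
      (lin c i j * (of_int (g1 a j) ^ 2 - 1) / 12 +
       (of_int (g1 a j) - 1) / 4 * (\<Sum>l\<in>{..<n} - {i, j}. lin c i l - 1))) +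
    (\<Sum>(j, l) | j < l \<and> l < n \<and> j \<noteq> i \<and> l \<noteq> i.
      1 / (\<Prod>p\<in>{..<n} - {i, j, l}. lin c i p) * zeta_sum a j l)"
proof -
  define J where "J = {..<n} - {i}"
  define L where "L = lin c i"
  define Q where "Q A = (\<Prod>p\<in>A. L p)" for A
  have fin: "finite J" by (simp add: J_def)
  have L0': "L j \<noteq> 0" if "j \<in> J" for j using L0 that by (simp add: J_def L_def)
  have J1: "{..<n} - {i, j} = J - {j}" and J2: "{..<n} - {i, j, l} = J - {j, l}" for j l
    by (auto simp: J_def)
  have Q1: "1 / Q (J - {j}) = L j * (1 / Q J)" if "j \<in> J" for j
    using that fin L0'[OF that] by (simp add: Q_def prod.remove[of J j L])
  have Q2: "1 / Q (J - {j, l}) = L j * L l * (1 / Q J)" if "j \<in> J" "l \<in> J - {j}" for j l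
  proof -
    have "J - {j, l} = J - {j} - {l}" by auto
    then have "Q (J - {j}) = L l * Q (J - {j, l})"
      unfolding Q_def using that fin by (simp add: prod.remove[of "J - {j}" l L])
    then have "1 / Q (J - {j, l}) = L l * (1 / Q (J - {j}))" using L0'[of l] that by simp
    then show ?thesis unfolding Q1[OF that(1)] by simp
  qed
  define z where "z = zeta_sum a"
  define g where "g j = (of_int (g1 a j) :: complex)" for j
  have A: "(\<Sum>j\<in>J. 1 / Q (J - {j}) * (((L j)\<^sup>2 - 1) / (12 * L j) + L j * (g j ^ 2 - 1) / 12)) =
      1 / Q J * ((p2 + 2 * p1) / 12) + (\<Sum>j\<in>J. 1 / Q (J - {j}) * (L j * (g j ^ 2 - 1) / 12))"
  proof -
    have "(\<Sum>j\<in>J. 1 / Q (J - {j}) * (((L j)\<^sup>2 - 1) / (12 * L j) + L j * (g j ^ 2 - 1) / 12)) =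
        (\<Sum>j\<in>J. 1 / Q J * (((L j - 1)\<^sup>2 + 2 * (L j - 1)) / 12) +
          1 / Q (J - {j}) * (L j * (g j ^ 2 - 1) / 12))"
    proof (intro sum.cong refl)
      fix j assume j: "j \<in> J"
      have "1 / Q (J - {j}) * (((L j)\<^sup>2 - 1) / (12 * L j)) = 1 / Q J * (((L j - 1)\<^sup>2 + 2 * (L j - 1)) / 12)"
      proof -
        have "(L j)\<^sup>2 - 1 = (L j - 1)\<^sup>2 + 2 * (L j - 1)"
          by (simp add: power2_eq_square algebra_simps)
        moreover have "L j * (1 / Q J) * (K / (12 * L j)) = 1 / Q J * (K / 12)" for K
          using L0'[OF j] by simp
        ultimately show ?thesis unfolding Q1[OF j] by simp
      qed
      then show "1 / Q (J - {j}) * (((L j)\<^sup>2 - 1) / (12 * L j) + L j * (g j ^ 2 - 1) / 12) =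
          1 / Q J * (((L j - 1)\<^sup>2 + 2 * (L j - 1)) / 12) + 1 / Q (J - {j}) * (L j * (g j ^ 2 - 1) / 12)"
        by (simp only: distrib_left)
    qed
    then show ?thesis
      unfolding sum.distrib sum_distrib_left[symmetric] sum_divide_distrib[symmetric]
      by (simp only: p1_def p2_def J_def L_def)
  qed
  have split: "(\<Sum>j\<in>J. \<Sum>l\<in>J - {j}. 1 / Q (J - {j, l}) *
      ((L j - 1) * (L l - 1) / (4 * L j * L l) + (L j - 1) / (2 * L j) * ((g l - 1) / 2) +
       (L l - 1) / (2 * L l) * ((g j - 1) / 2) + z j l)) =
      (\<Sum>j\<in>J. \<Sum>l\<in>J - {j}. 1 / (4 * Q J) * ((L j - 1) * (L l - 1))) +
      (\<Sum>j\<in>J. \<Sum>l\<in>J - {j}. 1 / Q (J - {j, l}) * ((L j - 1) / (2 * L j) * ((g l - 1) / 2) +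
        (L l - 1) / (2 * L l) * ((g j - 1) / 2))) +
      (\<Sum>j\<in>J. \<Sum>l\<in>J - {j}. 1 / Q (J - {j, l}) * z j l)"
    unfolding sum.distrib[symmetric]
  proof (intro sum.cong refl)
    fix j l assume jl: "j \<in> J" "l \<in> J - {j}"
    have "1 / Q (J - {j, l}) * ((L j - 1) * (L l - 1) / (4 * L j * L l)) =
        1 / (4 * Q J) * ((L j - 1) * (L l - 1))"
      unfolding Q2[OF jl] using L0'[of j] L0'[of l] jl by simp
    then show "1 / Q (J - {j, l}) * ((L j - 1) * (L l - 1) / (4 * L j * L l) +
        (L j - 1) / (2 * L j) * ((g l - 1) / 2) + (L l - 1) / (2 * L l) * ((g j - 1) / 2) + z j l) =
        1 / (4 * Q J) * ((L j - 1) * (L l - 1)) + 1 / Q (J - {j, l}) *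
        ((L j - 1) / (2 * L j) * ((g l - 1) / 2) + (L l - 1) / (2 * L l) * ((g j - 1) / 2)) +
        1 / Q (J - {j, l}) * z j l"
      by (simp only: distrib_left add.assoc)
  qed
  have B1: "(\<Sum>j\<in>J. \<Sum>l\<in>J - {j}. 1 / (4 * Q J) * ((L j - 1) * (L l - 1))) = 1 / Q J * ((p1\<^sup>2 - p2) / 4)"
  proof -
    have "(\<Sum>j\<in>J. \<Sum>l\<in>J - {j}. 1 / (4 * Q J) * ((L j - 1) * (L l - 1))) =
        1 / (4 * Q J) * (\<Sum>j\<in>J. \<Sum>l\<in>J - {j}. (L j - 1) * (L l - 1))"
      by (simp only: sum_distrib_left)
    also have "(\<Sum>j\<in>J. \<Sum>l\<in>J - {j}. (L j - 1) * (L l - 1)) = p1\<^sup>2 - p2"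
      unfolding sum_pairs_mult[OF fin] by (simp only: p1_def p2_def J_def L_def)
    finally show ?thesis by simp
  qed
  have B2: "(\<Sum>j\<in>J. \<Sum>l\<in>J - {j}. 1 / Q (J - {j, l}) * ((L j - 1) / (2 * L j) * ((g l - 1) / 2) +
        (L l - 1) / (2 * L l) * ((g j - 1) / 2))) =
      2 * (\<Sum>j\<in>J. 1 / Q (J - {j}) * ((g j - 1) / 4 * (\<Sum>l\<in>J - {j}. L l - 1)))"
  proof -
    define h where "h j l = 1 / Q (J - {j, l}) * ((L l - 1) / (2 * L l) * ((g j - 1) / 2))" for j l
    have swap: "(\<Sum>j\<in>J. \<Sum>l\<in>J - {j}. h l j) = (\<Sum>j\<in>J. \<Sum>l\<in>J - {j}. h j l)"
    proof -
      have "(\<Sum>j\<in>J. \<Sum>l\<in>J - {j}. h l j) = (\<Sum>j\<in>J. \<Sum>l\<in>J. if l \<noteq> j then h l j else 0)"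
        using fin by (intro sum.cong refl sum.mono_neutral_cong_left) auto
      also have "\<dots> = (\<Sum>l\<in>J. \<Sum>j\<in>J. if l \<noteq> j then h l j else 0)" by (rule sum.swap)
      also have "\<dots> = (\<Sum>l\<in>J. \<Sum>j\<in>J - {l}. h l j)"
        using fin by (intro sum.cong refl sum.mono_neutral_cong_right) auto
      finally show ?thesis .
    qed
    have "(\<Sum>j\<in>J. \<Sum>l\<in>J - {j}. 1 / Q (J - {j, l}) * ((L j - 1) / (2 * L j) * ((g l - 1) / 2) +
        (L l - 1) / (2 * L l) * ((g j - 1) / 2))) = (\<Sum>j\<in>J. \<Sum>l\<in>J - {j}. h l j + h j l)"
      by (intro sum.cong refl) (simp only: h_def distrib_left insert_commute)
    also have "\<dots> = 2 * (\<Sum>j\<in>J. \<Sum>l\<in>J - {j}. h j l)"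
      unfolding sum.distrib swap by simp
    also have "(\<Sum>j\<in>J. \<Sum>l\<in>J - {j}. h j l) =
        (\<Sum>j\<in>J. 1 / Q (J - {j}) * ((g j - 1) / 4 * (\<Sum>l\<in>J - {j}. L l - 1)))"
      unfolding sum_distrib_left
    proof (intro sum.cong refl)
      fix j l assume jl: "j \<in> J" "l \<in> J - {j}"
      show "h j l = 1 / Q (J - {j}) * ((g j - 1) / 4 * (L l - 1))"
        unfolding h_def Q2[OF jl] Q1[OF jl(1)] using L0'[of l] jl by simp
    qed
    finally show ?thesis .
  qed
  have B3: "(\<Sum>j\<in>J. \<Sum>l\<in>J - {j}. 1 / Q (J - {j, l}) * z j l) =
      2 * (\<Sum>(j, l) | j < l \<and> l < n \<and> j \<noteq> i \<and> l \<noteq> i. 1 / Q (J - {j, l}) * z j l)"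
  proof -
    have "{(j, l). j \<in> J \<and> l \<in> J \<and> j < l} = {(j, l). j < l \<and> l < n \<and> j \<noteq> i \<and> l \<noteq> i}"
      by (auto simp: J_def)
    then show ?thesis
      using sum_pairs_symmetric[OF fin, of "\<lambda>j l. 1 / Q (J - {j, l}) * z j l"]
      by (simp add: z_def zeta_sum_sym insert_commute)
  qed
  have "G2 c i = (\<Sum>j\<in>J. 1 / Q (J - {j}) * (((L j)\<^sup>2 - 1) / (12 * L j) + L j * (g j ^ 2 - 1) / 12)) +
    (\<Sum>j\<in>J. \<Sum>l\<in>J - {j}. 1 / Q (J - {j, l}) *
      ((L j - 1) * (L l - 1) / (4 * L j * L l) + (L j - 1) / (2 * L j) * ((g l - 1) / 2) +
       (L l - 1) / (2 * L l) * ((g j - 1) / 2) + z j l)) / 2"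
    unfolding G2_def J1 J2 by (simp only: J_def L_def Q_def g_def z_def)
  also have "\<dots> = 1 / Q J * (p1 / 6 + p1\<^sup>2 / 8 - p2 / 24) +
    (\<Sum>j\<in>J. 1 / Q (J - {j}) * (L j * (g j ^ 2 - 1) / 12 + (g j - 1) / 4 * (\<Sum>l\<in>J - {j}. L l - 1))) +
    (\<Sum>(j, l) | j < l \<and> l < n \<and> j \<noteq> i \<and> l \<noteq> i. 1 / Q (J - {j, l}) * z j l)"
  proof -
    have C: "(\<Sum>j\<in>J. 1 / Q (J - {j}) * (L j * (g j ^ 2 - 1) / 12 + (g j - 1) / 4 * (\<Sum>l\<in>J - {j}. L l - 1))) =
        (\<Sum>j\<in>J. 1 / Q (J - {j}) * (L j * (g j ^ 2 - 1) / 12)) +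
        (\<Sum>j\<in>J. 1 / Q (J - {j}) * ((g j - 1) / 4 * (\<Sum>l\<in>J - {j}. L l - 1)))"
      by (simp only: distrib_left sum.distrib)
    have "K * ((p2 + 2 * p1) / 12) + SA + (K * ((p1\<^sup>2 - p2) / 4) + 2 * SB + 2 * SC) / 2 =
        K * (p1 / 6 + p1\<^sup>2 / 8 - p2 / 24) + (SA + SB) + SC" for K SA SB SC
      by (simp add: field_simps)
    then show ?thesis unfolding A split B1 B2 B3 C .
  qed
  finally show ?thesis unfolding J1 J2 by (simp only: J_def L_def Q_def g_def z_def)
qed

end

section \<open>The two formulas\<close>

lemma elem_sym_1: "elem_sym 1 b = sum_list b"
proof -
  have "{I. I \<subseteq> {..<length b} \<and> card I = 1} = (\<lambda>i. {i}) ` {..<length b}"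
    by (auto simp: card_1_singleton_iff)
  then have "elem_sym 1 b = (\<Sum>I\<in>(\<lambda>i. {i}) ` {..<length b}. \<Prod>i\<in>I. b ! i)"
    by (simp add: elem_sym_def)
  also have "\<dots> = (\<Sum>i<length b. b ! i)"
    by (subst sum.reindex) (auto intro: inj_onI)
  finally show ?thesis by (simp add: sum_list_sum_nth atLeast0LessThan)
qed

lemma elem_sym_2: "elem_sym 2 b = (\<Sum>(j, l) | j < l \<and> l < length b. b ! j * b ! l)"
proof -
  define P where "P = {(j, l). j < l \<and> l < length b}"
  have "{I. I \<subseteq> {..<length b} \<and> card I = 2} = (\<lambda>(j, l). {j, l}) ` P" (is "?A = ?B")
  proof (intro subset_antisym subsetI)
    fix I assume "I \<in> ?A"
    then obtain j l where I: "I = {j, l}" "j \<noteq> l" "j < length b" "l < length b"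
      by (auto simp: card_2_iff)
    show "I \<in> ?B"
    proof (cases "j < l")
      case True
      then have "(j, l) \<in> P" using I by (simp add: P_def)
      then show ?thesis using I(1) by (intro image_eqI[of _ _ "(j, l)"]) auto
    next
      case False
      then have "(l, j) \<in> P" using I by (simp add: P_def)
      then show ?thesis using I(1) by (intro image_eqI[of _ _ "(l, j)"]) auto
    qed
  qed (auto simp: P_def)
  moreover have "inj_on (\<lambda>(j, l). {j, l}) P"
    by (rule inj_onI) (auto simp: P_def doubleton_eq_iff)
  ultimately have "elem_sym 2 b = (\<Sum>(j, l)\<in>P. \<Prod>i\<in>{j, l}. b ! i)"
    by (simp add: elem_sym_def sum.reindex split_def)
  also have "\<dots> = (\<Sum>(j, l)\<in>P. b ! j * b ! l)"
    by (intro sum.cong refl) (auto simp: P_def)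
  finally show ?thesis by (simp add: P_def)
qed

context torus_weights
begin

section \<open>Perturbed weights\<close>

definition ratio :: "(nat \<Rightarrow> complex) \<Rightarrow> nat \<Rightarrow> complex" where
  "ratio c j = of_int (a ! j) / c j"

definition admissible :: "(nat \<Rightarrow> complex) \<Rightarrow> bool" where
  "admissible c \<longleftrightarrow> (\<forall>j<n. c j \<noteq> 0) \<and> (\<forall>i<k. \<forall>j<n. i \<noteq> j \<longrightarrow> ratio c i \<noteq> ratio c j)"

text \<open>Two readings of one exponent. The first is affine in \<open>1 / ratio c i\<close>, so
  brackets become polynomials in it; the second turns products of exponents into the denominators of
  a Lagrange sum.\<close>

lemma lin_ratio:
  assumes "i < n" "j < n" "c i \<noteq> 0" "c j \<noteq> 0"
  shows "lin c i j = c j - of_int (a ! j) / ratio c i"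
    and "lin c i j = c j * (ratio c i - ratio c j) / ratio c i"
  using assms a_nonzero[of i] by (simp_all add: lin_def ratio_def field_simps)

lemma ratio_nonzero: "i < n \<Longrightarrow> c i \<noteq> 0 \<Longrightarrow> ratio c i \<noteq> 0"
  using a_nonzero by (simp add: ratio_def)

lemma admissible_generic: "admissible c \<Longrightarrow> generic c"
  unfolding generic_def
proof (intro allI impI)
  fix i j assume "admissible c" "i < k" "j < n" "j \<noteq> i"
  moreover then have "i < n" using k by simp
  ultimately show "lin c i j \<noteq> 0"
    by (simp add: lin_ratio(2) admissible_def ratio_nonzero)
qed

text \<open>The summand with index \<open>i\<close> of the sum that tends to
  \<open>S_fun u / D_prod\<close>, at the perturbed weights with positions in
  \<open>A\<close>.\<close>

definition res :: "(nat \<Rightarrow> complex) \<Rightarrow> nat \<Rightarrow> int \<Rightarrow> nat set \<Rightarrow> complex" where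
  "res c i u A = ratio c i powi u / (\<Prod>p\<in>A \<inter> {..<n} - {i}. ratio c i - ratio c p)"

text \<open>With \<open>x = ratio c i\<close>, every \<open>lin c i p\<close> carries a factor
  \<open>1 / x\<close>, which yields \<open>card - 1\<close> powers of \<open>x\<close>. One of them
  is lost to \<open>w i = - (c i * x)\<close>, which also brings in the sign.\<close>

lemma inverse_prod_lin:
  assumes i: "i < k" "i \<in> A" and c0: "\<And>j. j < n \<Longrightarrow> c j \<noteq> 0"
  shows "1 / of_nat (w i) * (1 / (\<Prod>p\<in>A \<inter> {..<n} - {i}. lin c i p)) =
    - (1 / (\<Prod>p\<in>A \<inter> {..<n}. c p)) * res c i (int (card (A \<inter> {..<n})) - 2) A"
proof -
  define B where "B = A \<inter> {..<n}"
  define x where "x = ratio c i"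
  have inn: "i < n" using i k by simp
  have iB: "i \<in> B" "finite B" using i inn by (auto simp: B_def)
  have x0: "x \<noteq> 0" unfolding x_def using ratio_nonzero[of i c] c0[of i] inn by simp
  have "(\<Prod>p\<in>B - {i}. lin c i p) = (\<Prod>p\<in>B - {i}. c p * (x - ratio c p) / x)"
    unfolding x_def by (intro prod.cong refl lin_ratio) (use inn c0 in \<open>auto simp: B_def\<close>)
  also have "\<dots> = (\<Prod>p\<in>B - {i}. c p) * (\<Prod>p\<in>B - {i}. x - ratio c p) / x ^ (card B - 1)"
    using iB by (simp add: prod.distrib prod_dividef)
  finally have l: "(\<Prod>p\<in>B - {i}. lin c i p) =
      (\<Prod>p\<in>B - {i}. c p) * (\<Prod>p\<in>B - {i}. x - ratio c p) / x ^ (card B - 1)" .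
  have w: "of_nat (w i) = - (c i * x)"
    using c0[of i] inn by (simp add: x_def ratio_def w_neg i)
  have C: "(\<Prod>p\<in>B. c p) = c i * (\<Prod>p\<in>B - {i}. c p)" using iB by (simp add: prod.remove)
  have "card B \<ge> 1" using iB by (metis One_nat_def Suc_leI card_gt_0_iff empty_iff)
  then have "int (card B) - 2 = int (card B - 1) + - 1" by simp
  then have pw: "x powi (int (card B) - 2) = x ^ (card B - 1) * inverse x"
    using x0 by (simp only: power_int_add power_int_minus power_int_1_right power_int_of_nat simp_thms)
  have "1 / (- (c' * x)) * (1 / (C' * P / X)) = - (1 / (c' * C')) * (X * inverse x / P)" for c' C' P X :: complex
    by (simp add: divide_inverse mult_ac)
  then show ?thesis unfolding res_def B_def[symmetric] x_def[symmetric] l w C pw .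
qed

lemma G2_res:
  assumes adm: "admissible c" and i: "i < k"
  defines "p1 \<equiv> \<Sum>j\<in>{..<n} - {i}. lin c i j - 1" and "p2 \<equiv> \<Sum>j\<in>{..<n} - {i}. (lin c i j - 1)\<^sup>2"
  shows "1 / of_nat (w i) * G2 c i =
    - (1 / (\<Prod>p\<in>UNIV \<inter> {..<n}. c p)) * res c i (int n - 2) UNIV * (p1 / 6 + p1\<^sup>2 / 8 - p2 / 24) +
    (\<Sum>j\<in>{..<n} - {i}. - (1 / (\<Prod>p\<in>- {j} \<inter> {..<n}. c p)) * res c i (int n - 3) (- {j}) *
      (lin c i j * (of_int (g1 a j) ^ 2 - 1) / 12 +
       (of_int (g1 a j) - 1) / 4 * (\<Sum>l\<in>{..<n} - {i, j}. lin c i l - 1))) +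
    (\<Sum>(j, l) | j < l \<and> l < n \<and> j \<noteq> i \<and> l \<noteq> i.
      - (1 / (\<Prod>p\<in>- {j, l} \<inter> {..<n}. c p)) * res c i (int n - 4) (- {j, l}) * zeta_sum a j l)"
proof -
  have c0: "c j \<noteq> 0" if "j < n" for j using adm that by (simp add: admissible_def)
  have L0: "lin c i j \<noteq> 0" if "j < n" "j \<noteq> i" for j
    using admissible_generic[OF adm] i that by (simp add: generic_def)
  have N0: "1 / of_nat (w i) * (1 / (\<Prod>p\<in>{..<n} - {i}. lin c i p)) =
      - (1 / (\<Prod>p\<in>UNIV \<inter> {..<n}. c p)) * res c i (int n - 2) UNIV"
    using inverse_prod_lin[OF i UNIV_I c0] by simp
  have N1: "1 / of_nat (w i) * (1 / (\<Prod>p\<in>{..<n} - {i, j}. lin c i p)) =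
      - (1 / (\<Prod>p\<in>- {j} \<inter> {..<n}. c p)) * res c i (int n - 3) (- {j})" if j: "j < n" "j \<noteq> i" for j
  proof -
    have "- {j} \<inter> {..<n} = {..<n} - {j}" by auto
    then have "card (- {j} \<inter> {..<n}) = n - 1" using j by simp
    then have "int (card (- {j} \<inter> {..<n})) - 2 = int n - 3" using j by simp
    moreover have "- {j} \<inter> {..<n} - {i} = {..<n} - {i, j}" by auto
    moreover have "i \<in> - {j}" using j by simp
    ultimately show ?thesis using inverse_prod_lin[OF i _ c0, of "- {j}"] by (simp only:)
  qed
  have N2: "1 / of_nat (w i) * (1 / (\<Prod>p\<in>{..<n} - {i, j, l}. lin c i p)) =
      - (1 / (\<Prod>p\<in>- {j, l} \<inter> {..<n}. c p)) * res c i (int n - 4) (- {j, l})"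
    if j: "j < l" "l < n" "j \<noteq> i" "l \<noteq> i" for j l
  proof -
    have "- {j, l} \<inter> {..<n} = {..<n} - {j, l}" by auto
    then have "card (- {j, l} \<inter> {..<n}) = n - 2" using j by (simp add: card_Diff_subset)
    moreover have "n \<ge> 2" using j by simp
    ultimately have "int (card (- {j, l} \<inter> {..<n})) - 2 = int n - 4" by simp
    moreover have "- {j, l} \<inter> {..<n} - {i} = {..<n} - {i, j, l}" by auto
    moreover have "i \<in> - {j, l}" using j by simp
    ultimately show ?thesis using inverse_prod_lin[OF i _ c0, of "- {j, l}"] by (simp only:)
  qed
  define W where "W = (1 / of_nat (w i) :: complex)"
  define br where "br = p1 / 6 + p1\<^sup>2 / 8 - p2 / 24"
  define H where "H j = lin c i j * (of_int (g1 a j) ^ 2 - 1) / 12 +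
       (of_int (g1 a j) - 1) / 4 * (\<Sum>l\<in>{..<n} - {i, j}. lin c i l - 1)" for j
  have G: "G2 c i = 1 / (\<Prod>p\<in>{..<n} - {i}. lin c i p) * br +
    (\<Sum>j\<in>{..<n} - {i}. 1 / (\<Prod>p\<in>{..<n} - {i, j}. lin c i p) * H j) +
    (\<Sum>(j, l) | j < l \<and> l < n \<and> j \<noteq> i \<and> l \<noteq> i.
      1 / (\<Prod>p\<in>{..<n} - {i, j, l}. lin c i p) * zeta_sum a j l)"
    unfolding br_def H_def p1_def p2_def by (rule G2_eq[OF L0])
  have "W * G2 c i = W * (1 / (\<Prod>p\<in>{..<n} - {i}. lin c i p)) * br +
    (\<Sum>j\<in>{..<n} - {i}. W * (1 / (\<Prod>p\<in>{..<n} - {i, j}. lin c i p)) * H j) +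
    (\<Sum>(j, l) | j < l \<and> l < n \<and> j \<noteq> i \<and> l \<noteq> i.
      W * (1 / (\<Prod>p\<in>{..<n} - {i, j, l}. lin c i p)) * zeta_sum a j l)"
    unfolding G by (simp only: distrib_left sum_distrib_left mult.assoc split_def)
  also have "\<dots> = - (1 / (\<Prod>p\<in>UNIV \<inter> {..<n}. c p)) * res c i (int n - 2) UNIV * br +
    (\<Sum>j\<in>{..<n} - {i}. - (1 / (\<Prod>p\<in>- {j} \<inter> {..<n}. c p)) * res c i (int n - 3) (- {j}) * H j) +
    (\<Sum>(j, l) | j < l \<and> l < n \<and> j \<noteq> i \<and> l \<noteq> i.
      - (1 / (\<Prod>p\<in>- {j, l} \<inter> {..<n}. c p)) * res c i (int n - 4) (- {j, l}) * zeta_sum a j l)"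
    unfolding N0[folded W_def]
  proof (intro arg_cong2[where f = "(+)"] refl sum.cong)
    fix j assume "j \<in> {..<n} - {i}"
    then have "j < n" "j \<noteq> i" by auto
    from N1[OF this, folded W_def]
    show "W * (1 / (\<Prod>p\<in>{..<n} - {i, j}. lin c i p)) * H j =
        - (1 / (\<Prod>p\<in>- {j} \<inter> {..<n}. c p)) * res c i (int n - 3) (- {j}) * H j"
      by (simp only:)
  next
    fix q assume "q \<in> {(j, l). j < l \<and> l < n \<and> j \<noteq> i \<and> l \<noteq> i}"
    then obtain j l where q: "q = (j, l)" and jl: "j < l" "l < n" "j \<noteq> i" "l \<noteq> i" by auto
    from N2[OF jl, folded W_def]
    show "(case q of (j, l) \<Rightarrow> W * (1 / (\<Prod>p\<in>{..<n} - {i, j, l}. lin c i p)) * zeta_sum a j l) =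
        (case q of (j, l) \<Rightarrow> - (1 / (\<Prod>p\<in>- {j, l} \<inter> {..<n}. c p)) *
          res c i (int n - 4) (- {j, l}) * zeta_sum a j l)"
      unfolding q by (simp only: prod.case)
  qed
  finally show ?thesis unfolding W_def br_def H_def .
qed

lemma finite_ordered_pairs: "finite {(j, l). j < l \<and> l < n \<and> P j l}"
  by (rule finite_subset[of _ "{..<n} \<times> {..<n}"]) auto

text \<open>Distinct negative weights make the unperturbed choice \<open>c = 1\<close> generic
  already. The limit is then that of a constant sequence, and the sum over the poles is itself the
  coefficient.\<close>

lemma gamma_2_distinct:
  assumes gcd: "Gcd (set a) = 1" and dist: "\<And>i j. i < k \<Longrightarrow> j < k \<Longrightarrow> i \<noteq> j \<Longrightarrow> a ! i \<noteq> a ! j"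
  shows "gamma_coeff 2 a =
    (\<Sum>i<k. of_int (a ! i) powi (int n - 4) / (12 * (\<Prod>j\<in>{..<n} - {i}. of_int (a ! i - a ! j))) *
       ((\<Sum>j\<in>{..<n} - {i}. of_int ((2 * a ! i - a ! j) * a ! j))
         - 3 * (\<Sum>(j, l) | j < l \<and> l < n \<and> j \<noteq> i \<and> l \<noteq> i. of_int (a ! j * a ! l))))
    + (\<Sum>i<k. \<Sum>j\<in>{..<n} - {i}.
         (1 - of_int (g1 a j) ^ 2) * of_int (a ! i) powi (int n - 4) * of_int (a ! i - a ! j)
           / (12 * (\<Prod>l\<in>{..<n} - {i, j}. of_int (a ! i - a ! l)))
         + (of_int (g1 a j) - 1) / 2 *
           (\<Sum>l\<in>{..<n} - {i, j}. of_int (a ! i) powi (int n - 4) * of_int (a ! l)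
              / (2 * (\<Prod>p\<in>{..<n} - {i, j}. of_int (a ! i - a ! p)))))
    + (\<Sum>i<k. \<Sum>(j, l) | j < l \<and> l < n \<and> j \<noteq> i \<and> l \<noteq> i.
         - (of_int (a ! i) powi (int n - 4)) / (\<Prod>p\<in>{..<n} - {i, j, l}. of_int (a ! i - a ! p)) *
           zeta_sum a j l)"
proof -
  define one where "one = (\<lambda>_ :: nat. 1 :: complex)"
  have ratio1: "ratio one j = of_int (a ! j)" for j by (simp add: ratio_def one_def)
  have adm: "admissible one"
    unfolding admissible_def ratio1
  proof (intro conjI allI impI)
    fix i j assume "i < k" "j < n" "i \<noteq> j"
    then have "a ! i \<noteq> a ! j" using dist[of i j] neg[of i] pos[of j] by (cases "j < k") auto
    then show "(of_int (a ! i) :: complex) \<noteq> of_int (a ! j)" by simp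
  qed (simp add: one_def)
  have "((\<lambda>_ :: nat. fps_nth (Phi one) 2) \<longlongrightarrow> gamma_coeff 2 a) sequentially"
    by (rule gamma_2_lim) (simp_all add: one_def admissible_generic[OF adm, unfolded one_def])
  then have "gamma_coeff 2 a = fps_nth (Phi one) 2" by (simp add: LIMSEQ_const_iff)
  also have "\<dots> = (\<Sum>i<k. 1 / of_nat (w i) * G2 one i)"
    by (rule Phi_2[OF admissible_generic[OF adm] gcd])
  also have "\<dots> = (\<Sum>i<k.
      of_int (a ! i) powi (int n - 4) / (12 * (\<Prod>j\<in>{..<n} - {i}. of_int (a ! i - a ! j))) *
       ((\<Sum>j\<in>{..<n} - {i}. of_int ((2 * a ! i - a ! j) * a ! j))
         - 3 * (\<Sum>(j, l) | j < l \<and> l < n \<and> j \<noteq> i \<and> l \<noteq> i. of_int (a ! j * a ! l)))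
      + (\<Sum>j\<in>{..<n} - {i}.
         (1 - of_int (g1 a j) ^ 2) * of_int (a ! i) powi (int n - 4) * of_int (a ! i - a ! j)
           / (12 * (\<Prod>l\<in>{..<n} - {i, j}. of_int (a ! i - a ! l)))
         + (of_int (g1 a j) - 1) / 2 *
           (\<Sum>l\<in>{..<n} - {i, j}. of_int (a ! i) powi (int n - 4) * of_int (a ! l)
              / (2 * (\<Prod>p\<in>{..<n} - {i, j}. of_int (a ! i - a ! p)))))
      + (\<Sum>(j, l) | j < l \<and> l < n \<and> j \<noteq> i \<and> l \<noteq> i.
         - (of_int (a ! i) powi (int n - 4)) / (\<Prod>p\<in>{..<n} - {i, j, l}. of_int (a ! i - a ! p)) *
           zeta_sum a j l))"
  proof (rule sum.cong[OF refl])
    fix i assume "i \<in> {..<k}"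
    then have i: "i < k" "i < n" using k by auto
    define x where "x = (of_int (a ! i) :: complex)"
    define y where "y = x powi (int n - 4)"
    define b where "b j = (of_int (a ! j) :: complex)" for j
    have x0: "x \<noteq> 0" using a_nonzero[OF i(2)] by (simp add: x_def)
    have lin1: "lin one i j = (x - b j) / x" if "j < n" for j
      using x0 by (simp add: lin_def one_def x_def b_def diff_divide_distrib)
    have lin2: "lin one i j - 1 = - (b j / x)" if "j < n" for j
      using x0 by (simp add: lin_def one_def x_def b_def)
    have pw: "x powi (int n - 2) = y * x\<^sup>2" "x powi (int n - 3) = y * x"
    proof -
      have "int n - 2 = int n - 4 + int 2" "int n - 3 = int n - 4 + int 1" by simp_all
      then show "x powi (int n - 2) = y * x\<^sup>2" "x powi (int n - 3) = y * x"
        unfolding y_def using x0 by (simp_all only: power_int_add power_int_of_nat power_one_right simp_thms)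
    qed
    have prod1: "(\<Prod>p\<in>A. one p) = 1" for A by (simp add: one_def)
    have res1: "res one i u A = x powi u / (\<Prod>p\<in>A \<inter> {..<n} - {i}. of_int (a ! i - a ! p))" for u A
      by (simp add: res_def ratio1 x_def)
    have set1: "UNIV \<inter> {..<n} - {i} = {..<n} - {i}" "- {j} \<inter> {..<n} - {i} = {..<n} - {i, j}"
      "- {j, l} \<inter> {..<n} - {i} = {..<n} - {i, j, l}" for j l by auto
    define J where "J = {..<n} - {i}"
    define E where "E = (\<Sum>j\<in>J. b j)"
    define Q where "Q = (\<Sum>j\<in>J. (b j)\<^sup>2)"
    have P1: "(\<Sum>j\<in>J. lin one i j - 1) = - (E / x)"
      unfolding E_def sum_divide_distrib sum_negf[symmetric] by (intro sum.cong refl lin2) (simp add: J_def)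
    have P2: "(\<Sum>j\<in>J. (lin one i j - 1)\<^sup>2) = Q / x\<^sup>2"
    proof -
      have "(\<Sum>j\<in>J. (lin one i j - 1)\<^sup>2) = (\<Sum>j\<in>J. (b j)\<^sup>2 / x\<^sup>2)"
        by (intro sum.cong refl) (simp add: lin2 J_def power_divide)
      then show ?thesis by (simp add: Q_def sum_divide_distrib)
    qed
    have R1: "(\<Sum>j\<in>J. of_int ((2 * a ! i - a ! j) * a ! j)) = 2 * x * E - Q"
      by (simp add: E_def Q_def x_def b_def sum_distrib_left sum_subtractf[symmetric] algebra_simps power2_eq_square)
    have R2: "(\<Sum>(j, l) | j < l \<and> l < n \<and> j \<noteq> i \<and> l \<noteq> i. of_int (a ! j * a ! l)) = (E\<^sup>2 - Q) / 2"
    proof -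
      have "{(j, l). j \<in> J \<and> l \<in> J \<and> j < l} = {(j, l). j < l \<and> l < n \<and> j \<noteq> i \<and> l \<noteq> i}"
        by (auto simp: J_def)
      then have "(\<Sum>j\<in>J. \<Sum>l\<in>J - {j}. b j * b l) =
          2 * (\<Sum>(j, l) | j < l \<and> l < n \<and> j \<noteq> i \<and> l \<noteq> i. b j * b l)"
        using sum_pairs_symmetric[of J "\<lambda>j l. b j * b l"] by (simp add: J_def mult.commute)
      moreover have "(\<Sum>j\<in>J. \<Sum>l\<in>J - {j}. b j * b l) = E\<^sup>2 - Q"
        unfolding E_def Q_def by (rule sum_pairs_mult) (simp add: J_def)
      ultimately have "(\<Sum>(j, l) | j < l \<and> l < n \<and> j \<noteq> i \<and> l \<noteq> i. b j * b l) = (E\<^sup>2 - Q) / 2"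
        by (simp only: eq_divide_eq mult.commute) simp
      then show ?thesis by (simp only: b_def of_int_mult)
    qed
    \<comment> \<open>At \<open>c = 1\<close> the numbers \<open>lin - 1\<close> are
      \<open>- b j / x\<close>. The bracket is therefore turned into a polynomial in
      \<open>x\<close>, \<open>E\<close> and \<open>Q\<close> by \<open>x^2\<close>, the surplus of
      the exponent \<open>n - 2\<close> over \<open>n - 4\<close>.\<close>
    have alg: "- (1 / 1) * (y * x\<^sup>2 / D) * (- (E / x) / 6 + (- (E / x))\<^sup>2 / 8 - Q / x\<^sup>2 / 24) =
        y / (12 * D) * (2 * x * E - Q - 3 * ((E\<^sup>2 - Q) / 2))" for D
    proof -
      have "x\<^sup>2 * (- (E / x) / 6 + (- (E / x))\<^sup>2 / 8 - Q / x\<^sup>2 / 24) = - (x * E / 6) + E\<^sup>2 / 8 - Q / 24"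
        using x0 by (simp add: field_simps power2_eq_square)
      also have "\<dots> = - ((2 * x * E - Q - 3 * ((E\<^sup>2 - Q) / 2)) / 12)" by (simp add: field_simps)
      finally have "x\<^sup>2 * (- (E / x) / 6 + (- (E / x))\<^sup>2 / 8 - Q / x\<^sup>2 / 24) =
          - ((2 * x * E - Q - 3 * ((E\<^sup>2 - Q) / 2)) / 12)" .
      moreover have "- (1 / 1) * (y * x\<^sup>2 / D) * K = - (y / D) * (x\<^sup>2 * K)" for K by simp
      moreover have "- (y / D) * - (M / 12) = y / (12 * D) * M" for M by simp
      ultimately show ?thesis by (simp only:)
    qed
    show "1 / of_nat (w i) * G2 one i =
      of_int (a ! i) powi (int n - 4) / (12 * (\<Prod>j\<in>{..<n} - {i}. of_int (a ! i - a ! j))) *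
       ((\<Sum>j\<in>{..<n} - {i}. of_int ((2 * a ! i - a ! j) * a ! j))
         - 3 * (\<Sum>(j, l) | j < l \<and> l < n \<and> j \<noteq> i \<and> l \<noteq> i. of_int (a ! j * a ! l)))
      + (\<Sum>j\<in>{..<n} - {i}.
         (1 - of_int (g1 a j) ^ 2) * of_int (a ! i) powi (int n - 4) * of_int (a ! i - a ! j)
           / (12 * (\<Prod>l\<in>{..<n} - {i, j}. of_int (a ! i - a ! l)))
         + (of_int (g1 a j) - 1) / 2 *
           (\<Sum>l\<in>{..<n} - {i, j}. of_int (a ! i) powi (int n - 4) * of_int (a ! l)
              / (2 * (\<Prod>p\<in>{..<n} - {i, j}. of_int (a ! i - a ! p)))))
      + (\<Sum>(j, l) | j < l \<and> l < n \<and> j \<noteq> i \<and> l \<noteq> i.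
         - (of_int (a ! i) powi (int n - 4)) / (\<Prod>p\<in>{..<n} - {i, j, l}. of_int (a ! i - a ! p)) *
           zeta_sum a j l)"
      unfolding G2_res[OF adm i(1)] prod1 res1 set1 x_def[symmetric] pw y_def[symmetric]
    proof (intro arg_cong2[where f = "(+)"] sum.cong[OF refl])
      show "- (1 / 1) * (y * x\<^sup>2 / (\<Prod>p\<in>{..<n} - {i}. of_int (a ! i - a ! p))) *
        ((\<Sum>j\<in>{..<n} - {i}. lin one i j - 1) / 6 + (\<Sum>j\<in>{..<n} - {i}. lin one i j - 1)\<^sup>2 / 8 -
         (\<Sum>j\<in>{..<n} - {i}. (lin one i j - 1)\<^sup>2) / 24) =
        y / (12 * (\<Prod>j\<in>{..<n} - {i}. of_int (a ! i - a ! j))) *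
       ((\<Sum>j\<in>{..<n} - {i}. of_int ((2 * a ! i - a ! j) * a ! j))
         - 3 * (\<Sum>(j, l) | j < l \<and> l < n \<and> j \<noteq> i \<and> l \<noteq> i. of_int (a ! j * a ! l)))"
        unfolding J_def[symmetric] P1 P2 R1 R2 by (rule alg)
    next
      fix j assume "j \<in> {..<n} - {i}"
      then have j: "j < n" "j \<noteq> i" by auto
      define D where "D = (\<Prod>p\<in>{..<n} - {i, j}. of_int (a ! i - a ! p) :: complex)"
      define g where "g = (of_int (g1 a j) :: complex)"
      define s where "s = (\<Sum>l\<in>{..<n} - {i, j}. b l)"
      have 1: "(\<Sum>l\<in>{..<n} - {i, j}. lin one i l - 1) = - (s / x)"
        unfolding s_def sum_divide_distrib sum_negf[symmetric] by (intro sum.cong refl lin2) simp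
      have 2: "(\<Sum>l\<in>{..<n} - {i, j}. y * of_int (a ! l) / (2 * D)) = y * s / (2 * D)"
        unfolding s_def b_def by (simp only: sum_distrib_left sum_divide_distrib)
      have 3: "of_int (a ! i - a ! j) = x - b j" by (simp add: x_def b_def)
      have "- (1 / 1) * (y * x / D) * ((x - b j) / x * (g\<^sup>2 - 1) / 12 + (g - 1) / 4 * - (s / x)) =
          (1 - g\<^sup>2) * y * (x - b j) / (12 * D) + (g - 1) / 2 * (y * s / (2 * D))"
      proof -
        have "x * ((x - b j) / x * (g\<^sup>2 - 1) / 12 + (g - 1) / 4 * - (s / x)) =
            (x - b j) * (g\<^sup>2 - 1) / 12 - (g - 1) / 4 * s"
          using x0 by (simp add: field_simps)
        moreover have "- (1 / 1) * (y * x / D) * K = - (y / D) * (x * K)" for K by simp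
        ultimately have "- (1 / 1) * (y * x / D) * ((x - b j) / x * (g\<^sup>2 - 1) / 12 + (g - 1) / 4 * - (s / x)) =
            - (y / D) * ((x - b j) * (g\<^sup>2 - 1) / 12 - (g - 1) / 4 * s)" by (simp only:)
        also have "\<dots> = (1 - g\<^sup>2) * y * (x - b j) / (12 * D) + (g - 1) / 2 * (y * s / (2 * D))"
        proof -
          have "(1 - g\<^sup>2) * y * (x - b j) / (12 * D) = (y / D) * ((1 - g\<^sup>2) * (x - b j) / 12)"
            "y * s / (2 * D) = (y / D) * (s / 2)" by (simp_all add: mult_ac)
          moreover have "- z * (u * (g\<^sup>2 - 1) / 12 - (g - 1) / 4 * s) =
              z * ((1 - g\<^sup>2) * u / 12) + (g - 1) / 2 * (z * (s / 2))" for z u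
            by (simp add: field_simps)
          ultimately show ?thesis by (simp only:)
        qed
        finally show ?thesis .
      qed
      then show "- (1 / 1) * (y * x / (\<Prod>p\<in>{..<n} - {i, j}. of_int (a ! i - a ! p))) *
        (lin one i j * (of_int (g1 a j) ^ 2 - 1) / 12 +
         (of_int (g1 a j) - 1) / 4 * (\<Sum>l\<in>{..<n} - {i, j}. lin one i l - 1)) =
         (1 - of_int (g1 a j) ^ 2) * y * of_int (a ! i - a ! j)
           / (12 * (\<Prod>l\<in>{..<n} - {i, j}. of_int (a ! i - a ! l)))
         + (of_int (g1 a j) - 1) / 2 *
           (\<Sum>l\<in>{..<n} - {i, j}. y * of_int (a ! l) / (2 * (\<Prod>p\<in>{..<n} - {i, j}. of_int (a ! i - a ! p))))"
        unfolding D_def[symmetric] g_def[symmetric] 1 2 3 lin1[OF j(1)] .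
    qed (simp add: split_def)
  qed
  finally show ?thesis by (simp only: sum.distrib)
qed

section \<open>Collecting the poles into S / D\<close>

definition Res :: "(nat \<Rightarrow> complex) \<Rightarrow> int \<Rightarrow> nat set \<Rightarrow> complex" where
  "Res c u A = (\<Sum>i\<in>A \<inter> {..<k}. res c i u A)"

definition excess :: "(nat \<Rightarrow> complex) \<Rightarrow> nat set \<Rightarrow> complex" where
  "excess c A = (\<Sum>j\<in>A \<inter> {..<n}. c j - 1)"

definition wt_sum :: "nat set \<Rightarrow> complex" where
  "wt_sum A = (\<Sum>j\<in>A \<inter> {..<n}. of_int (a ! j))"

text \<open>A sum over \<open>j \<noteq> i\<close> is completed by its own index so that it depends
  on \<open>i\<close> only through \<open>1 / ratio c i\<close>. The added term has
  \<open>lin c i i = 0\<close>, whence the corrections \<open>+ 1\<close> and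
  \<open>- 1\<close>.\<close>

lemma sum_lin:
  assumes i: "i < k" "i \<in> A" and c0: "\<And>j. j < n \<Longrightarrow> c j \<noteq> 0"
  shows "(\<Sum>j\<in>A \<inter> {..<n} - {i}. lin c i j - 1) = excess c A + 1 - wt_sum A / ratio c i"
    and "(\<Sum>j\<in>A \<inter> {..<n} - {i}. (lin c i j - 1)\<^sup>2) = (\<Sum>j\<in>A \<inter> {..<n}. (c j - 1)\<^sup>2)
      - 2 * (\<Sum>j\<in>A \<inter> {..<n}. (c j - 1) * of_int (a ! j)) / ratio c i
      + (\<Sum>j\<in>A \<inter> {..<n}. (of_int (a ! j))\<^sup>2) / (ratio c i)\<^sup>2 - 1"
proof -
  have inn: "i < n" using i k by simp
  define x where "x = ratio c i"
  have l: "lin c i j - 1 = (c j - 1) - of_int (a ! j) / x" if "j \<in> A \<inter> {..<n}" for j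
    using lin_ratio(1)[of i j c] that inn c0 by (simp add: x_def)
  have self: "lin c i i - 1 = - 1" using a_nonzero[OF inn] by (simp add: lin_def)
  have mem: "i \<in> A \<inter> {..<n}" using i inn by simp
  have "(\<Sum>j\<in>A \<inter> {..<n}. lin c i j - 1) = (\<Sum>j\<in>A \<inter> {..<n}. (c j - 1) - of_int (a ! j) / x)"
    by (intro sum.cong refl l)
  also have "\<dots> = excess c A - wt_sum A / x"
    by (simp only: sum_subtractf excess_def wt_sum_def sum_divide_distrib)
  finally show "(\<Sum>j\<in>A \<inter> {..<n} - {i}. lin c i j - 1) = excess c A + 1 - wt_sum A / ratio c i"
    using mem self by (simp add: sum.remove[of "A \<inter> {..<n}" i] x_def[symmetric] algebra_simps)
  have "(\<Sum>j\<in>A \<inter> {..<n}. (lin c i j - 1)\<^sup>2) =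
      (\<Sum>j\<in>A \<inter> {..<n}. (c j - 1)\<^sup>2 - 2 * ((c j - 1) * of_int (a ! j)) / x + (of_int (a ! j))\<^sup>2 / x\<^sup>2)"
    by (intro sum.cong refl) (simp add: l power2_diff power_divide)
  also have "\<dots> = (\<Sum>j\<in>A \<inter> {..<n}. (c j - 1)\<^sup>2)
      - 2 * (\<Sum>j\<in>A \<inter> {..<n}. (c j - 1) * of_int (a ! j)) / x
      + (\<Sum>j\<in>A \<inter> {..<n}. (of_int (a ! j))\<^sup>2) / x\<^sup>2"
    by (simp only: sum_subtractf sum.distrib sum_divide_distrib sum_distrib_left)
  finally show "(\<Sum>j\<in>A \<inter> {..<n} - {i}. (lin c i j - 1)\<^sup>2) = (\<Sum>j\<in>A \<inter> {..<n}. (c j - 1)\<^sup>2)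
      - 2 * (\<Sum>j\<in>A \<inter> {..<n}. (c j - 1) * of_int (a ! j)) / ratio c i
      + (\<Sum>j\<in>A \<inter> {..<n}. (of_int (a ! j))\<^sup>2) / (ratio c i)\<^sup>2 - 1"
    using mem self by (simp add: sum.remove[of "A \<inter> {..<n}" i] x_def[symmetric] algebra_simps)
qed

lemma res_shift:
  assumes "ratio c i \<noteq> 0"
  shows "res c i u A / ratio c i = res c i (u - 1) A"
  using assms by (simp add: res_def power_int_diff)

text \<open>By \<open>sum_lin\<close> the brackets are polynomials in \<open>1 / ratio c i\<close>
  of degree at most 2, with coefficients independent of \<open>i\<close>, and dividing
  \<open>res\<close> by \<open>ratio c i\<close> lowers its exponent by one. This is how the
  exponents \<open>n - 2\<close>, \<open>n - 3\<close> and \<open>n - 4\<close> come about. The sums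
  over \<open>i\<close> can then be carried out first, for a fixed set of deleted positions.\<close>

lemma Phi_2_res:
  assumes adm: "admissible c" and gcd: "Gcd (set a) = 1"
  defines "K1 \<equiv> excess c UNIV + 1" and "K2 \<equiv> (\<Sum>j\<in>UNIV \<inter> {..<n}. (c j - 1)\<^sup>2) - 1"
    and "K3 \<equiv> (\<Sum>j\<in>UNIV \<inter> {..<n}. (c j - 1) * of_int (a ! j))"
    and "Q \<equiv> (\<Sum>j\<in>UNIV \<inter> {..<n}. (of_int (a ! j))\<^sup>2)" and "E \<equiv> wt_sum UNIV"
  shows "fps_nth (Phi c) 2 =
    - (1 / (\<Prod>p\<in>UNIV \<inter> {..<n}. c p)) * ((K1 / 6 + K1\<^sup>2 / 8 - K2 / 24) * Res c (int n - 2) UNIV +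
       (K3 / 12 - E / 6 - K1 * E / 4) * Res c (int n - 3) UNIV + (E\<^sup>2 / 8 - Q / 24) * Res c (int n - 4) UNIV) +
    (\<Sum>j<n. - (1 / (\<Prod>p\<in>- {j} \<inter> {..<n}. c p)) *
      ((of_int (g1 a j) ^ 2 - 1) / 12 *
         (c j * Res c (int n - 3) (- {j}) - of_int (a ! j) * Res c (int n - 4) (- {j})) +
       (of_int (g1 a j) - 1) / 4 *
         ((excess c (- {j}) + 1) * Res c (int n - 3) (- {j}) - wt_sum (- {j}) * Res c (int n - 4) (- {j})))) +
    (\<Sum>(j, l) | j < l \<and> l < n.
      - (1 / (\<Prod>p\<in>- {j, l} \<inter> {..<n}. c p)) * Res c (int n - 4) (- {j, l}) * zeta_sum a j l)"
proof -
  have c0: "c j \<noteq> 0" if "j < n" for j using adm that by (simp add: admissible_def)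
  have x0: "ratio c i \<noteq> 0" if "i < k" for i using ratio_nonzero[of i c] c0[of i] that k by simp
  have shift1: "res c i (int n - 2) A / ratio c i = res c i (int n - 3) A"
    and shift2: "res c i (int n - 3) A / ratio c i = res c i (int n - 4) A" if "i < k" for i A
    using res_shift[OF x0[OF that], of "int n - 2"] res_shift[OF x0[OF that], of "int n - 3"] by simp_all
  define C where "C A = (1 / (\<Prod>p\<in>A \<inter> {..<n}. c p))" for A
  define g where "g j = (of_int (g1 a j) :: complex)" for j
  define F1 where "F1 i = - C UNIV * ((K1 / 6 + K1\<^sup>2 / 8 - K2 / 24) * res c i (int n - 2) UNIV +
       (K3 / 12 - E / 6 - K1 * E / 4) * res c i (int n - 3) UNIV + (E\<^sup>2 / 8 - Q / 24) * res c i (int n - 4) UNIV)" for i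
  define F2 where "F2 i j = - C (- {j}) * ((g j ^ 2 - 1) / 12 *
         (c j * res c i (int n - 3) (- {j}) - of_int (a ! j) * res c i (int n - 4) (- {j})) +
       (g j - 1) / 4 *
         ((excess c (- {j}) + 1) * res c i (int n - 3) (- {j}) - wt_sum (- {j}) * res c i (int n - 4) (- {j})))"
    for i j
  define F3 where "F3 i j l = - C (- {j, l}) * res c i (int n - 4) (- {j, l}) * zeta_sum a j l" for i j l
  have "1 / of_nat (w i) * G2 c i = F1 i + (\<Sum>j\<in>{..<n} - {i}. F2 i j) +
      (\<Sum>(j, l) | j < l \<and> l < n \<and> j \<noteq> i \<and> l \<noteq> i. F3 i j l)" if i: "i < k" for i
  proof -
    define x where "x = ratio c i"
    have x: "x \<noteq> 0" using x0[OF i] by (simp add: x_def)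
    have J: "UNIV \<inter> {..<n} - {i} = {..<n} - {i}" by auto
    have p1: "(\<Sum>j\<in>{..<n} - {i}. lin c i j - 1) = K1 - E / x"
      using sum_lin(1)[OF i UNIV_I c0] by (simp add: K1_def E_def x_def)
    have p2: "(\<Sum>j\<in>{..<n} - {i}. (lin c i j - 1)\<^sup>2) = K2 - 2 * K3 / x + Q / x\<^sup>2"
      using sum_lin(2)[OF i UNIV_I c0] by (simp add: K2_def K3_def Q_def x_def)
    have one: "- C UNIV * res c i (int n - 2) UNIV *
        ((K1 - E / x) / 6 + (K1 - E / x)\<^sup>2 / 8 - (K2 - 2 * K3 / x + Q / x\<^sup>2) / 24) = F1 i"
    proof -
      define r where "r = res c i (int n - 2) UNIV"
      have r: "res c i (int n - 3) UNIV = r / x" "res c i (int n - 4) UNIV = r / x / x"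
        unfolding r_def x_def shift1[OF i] shift2[OF i] by simp_all
      have "r * ((K1 - E / x) / 6 + (K1 - E / x)\<^sup>2 / 8 - (K2 - 2 * K3 / x + Q / x\<^sup>2) / 24) =
          (K1 / 6 + K1\<^sup>2 / 8 - K2 / 24) * r + (K3 / 12 - E / 6 - K1 * E / 4) * (r / x) +
          (E\<^sup>2 / 8 - Q / 24) * (r / x / x)"
        using x by (simp add: power2_eq_square) (simp add: field_simps)
      then show ?thesis unfolding F1_def r r_def[symmetric] by (simp only: mult.assoc)
    qed
    have two: "- C (- {j}) * res c i (int n - 3) (- {j}) * (lin c i j * (g j ^ 2 - 1) / 12 +
        (g j - 1) / 4 * (\<Sum>l\<in>{..<n} - {i, j}. lin c i l - 1)) = F2 i j" if j: "j < n" "j \<noteq> i" for j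
    proof -
      define r where "r = res c i (int n - 3) (- {j})"
      have r: "res c i (int n - 4) (- {j}) = r / x"
        unfolding r_def x_def shift2[OF i] by simp
      have "- {j} \<inter> {..<n} - {i} = {..<n} - {i, j}" by auto
      then have s: "(\<Sum>l\<in>{..<n} - {i, j}. lin c i l - 1) = excess c (- {j}) + 1 - wt_sum (- {j}) / x"
        using sum_lin(1)[OF i _ c0, of "- {j}"] j by (simp add: x_def)
      have l: "lin c i j = c j - of_int (a ! j) / x"
        unfolding x_def using lin_ratio(1)[of i j c] j i k c0 by simp
      have "r * ((cj - aj / x) * G / 12 + H * (e - v / x)) =
          G / 12 * (cj * r - aj * (r / x)) + H * (e * r - v * (r / x))" for cj aj G H e v
      proof -
        have "(cj - aj / x) * G / 12 = G / 12 * (cj - aj / x)" by simp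
        moreover have "aj / x * r = aj * (r / x)" "v / x * r = v * (r / x)" by simp_all
        ultimately show ?thesis
          by (simp only: distrib_left right_diff_distrib left_diff_distrib mult.assoc mult.left_commute[of r]
            mult.commute[of r])
      qed
      then show ?thesis unfolding F2_def r s l r_def[symmetric] by (simp only: mult.assoc)
    qed
    show ?thesis
      unfolding G2_res[OF adm i] p1 p2 C_def[symmetric] g_def[symmetric] one F3_def
      using two by (intro arg_cong2[where f = "(+)"] refl sum.cong) auto
  qed
  then have "fps_nth (Phi c) 2 = (\<Sum>i<k. F1 i + (\<Sum>j\<in>{..<n} - {i}. F2 i j) +
      (\<Sum>(j, l) | j < l \<and> l < n \<and> j \<noteq> i \<and> l \<noteq> i. F3 i j l))"
    unfolding Phi_2[OF admissible_generic[OF adm] gcd] by (intro sum.cong refl) simp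
  also have "\<dots> = (\<Sum>i<k. F1 i) + (\<Sum>i<k. \<Sum>j\<in>{..<n} - {i}. F2 i j) +
      (\<Sum>i<k. \<Sum>(j, l) | j < l \<and> l < n \<and> j \<noteq> i \<and> l \<noteq> i. F3 i j l)"
    by (simp only: sum.distrib)
  also have "(\<Sum>i<k. \<Sum>j\<in>{..<n} - {i}. F2 i j) = (\<Sum>j<n. \<Sum>i\<in>- {j} \<inter> {..<k}. F2 i j)"
  proof -
    have s1: "{..<n} - {i} = {j \<in> {..<n}. i \<noteq> j}" and s2: "- {j} \<inter> {..<k} = {i \<in> {..<k}. i \<noteq> j}"
      for i j by auto
    show ?thesis unfolding s1 s2 by (rule sum.swap_restrict) simp_all
  qed
  also have "(\<Sum>i<k. \<Sum>(j, l) | j < l \<and> l < n \<and> j \<noteq> i \<and> l \<noteq> i. F3 i j l) =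
      (\<Sum>(j, l) | j < l \<and> l < n. \<Sum>i\<in>- {j, l} \<inter> {..<k}. F3 i j l)"
  proof -
    let ?P = "{(j, l). j < l \<and> l < n}"
    have "(\<Sum>i<k. \<Sum>(j, l) | j < l \<and> l < n \<and> j \<noteq> i \<and> l \<noteq> i. F3 i j l) =
        (\<Sum>i<k. \<Sum>q\<in>{q \<in> ?P. fst q \<noteq> i \<and> snd q \<noteq> i}. F3 i (fst q) (snd q))"
      by (intro sum.cong refl) auto
    also have "\<dots> = (\<Sum>q\<in>?P. \<Sum>i\<in>{i \<in> {..<k}. fst q \<noteq> i \<and> snd q \<noteq> i}. F3 i (fst q) (snd q))"
      using finite_ordered_pairs[of "\<lambda>_ _. True"] by (intro sum.swap_restrict) simp_all
    also have "\<dots> = (\<Sum>(j, l)\<in>?P. \<Sum>i\<in>- {j, l} \<inter> {..<k}. F3 i j l)"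
      unfolding split_def by (intro sum.cong refl) auto
    finally show ?thesis .
  qed
  finally have total: "fps_nth (Phi c) 2 = (\<Sum>i<k. F1 i) + (\<Sum>j<n. \<Sum>i\<in>- {j} \<inter> {..<k}. F2 i j) +
      (\<Sum>(j, l) | j < l \<and> l < n. \<Sum>i\<in>- {j, l} \<inter> {..<k}. F3 i j l)" .
  have F1: "(\<Sum>i<k. F1 i) = - C UNIV * ((K1 / 6 + K1\<^sup>2 / 8 - K2 / 24) * Res c (int n - 2) UNIV +
       (K3 / 12 - E / 6 - K1 * E / 4) * Res c (int n - 3) UNIV + (E\<^sup>2 / 8 - Q / 24) * Res c (int n - 4) UNIV)"
    by (simp only: F1_def Res_def Int_UNIV_left sum_distrib_left[symmetric] sum.distrib)
  have F2: "(\<Sum>i\<in>- {j} \<inter> {..<k}. F2 i j) = - C (- {j}) * ((g j ^ 2 - 1) / 12 *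
         (c j * Res c (int n - 3) (- {j}) - of_int (a ! j) * Res c (int n - 4) (- {j})) +
       (g j - 1) / 4 *
         ((excess c (- {j}) + 1) * Res c (int n - 3) (- {j}) - wt_sum (- {j}) * Res c (int n - 4) (- {j})))" for j
    by (simp only: F2_def Res_def sum_distrib_left[symmetric] sum.distrib sum_subtractf)
  have F3: "(\<Sum>i\<in>- {j, l} \<inter> {..<k}. F3 i j l) =
      - C (- {j, l}) * Res c (int n - 4) (- {j, l}) * zeta_sum a j l" for j l
    by (simp only: F3_def Res_def sum_distrib_left[symmetric] sum_distrib_right[symmetric])
  show ?thesis unfolding total F1 F2 F3 C_def g_def ..
qed

lemma wt_sum_eq: "wt_sum A = of_int (elem_sym 1 (nths a A))"
proof -
  have "sum_list (nths a A) = (\<Sum>i\<in>A \<inter> {..<n}. a ! i)"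
    unfolding nths_eq_map len
    by (subst sum_list_distinct_conv_sum_set) (auto intro: sum.cong)
  then show ?thesis unfolding elem_sym_1 wt_sum_def by simp
qed

lemma nths_UNIV: "nths xs UNIV = xs"
  by (rule nths_all) simp

lemma gamma_2_general:
  assumes gcd: "Gcd (set a) = 1"
  shows "gamma_coeff 2 a =
       (5 * of_int (elem_sym 1 a) * S_fun (int n - 3) a
          - (of_int (elem_sym 2 a) + of_int (elem_sym 1 a) ^ 2) * S_fun (int n - 4) a
          - 4 * S_fun (int n - 2) a) / (12 * of_int (D_prod a))
       + (\<Sum>j<n. (1 - of_int (g1 a j) ^ 2) / 12 *
            ((S_fun (int n - 3) (del1 a j) - of_int (a ! j) * S_fun (int n - 4) (del1 a j))
              / of_int (D_prod (del1 a j))))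
       + (\<Sum>j<n. (of_int (g1 a j) - 1) / 4 *
            ((of_int (elem_sym 1 (del1 a j)) * S_fun (int n - 4) (del1 a j) - S_fun (int n - 3) (del1 a j))
              / of_int (D_prod (del1 a j))))
       + (\<Sum>(j, l) | j < l \<and> l < n.
            - S_fun (int n - 4) (del2 a j l) / of_int (D_prod (del2 a j l)) * zeta_sum a j l)"
proof -
  \<comment> \<open>Equal weights receive different \<open>c j\<close>, so their ratios differ
    whenever \<open>\<epsilon> \<noteq> 0\<close> and they are defined; different weights keep
    different ratios for small \<open>\<epsilon>\<close>. A single real parameter thus makes all
    ratios distinct near 0.\<close>
  define c where "c \<epsilon> j = (1 + of_real \<epsilon> * of_nat j :: complex)" for \<epsilon> :: real and j :: nat
  let ?F = "at (0 :: real)"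
  have cl: "((\<lambda>\<epsilon>. c \<epsilon> j) \<longlongrightarrow> 1) ?F" for j
    unfolding c_def by (auto intro!: tendsto_eq_intros)
  have ratio_lim: "((\<lambda>\<epsilon>. ratio (c \<epsilon>) j) \<longlongrightarrow> of_int (a ! j)) ?F" for j
    unfolding ratio_def using tendsto_divide[OF tendsto_const cl, of "of_int (a ! j)" j] by simp
  have ev_c: "\<forall>\<^sub>F \<epsilon> in ?F. \<forall>j\<in>{..<n}. c \<epsilon> j \<noteq> 0"
    by (intro eventually_ball_finite ballI finite_lessThan tendsto_imp_eventually_ne[OF cl]) simp
  have ev_0: "\<forall>\<^sub>F \<epsilon> in ?F. \<epsilon> \<noteq> 0" by (simp add: eventually_at_filter)
  have ev_ne: "\<forall>\<^sub>F \<epsilon> in ?F. \<forall>i\<in>{..<n}. \<forall>j\<in>{..<n}. i \<noteq> j \<longrightarrow> ratio (c \<epsilon>) i \<noteq> ratio (c \<epsilon>) j"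
  proof (intro eventually_ball_finite ballI finite_lessThan)
    fix i j assume ij: "i \<in> {..<n}" "j \<in> {..<n}"
    show "\<forall>\<^sub>F \<epsilon> in ?F. i \<noteq> j \<longrightarrow> ratio (c \<epsilon>) i \<noteq> ratio (c \<epsilon>) j"
    proof (cases "a ! i = a ! j")
      case True
      show ?thesis using ev_c ev_0
      proof eventually_elim
        case (elim \<epsilon>)
        show ?case
        proof (intro impI notI)
          assume "i \<noteq> j" "ratio (c \<epsilon>) i = ratio (c \<epsilon>) j"
          moreover have "(of_int (a ! j) :: complex) \<noteq> 0" using a_nonzero[of j] ij by simp
          moreover have "c \<epsilon> i \<noteq> 0" "c \<epsilon> j \<noteq> 0" using elim(1) ij by auto
          ultimately have "c \<epsilon> i = c \<epsilon> j"
            unfolding ratio_def True by (simp add: frac_eq_eq)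
          then show False using \<open>i \<noteq> j\<close> elim(2) by (simp add: c_def)
        qed
      qed
    next
      case False
      have "((\<lambda>\<epsilon>. ratio (c \<epsilon>) i - ratio (c \<epsilon>) j) \<longlongrightarrow> of_int (a ! i) - of_int (a ! j)) ?F"
        by (intro tendsto_diff ratio_lim)
      moreover have "(of_int (a ! i) - of_int (a ! j) :: complex) \<noteq> 0" using False by simp
      ultimately have "\<forall>\<^sub>F \<epsilon> in ?F. ratio (c \<epsilon>) i - ratio (c \<epsilon>) j \<noteq> 0"
        by (rule tendsto_imp_eventually_ne)
      then show ?thesis by eventually_elim simp
    qed
  qed
  have adm: "\<forall>\<^sub>F \<epsilon> in ?F. admissible (c \<epsilon>)"
    using ev_c ev_ne by eventually_elim (use k in \<open>auto simp: admissible_def\<close>)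
  have inj: "\<forall>\<^sub>F \<epsilon> in ?F. inj_on (ratio (c \<epsilon>)) {..<n}"
    using ev_ne by eventually_elim (auto simp: inj_on_def)
  define s where "s u A = S_fun u (nths a A) / of_int (D_prod (nths a A))" for u A
  have Res_lim: "((\<lambda>\<epsilon>. Res (c \<epsilon>) u A) \<longlongrightarrow> s u A) ?F" for u A
    unfolding Res_def res_def s_def by (rule S_fun_lim_nths[OF ratio_lim inj])
  have C_lim: "((\<lambda>\<epsilon>. - (1 / (\<Prod>p\<in>A \<inter> {..<n}. c \<epsilon> p))) \<longlongrightarrow> - 1) ?F" for A
  proof -
    have "((\<lambda>\<epsilon>. - (1 / (\<Prod>p\<in>A \<inter> {..<n}. c \<epsilon> p))) \<longlongrightarrow> - (1 / (\<Prod>p\<in>A \<inter> {..<n}. 1))) ?F"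
      by (intro tendsto_minus tendsto_divide tendsto_const tendsto_prod cl) simp
    then show ?thesis by simp
  qed
  have excess_lim: "((\<lambda>\<epsilon>. excess (c \<epsilon>) A + 1) \<longlongrightarrow> 1) ?F" for A
  proof -
    have "((\<lambda>\<epsilon>. excess (c \<epsilon>) A + 1) \<longlongrightarrow> (\<Sum>j\<in>A \<inter> {..<n}. 1 - 1) + 1) ?F"
      unfolding excess_def by (intro tendsto_add tendsto_sum tendsto_diff tendsto_const cl)
    then show ?thesis by simp
  qed
  have K2_lim: "((\<lambda>\<epsilon>. (\<Sum>j\<in>UNIV \<inter> {..<n}. (c \<epsilon> j - 1)\<^sup>2) - 1) \<longlongrightarrow> - 1) ?F"
  proof -
    have "((\<lambda>\<epsilon>. (\<Sum>j\<in>UNIV \<inter> {..<n}. (c \<epsilon> j - 1)\<^sup>2) - 1) \<longlongrightarrow> (\<Sum>j\<in>UNIV \<inter> {..<n}. (1 - 1)\<^sup>2) - 1) ?F"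
      by (intro tendsto_diff tendsto_sum tendsto_power tendsto_const cl)
    then show ?thesis by simp
  qed
  have K3_lim: "((\<lambda>\<epsilon>. \<Sum>j\<in>UNIV \<inter> {..<n}. (c \<epsilon> j - 1) * of_int (a ! j)) \<longlongrightarrow> 0) ?F"
  proof -
    have "((\<lambda>\<epsilon>. \<Sum>j\<in>UNIV \<inter> {..<n}. (c \<epsilon> j - 1) * of_int (a ! j)) \<longlongrightarrow>
        (\<Sum>j\<in>UNIV \<inter> {..<n}. (1 - 1) * of_int (a ! j))) ?F"
      by (intro tendsto_diff tendsto_sum tendsto_mult tendsto_const cl)
    then show ?thesis by simp
  qed
  define E where "E = wt_sum UNIV"
  define Q where "Q = (\<Sum>j\<in>UNIV \<inter> {..<n}. (of_int (a ! j))\<^sup>2 :: complex)"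
  define g where "g j = (of_int (g1 a j) :: complex)" for j
  define R where "R \<epsilon> = - (1 / (\<Prod>p\<in>UNIV \<inter> {..<n}. c \<epsilon> p)) *
      (((excess (c \<epsilon>) UNIV + 1) / 6 + (excess (c \<epsilon>) UNIV + 1)\<^sup>2 / 8 -
         ((\<Sum>j\<in>UNIV \<inter> {..<n}. (c \<epsilon> j - 1)\<^sup>2) - 1) / 24) * Res (c \<epsilon>) (int n - 2) UNIV +
       ((\<Sum>j\<in>UNIV \<inter> {..<n}. (c \<epsilon> j - 1) * of_int (a ! j)) / 12 - E / 6 - (excess (c \<epsilon>) UNIV + 1) * E / 4) *
         Res (c \<epsilon>) (int n - 3) UNIV + (E\<^sup>2 / 8 - Q / 24) * Res (c \<epsilon>) (int n - 4) UNIV) +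
    (\<Sum>j<n. - (1 / (\<Prod>p\<in>- {j} \<inter> {..<n}. c \<epsilon> p)) *
      ((g j ^ 2 - 1) / 12 *
         (c \<epsilon> j * Res (c \<epsilon>) (int n - 3) (- {j}) - of_int (a ! j) * Res (c \<epsilon>) (int n - 4) (- {j})) +
       (g j - 1) / 4 *
         ((excess (c \<epsilon>) (- {j}) + 1) * Res (c \<epsilon>) (int n - 3) (- {j}) - wt_sum (- {j}) * Res (c \<epsilon>) (int n - 4) (- {j})))) +
    (\<Sum>q | fst q < snd q \<and> snd q < n.
      - (1 / (\<Prod>p\<in>- {fst q, snd q} \<inter> {..<n}. c \<epsilon> p)) * Res (c \<epsilon>) (int n - 4) (- {fst q, snd q}) *
        zeta_sum a (fst q) (snd q))" for \<epsilon>
  have "\<forall>\<^sub>F \<epsilon> in ?F. R \<epsilon> = fps_nth (Phi (c \<epsilon>)) 2"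
    using adm
  proof eventually_elim
    case (elim \<epsilon>)
    show ?case unfolding Phi_2_res[OF elim gcd] R_def E_def Q_def g_def split_def ..
  qed
  moreover have "((\<lambda>\<epsilon>. fps_nth (Phi (c \<epsilon>)) 2) \<longlongrightarrow> gamma_coeff 2 a) ?F"
    by (rule gamma_2_lim[OF cl]) (use adm admissible_generic in \<open>auto elim: eventually_mono\<close>)
  ultimately have "(R \<longlongrightarrow> gamma_coeff 2 a) ?F" by (simp add: tendsto_cong)
  \<comment> \<open>All \<open>c j\<close> tend to 1, so the quantities \<open>K1\<close>,
    \<open>K2\<close> and \<open>K3\<close> of \<open>Phi_2_res\<close> tend to 1, -1 and 0, and
    every \<open>Res\<close> tends to its quotient \<open>s\<close>.\<close>
  moreover have "(R \<longlongrightarrow> - 1 * ((1 / 6 + 1\<^sup>2 / 8 - (- 1) / 24) * s (int n - 2) UNIV +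
       (0 / 12 - E / 6 - 1 * E / 4) * s (int n - 3) UNIV + (E\<^sup>2 / 8 - Q / 24) * s (int n - 4) UNIV) +
    (\<Sum>j<n. - 1 * ((g j ^ 2 - 1) / 12 * (1 * s (int n - 3) (- {j}) - of_int (a ! j) * s (int n - 4) (- {j})) +
       (g j - 1) / 4 * (1 * s (int n - 3) (- {j}) - wt_sum (- {j}) * s (int n - 4) (- {j})))) +
    (\<Sum>q | fst q < snd q \<and> snd q < n. - 1 * s (int n - 4) (- {fst q, snd q}) * zeta_sum a (fst q) (snd q))) ?F"
    unfolding R_def
    by (intro tendsto_add[of _ _ ?F] tendsto_mult[of _ _ ?F] tendsto_diff[of _ _ ?F] tendsto_divide[of _ _ ?F]
        tendsto_power[of _ _ ?F] tendsto_sum C_lim Res_lim excess_lim K2_lim K3_lim cl tendsto_const) simp_all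
  ultimately have gamma: "gamma_coeff 2 a =
      - 1 * ((1 / 6 + 1\<^sup>2 / 8 - (- 1) / 24) * s (int n - 2) UNIV +
       (0 / 12 - E / 6 - 1 * E / 4) * s (int n - 3) UNIV + (E\<^sup>2 / 8 - Q / 24) * s (int n - 4) UNIV) +
    (\<Sum>j<n. - 1 * ((g j ^ 2 - 1) / 12 * (1 * s (int n - 3) (- {j}) - of_int (a ! j) * s (int n - 4) (- {j})) +
       (g j - 1) / 4 * (1 * s (int n - 3) (- {j}) - wt_sum (- {j}) * s (int n - 4) (- {j})))) +
    (\<Sum>q | fst q < snd q \<and> snd q < n. - 1 * s (int n - 4) (- {fst q, snd q}) * zeta_sum a (fst q) (snd q))"
    by (intro tendsto_unique[of ?F]) simp_all
  have e1: "of_int (elem_sym 1 a) = E"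
    unfolding E_def wt_sum_eq nths_UNIV ..
  have e2: "of_int (elem_sym 2 a) = (E\<^sup>2 - Q) / 2"
  proof -
    have "E\<^sup>2 - Q = (\<Sum>j<n. \<Sum>l\<in>{..<n} - {j}. of_int (a ! j) * of_int (a ! l))"
      unfolding E_def Q_def wt_sum_def Int_UNIV_left by (rule sum_pairs_mult[symmetric]) simp
    also have "\<dots> = 2 * (\<Sum>(j, l) | j \<in> {..<n} \<and> l \<in> {..<n} \<and> j < l. of_int (a ! j) * of_int (a ! l))"
      by (rule sum_pairs_symmetric) simp_all
    also have "{(j, l). j \<in> {..<n} \<and> l \<in> {..<n} \<and> j < l} = {(j, l). j < l \<and> l < length a}"
      by (auto simp: len)
    also have "(\<Sum>(j, l)\<in>\<dots>. of_int (a ! j) * of_int (a ! l)) = (of_int (elem_sym 2 a) :: complex)"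
      by (simp add: elem_sym_2 split_def)
    finally show ?thesis by simp
  qed
  \<comment> \<open>The constants: 1/6 + 1/8 + 1/24 = 4/12 and 1/6 + 1/4 = 5/12, while
    \<open>E^2 / 8 - Q / 24\<close> is \<open>((E^2 - Q) / 2 + E^2) / 12\<close>, in which
    \<open>e2\<close> recognises the second elementary symmetric polynomial.\<close>
  have T1: "- 1 * ((1 / 6 + 1\<^sup>2 / 8 - (- 1) / 24) * s (int n - 2) UNIV +
       (0 / 12 - E / 6 - 1 * E / 4) * s (int n - 3) UNIV + (E\<^sup>2 / 8 - Q / 24) * s (int n - 4) UNIV) =
      (5 * of_int (elem_sym 1 a) * S_fun (int n - 3) a
          - (of_int (elem_sym 2 a) + of_int (elem_sym 1 a) ^ 2) * S_fun (int n - 4) a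
          - 4 * S_fun (int n - 2) a) / (12 * of_int (D_prod a))"
  proof -
    have s: "s u UNIV = S_fun u a / of_int (D_prod a)" for u by (simp only: s_def nths_UNIV)
    have "- 1 * ((1 / 6 + 1\<^sup>2 / 8 - (- 1) / 24) * (s2 / d) + (0 / 12 - E / 6 - 1 * E / 4) * (s3 / d) +
        (E\<^sup>2 / 8 - Q / 24) * (s4 / d)) = (5 * E * s3 - ((E\<^sup>2 - Q) / 2 + E\<^sup>2) * s4 - 4 * s2) / (12 * d)"
      for s2 s3 s4 d :: complex
      by (cases "d = 0") (simp_all add: field_simps)
    then show ?thesis unfolding s e1 e2 .
  qed
  have T2: "(\<Sum>j<n. - 1 * ((g j ^ 2 - 1) / 12 * (1 * s (int n - 3) (- {j}) - of_int (a ! j) * s (int n - 4) (- {j})) +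
       (g j - 1) / 4 * (1 * s (int n - 3) (- {j}) - wt_sum (- {j}) * s (int n - 4) (- {j})))) =
      (\<Sum>j<n. (1 - of_int (g1 a j) ^ 2) / 12 *
            ((S_fun (int n - 3) (del1 a j) - of_int (a ! j) * S_fun (int n - 4) (del1 a j))
              / of_int (D_prod (del1 a j)))) +
      (\<Sum>j<n. (of_int (g1 a j) - 1) / 4 *
            ((of_int (elem_sym 1 (del1 a j)) * S_fun (int n - 4) (del1 a j) - S_fun (int n - 3) (del1 a j))
              / of_int (D_prod (del1 a j))))"
    unfolding sum.distrib[where A = "{..<n}", symmetric]
  proof (rule sum.cong[OF refl])
    fix j
    have "- 1 * ((G\<^sup>2 - 1) / 12 * (1 * (s3 / d) - A * (s4 / d)) + (G - 1) / 4 * (1 * (s3 / d) - v * (s4 / d))) =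
        (1 - G\<^sup>2) / 12 * ((s3 - A * s4) / d) + (G - 1) / 4 * ((v * s4 - s3) / d)"
      for G A v s3 s4 d :: complex
      by (simp add: diff_divide_distrib) (simp add: algebra_simps diff_divide_distrib add_divide_distrib)
    then show "- 1 * ((g j ^ 2 - 1) / 12 * (1 * s (int n - 3) (- {j}) - of_int (a ! j) * s (int n - 4) (- {j})) +
       (g j - 1) / 4 * (1 * s (int n - 3) (- {j}) - wt_sum (- {j}) * s (int n - 4) (- {j}))) =
       (1 - of_int (g1 a j) ^ 2) / 12 *
            ((S_fun (int n - 3) (del1 a j) - of_int (a ! j) * S_fun (int n - 4) (del1 a j))
              / of_int (D_prod (del1 a j))) +
       (of_int (g1 a j) - 1) / 4 *
            ((of_int (elem_sym 1 (del1 a j)) * S_fun (int n - 4) (del1 a j) - S_fun (int n - 3) (del1 a j))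
              / of_int (D_prod (del1 a j)))"
      unfolding s_def wt_sum_eq g_def del1_def .
  qed
  have T3: "(\<Sum>q | fst q < snd q \<and> snd q < n. - 1 * s (int n - 4) (- {fst q, snd q}) * zeta_sum a (fst q) (snd q)) =
      (\<Sum>(j, l) | j < l \<and> l < n.
            - S_fun (int n - 4) (del2 a j l) / of_int (D_prod (del2 a j l)) * zeta_sum a j l)"
    unfolding s_def del2_def split_def by simp
  show ?thesis unfolding gamma T1 T2 T3 by (simp only: add.assoc)
qed

end

theorem theorem6p4:
  fixes a :: "int list" and n k :: nat
  assumes "length a = n"
    and "Gcd (set a) = 1"
    and "0 < k" and "k < n"
    and "\<And>i. i < k \<Longrightarrow> a ! i < 0"
    and "\<And>i. k \<le> i \<Longrightarrow> i < n \<Longrightarrow> a ! i > 0"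
  shows
    "(gamma_coeff 2 a =
       (5 * of_int (elem_sym 1 a) * S_fun (int n - 3) a
          - (of_int (elem_sym 2 a) + of_int (elem_sym 1 a) ^ 2) * S_fun (int n - 4) a
          - 4 * S_fun (int n - 2) a) / (12 * of_int (D_prod a))
       + (\<Sum>j<n. (1 - of_int (g1 a j) ^ 2) / 12 *
            ((S_fun (int n - 3) (del1 a j) - of_int (a ! j) * S_fun (int n - 4) (del1 a j))
              / of_int (D_prod (del1 a j))))
       + (\<Sum>j<n. (of_int (g1 a j) - 1) / 4 *
            ((of_int (elem_sym 1 (del1 a j)) * S_fun (int n - 4) (del1 a j) - S_fun (int n - 3) (del1 a j))
              / of_int (D_prod (del1 a j))))
       + (\<Sum>(j, l) | j < l \<and> l < n.
            - S_fun (int n - 4) (del2 a j l) / of_int (D_prod (del2 a j l)) * zeta_sum a j l))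
    \<and> ((\<forall>i<k. \<forall>j<k. i \<noteq> j \<longrightarrow> a ! i \<noteq> a ! j) \<longrightarrow>
      gamma_coeff 2 a =
       (\<Sum>i<k. of_int (a ! i) powi (int n - 4)
            / (12 * (\<Prod>j\<in>{..<n} - {i}. of_int (a ! i - a ! j))) *
            ((\<Sum>j\<in>{..<n} - {i}. of_int ((2 * a ! i - a ! j) * a ! j))
             - 3 * (\<Sum>(j, l) | j < l \<and> l < n \<and> j \<noteq> i \<and> l \<noteq> i. of_int (a ! j * a ! l))))
       + (\<Sum>i<k. \<Sum>j\<in>{..<n} - {i}.
            (1 - of_int (g1 a j) ^ 2) * of_int (a ! i) powi (int n - 4) * of_int (a ! i - a ! j)
              / (12 * (\<Prod>l\<in>{..<n} - {i, j}. of_int (a ! i - a ! l)))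
            + (of_int (g1 a j) - 1) / 2 *
              (\<Sum>l\<in>{..<n} - {i, j}. of_int (a ! i) powi (int n - 4) * of_int (a ! l)
                 / (2 * (\<Prod>p\<in>{..<n} - {i, j}. of_int (a ! i - a ! p)))))
       + (\<Sum>i<k. \<Sum>(j, l) | j < l \<and> l < n \<and> j \<noteq> i \<and> l \<noteq> i.
            - (of_int (a ! i) powi (int n - 4))
              / (\<Prod>p\<in>{..<n} - {i, j, l}. of_int (a ! i - a ! p)) * zeta_sum a j l))"
proof -
  interpret torus_weights a n k
    by unfold_locales (use assms in auto)
  show ?thesis
    by (intro conjI impI gamma_2_general gamma_2_distinct assms(2)) blast
qed

end
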